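(* The Monophonic rank problem restricted to split graphs belongs to P.
   Context: All graphs are simple, finite and undirected. A set of vertices $S$ of a graph $G$ is monophonically convex if every induced path joining two vertices of $S$ is contained in $S$; the monophonic convex hull $\langle S\rangle$ is the smallest monophonically convex set containing $S$. A set $S$ is monophonic convexly independent if $v\notin\langle S-\{v\}\rangle$ for every $v\in S$. The Monophonic rank problem: given a graph $G$ and a positive integer $k$, does $G$ contain a monophonic convexly independent set with at least $k$ vertices? A split graph is a graph whose vertex set can be partitioned into a clique and an independent set (equivalently, a 1-starlike graph). *)

theory Defs
  imports
    "Graph_Theory.Graph_Theory"
    "HOL-Computational_Algebra.Polynomial"
begin

section \<open>Monophonic convexity\<close>

text \<open>
  A simple, finite, undirected graph is a \<open>pair_graph\<close>: a finite, loop-free digraph without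
  parallel arcs whose arc relation is symmetric.
\<close>

definition induced_path :: "'a pair_pre_digraph \<Rightarrow> 'a list \<Rightarrow> bool" where
  "induced_path G p \<longleftrightarrow> vpath p (with_proj G) \<and>
     (\<forall>i<length p. \<forall>j<length p. (p ! i, p ! j) \<in> parcs G \<longrightarrow> j = Suc i \<or> i = Suc j)"

definition monophonically_convex :: "'a pair_pre_digraph \<Rightarrow> 'a set \<Rightarrow> bool" where
  "monophonically_convex G S \<longleftrightarrow> S \<subseteq> pverts G \<and>
     (\<forall>p. induced_path G p \<and> hd p \<in> S \<and> last p \<in> S \<longrightarrow> set p \<subseteq> S)"

definition monophonic_hull :: "'a pair_pre_digraph \<Rightarrow> 'a set \<Rightarrow> 'a set" where
  "monophonic_hull G S = (monophonically_convex G) hull S"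

definition monophonic_convexly_independent :: "'a pair_pre_digraph \<Rightarrow> 'a set \<Rightarrow> bool" where
  "monophonic_convexly_independent G S \<longleftrightarrow>
     S \<subseteq> pverts G \<and> (\<forall>v\<in>S. v \<notin> monophonic_hull G (S - {v}))"

definition split_graph :: "'a pair_pre_digraph \<Rightarrow> bool" where
  "split_graph G \<longleftrightarrow> pair_graph G \<and>
     (\<exists>K I. K \<union> I = pverts G \<and> K \<inter> I = {} \<and>
        (\<forall>u\<in>K. \<forall>v\<in>K. u \<noteq> v \<longrightarrow> (u, v) \<in> parcs G) \<and>
        (\<forall>u\<in>I. \<forall>v\<in>I. (u, v) \<notin> parcs G))"

text \<open>The hull is the smallest convex set containing the given set.\<close>

lemma monophonically_convex_hull:
  assumes "S \<subseteq> pverts G"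
  shows "monophonically_convex G (monophonic_hull G S)"
    and "S \<subseteq> monophonic_hull G S"
    and "monophonically_convex G C \<Longrightarrow> S \<subseteq> C \<Longrightarrow> monophonic_hull G S \<subseteq> C"
proof -
  have "monophonically_convex G (pverts G)"
    by (auto simp: monophonically_convex_def induced_path_def vpath_def vwalk_def)
  then have sub: "monophonic_hull G S \<subseteq> pverts G"
    unfolding monophonic_hull_def by (intro hull_minimal assms)
  show "monophonically_convex G (monophonic_hull G S)"
    unfolding monophonically_convex_def
  proof (intro conjI sub allI impI)
    fix p
    assume p: "induced_path G p \<and> hd p \<in> monophonic_hull G S \<and> last p \<in> monophonic_hull G S"
    have "set p \<subseteq> C" if C: "monophonically_convex G C" "S \<subseteq> C" for C
    proof -
      have "monophonic_hull G S \<subseteq> C"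
        unfolding monophonic_hull_def using C by (intro hull_minimal)
      then show ?thesis
        using p C(1) unfolding monophonically_convex_def by (meson subsetD)
    qed
    then show "set p \<subseteq> monophonic_hull G S"
      unfolding monophonic_hull_def hull_def by (intro Inter_greatest) simp
  qed
qed (auto simp: monophonic_hull_def hull_def)

section \<open>The class P\<close>

text \<open>
  Deterministic Turing machines with finitely many two-way infinite tapes.  States and symbols are
  numbers below \<open>num_states\<close> and \<open>num_symbols\<close>.  Symbol 0 is the blank; 1 and 2 are the input bits.
\<close>

datatype move = Move_Left | Stay | Move_Right

record turing_machine =
  num_tapes :: nat
  num_states :: nat
  num_symbols :: nat
  start_state :: nat
  accept_state :: nat
  reject_state :: nat
  transition :: "nat \<Rightarrow> nat list \<Rightarrow> nat \<times> (nat \<times> move) list"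

text \<open>
  Since \<open>transition\<close> of a machine satisfying the predicate below is only ever applied to a state below \<open>num_states\<close> and to a list of
  \<open>num_tapes\<close> symbols below \<open>num_symbols\<close>, the relevant part of it is a finite table.
\<close>

definition turing_machine :: "turing_machine \<Rightarrow> bool" where
  "turing_machine M \<longleftrightarrow>
     num_tapes M \<ge> 1 \<and> num_symbols M \<ge> 3 \<and>
     start_state M < num_states M \<and> accept_state M < num_states M \<and>
     reject_state M < num_states M \<and> accept_state M \<noteq> reject_state M \<and>
     (\<forall>q ss. q < num_states M \<and> length ss = num_tapes M \<and> (\<forall>s\<in>set ss. s < num_symbols M) \<longrightarrow>
        (case transition M q ss of (q', acts) \<Rightarrow>
           q' < num_states M \<and> length acts = num_tapes M \<and>
           (\<forall>(s, d)\<in>set acts. s < num_symbols M)))"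

text \<open>A tape is given by its contents and the position of its head.\<close>

type_synonym tape = "(int \<Rightarrow> nat) \<times> int"
type_synonym config = "nat \<times> tape list"

fun move_head :: "move \<Rightarrow> int \<Rightarrow> int" where
  "move_head Move_Left h = h - 1"
| "move_head Stay h = h"
| "move_head Move_Right h = h + 1"

definition read_tape :: "tape \<Rightarrow> nat" where
  "read_tape = (\<lambda>(t, h). t h)"

definition act_tape :: "nat \<times> move \<Rightarrow> tape \<Rightarrow> tape" where
  "act_tape = (\<lambda>(s, d) (t, h). (t(h := s), move_head d h))"

definition halted :: "turing_machine \<Rightarrow> config \<Rightarrow> bool" where
  "halted M c \<longleftrightarrow> fst c \<in> {accept_state M, reject_state M}"

definition step :: "turing_machine \<Rightarrow> config \<Rightarrow> config" where
  "step M c =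
     (if halted M c then c
      else (case c of (q, ts) \<Rightarrow> case transition M q (map read_tape ts) of (q', acts) \<Rightarrow>
              (q', map2 act_tape acts ts)))"

definition blank_tape :: tape where
  "blank_tape = (\<lambda>_. 0, 0)"

definition input_tape :: "bool list \<Rightarrow> tape" where
  "input_tape w =
     (\<lambda>i. if 0 \<le> i \<and> i < int (length w) then (if w ! nat i then 2 else 1) else 0, 0)"

definition initial_config :: "turing_machine \<Rightarrow> bool list \<Rightarrow> config" where
  "initial_config M w = (start_state M, input_tape w # replicate (num_tapes M - 1) blank_tape)"

definition decides_in_time :: "turing_machine \<Rightarrow> bool list set \<Rightarrow> (nat \<Rightarrow> nat) \<Rightarrow> bool" where
  "decides_in_time M L T \<longleftrightarrow>
     (\<forall>w. let c = (step M ^^ T (length w)) (initial_config M w)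
          in halted M c \<and> (fst c = accept_state M \<longleftrightarrow> w \<in> L))"

definition class_P :: "bool list set set" where
  "class_P = {L. \<exists>M (p :: nat poly). turing_machine M \<and> decides_in_time M L (poly p)}"

section \<open>The decision problem\<close>

text \<open>Binary representation, least significant bit first and without leading zeros.\<close>

fun binary :: "nat \<Rightarrow> bool list" where
  "binary k = (if k = 0 then [] else odd k # binary (k div 2))"

declare binary.simps [simp del]

text \<open>
  An instance \<open>(G, k)\<close>, where the vertices of \<open>G\<close> are \<open>0, \<dots>, n - 1\<close>, is encoded by \<open>n\<close> in unary
  followed by a terminator, the adjacency matrix row by row, and finally \<open>k\<close> in binary.
\<close>

definition adjacency_bits :: "nat pair_pre_digraph \<Rightarrow> bool list" where
  "adjacency_bits G =
     (let n = card (pverts G)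
      in concat (map (\<lambda>i. map (\<lambda>j. (i, j) \<in> parcs G) [0..<n]) [0..<n]))"

definition encode_instance :: "nat pair_pre_digraph \<Rightarrow> nat \<Rightarrow> bool list" where
  "encode_instance G k =
     replicate (card (pverts G)) True @ False # adjacency_bits G @ binary k"

text \<open>The yes-instances whose graph is a split graph.\<close>

definition split_monophonic_rank :: "bool list set" where
  "split_monophonic_rank =
     {encode_instance G k | G k.
        split_graph G \<and> pverts G = {0..<card (pverts G)} \<and> k > 0 \<and>
        (\<exists>S. monophonic_convexly_independent G S \<and> card S \<ge> k)}"

text \<open>The encoding is injective on instances.\<close>

lemma binary_inject: "binary k = binary l \<longleftrightarrow> k = l"
proof
  show "binary k = binary l \<Longrightarrow> k = l"
  proof (induction k arbitrary: l rule: less_induct)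
    case (less k)
    show ?case
    proof (cases "k = 0 \<or> l = 0")
      case True
      then show ?thesis
        using less.prems binary.simps[of k] binary.simps[of l] by (auto split: if_splits)
    next
      case False
      then have "odd k = odd l" and "binary (k div 2) = binary (l div 2)"
        using less.prems binary.simps[of k] binary.simps[of l] by auto
      moreover have "k div 2 < k"
        using False by simp
      ultimately have "odd k = odd l" and "k div 2 = l div 2"
        using less.IH by blast+
      then show ?thesis
        by presburger
    qed
  qed
qed simp

lemma length_adjacency_bits:
  "length (adjacency_bits G) = card (pverts G) * card (pverts G)"
  by (simp add: adjacency_bits_def Let_def length_concat o_def sum_list_triv)

lemma encode_instance_inject:
  assumes "pair_graph G" "pverts G = {0..<card (pverts G)}"
    and "pair_graph H" "pverts H = {0..<card (pverts H)}"
    and eq: "encode_instance G k = encode_instance H l"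
  shows "G = H \<and> k = l"
proof -
  let ?n = "card (pverts G)" and ?m = "card (pverts H)"
  have tw: "takeWhile id (replicate a True @ False # xs) = replicate a True" for a xs
    by (induction a) auto
  have "replicate ?n True = replicate ?m True"
    using arg_cong[OF eq, of "takeWhile id"] by (simp only: encode_instance_def tw)
  then have nm: "?n = ?m"
    by (metis length_replicate)
  then have "adjacency_bits G @ binary k = adjacency_bits H @ binary l"
    using eq by (simp add: encode_instance_def)
  then have adj: "adjacency_bits G = adjacency_bits H" and kl: "binary k = binary l"
    using nm by (simp_all add: length_adjacency_bits)
  have "map (\<lambda>i. map (\<lambda>j. (i, j) \<in> parcs G) [0..<?n]) [0..<?n] =
        map (\<lambda>i. map (\<lambda>j. (i, j) \<in> parcs H) [0..<?n]) [0..<?n]"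
    using adj nm unfolding adjacency_bits_def Let_def
    by (intro concat_injective) (auto simp: set_zip)
  then have iff: "(i, j) \<in> parcs G \<longleftrightarrow> (i, j) \<in> parcs H" if "i < ?n" "j < ?n" for i j
    using that by simp
  have V: "pverts G = pverts H"
    using assms(2,4) nm by simp
  have G: "parcs G \<subseteq> {0..<?n} \<times> {0..<?n}"
  proof -
    interpret pair_graph G by fact
    show ?thesis using in_arcsD1 in_arcsD2 assms(2) by fastforce
  qed
  have H: "parcs H \<subseteq> {0..<?n} \<times> {0..<?n}"
  proof -
    interpret pair_graph H by fact
    show ?thesis using in_arcsD1 in_arcsD2 assms(2) V by fastforce
  qed
  have "parcs G = parcs H"
  proof (rule set_eqI)
    fix e :: "nat \<times> nat"
    show "e \<in> parcs G \<longleftrightarrow> e \<in> parcs H"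
      using iff[of "fst e" "snd e"] G H by (cases e) auto
  qed
  then show ?thesis
    using V kl binary_inject by (cases G; cases H) auto
qed

end

theory Submission
  imports Defs
begin

text \<open>
  In a split graph with clique \<open>K\<close> and independent set \<open>I\<close>, only vertices of \<open>K\<close> can be interior to an
  induced path.  This makes hulls explicit: \<open>S\<close> is convexly independent iff every edge between some
  \<open>t \<in> S \<inter> I\<close> and \<open>v \<in> S \<inter> K\<close> forces \<open>S \<inter> K \<subseteq> N(t)\<close>, and forces the other
  vertices \<open>i \<in> S \<inter> I\<close> to satisfy \<open>N(i) \<subseteq> N(t)\<close> and \<open>v \<notin> N(i)\<close>.  So \<open>S\<close> is either an
  independent set of the bipartite graph between \<open>I\<close> and \<open>K\<close>, or \<open>t\<close> together with an independent
  set of the bipartite graph between \<open>{i \<in> I - {t}. N(i) \<subseteq> N(t)}\<close> and \<open>N(t)\<close>, and the rank is the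
  largest of at most \<open>card I + 1\<close> bipartite independence numbers.

  A bipartite independence number is computed by an auction: an unmatched left vertex takes over its
  cheapest neighbour and raises its price by one, until every unmatched left vertex only sees
  neighbours at the maximal price.  By pigeonhole some price level \<open>l\<close> is not attained; the left
  vertices that are unmatched or pay more than \<open>l\<close>, together with the right vertices cheaper than
  \<open>l\<close>, form an independent set whose size equals the upper bound given by the matching.

  Polynomial time is obtained from a language of relational programs: loops run over a universe whose
  size is the length of the input, and basic steps redefine a relation by a first-order formula.
  Such programs always terminate, and they compile to Turing machines that run in polynomial time.
\<close>

section \<open>While programs on named tapes\<close>

text \<open>Augmenting paths would require reachability and backtracking, whereas a bid changes one
  owner and one price under a first-order condition; this is why an auction fits the program
  language. The universe consists of the positions of the input word. On a well-formed input it has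
  more than \<open>n\<close> elements, so it contains all vertices and also the dummy index
  \<open>n\<close>, and a threshold \<open>k\<close> outside it exceeds every possible rank. The
  partition into clique and independent set is not part of the input. It is built vertex by vertex,
  and the outcome is trusted only after a final validation, so the search phases only have to be
  right on split graphs.\<close>

datatype 'a prog =
    Act "('a \<Rightarrow> nat) \<Rightarrow> 'a \<Rightarrow> nat \<times> move"
  | Sequ "'a prog" "'a prog"  (infixr ";;" 60)
  | While "('a \<Rightarrow> nat) \<Rightarrow> bool" "'a prog"

definition act :: "(('a \<Rightarrow> nat) \<Rightarrow> 'a \<Rightarrow> nat \<times> move) \<Rightarrow> ('a \<Rightarrow> tape) \<Rightarrow> 'a \<Rightarrow> tape" where
  "act f T = (\<lambda>a. act_tape (f (\<lambda>b. read_tape (T b)) a) (T a))"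

text \<open>The count is exactly the number of machine steps: one per action and one per evaluated
  loop test. Sequencing is free, because the exit state of the first part is the entry state of the
  second.\<close>

inductive exec :: "'a prog \<Rightarrow> ('a \<Rightarrow> tape) \<Rightarrow> nat \<Rightarrow> ('a \<Rightarrow> tape) \<Rightarrow> bool" where
  exec_Act: "exec (Act f) T 1 (act f T)"
| exec_Sequ: "exec p T t T' \<Longrightarrow> exec p' T' t' T'' \<Longrightarrow> exec (p ;; p') T (t + t') T''"
| exec_While_False: "\<not> c (\<lambda>b. read_tape (T b)) \<Longrightarrow> exec (While c p) T 1 T"
| exec_While_True: "c (\<lambda>b. read_tape (T b)) \<Longrightarrow> exec p T t T' \<Longrightarrow> exec (While c p) T' t' T'' \<Longrightarrow>
    exec (While c p) T (1 + t + t') T''"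

text \<open>Four symbols suffice: the blank 0, the bits 1 and 2, and 3 as the left end marker
  introduced later.\<close>

primrec wf_prog :: "'a prog \<Rightarrow> bool" where
  "wf_prog (Act f) \<longleftrightarrow> (\<forall>r. (\<forall>a. r a < 4) \<longrightarrow> (\<forall>a. fst (f r a) < 4))"
| "wf_prog (p ;; p') \<longleftrightarrow> wf_prog p \<and> wf_prog p'"
| "wf_prog (While c p) \<longleftrightarrow> wf_prog p"

primrec psize :: "'a prog \<Rightarrow> nat" where
  "psize (Act f) = 1"
| "psize (p ;; p') = psize p + psize p'"
| "psize (While c p) = Suc (psize p)"

definition noop :: "('a \<Rightarrow> nat) \<Rightarrow> 'a \<Rightarrow> nat \<times> move" where
  "noop r = (\<lambda>a. (r a, Stay))"

text \<open>\<open>table p b e\<close> is the code of \<open>p\<close> placed at the states from \<open>b\<close> on, with exit state \<open>e\<close>.\<close>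

primrec table :: "'a prog \<Rightarrow> nat \<Rightarrow> nat \<Rightarrow> nat \<Rightarrow> ('a \<Rightarrow> nat) \<Rightarrow> nat \<times> ('a \<Rightarrow> nat \<times> move)" where
  "table (Act f) b e q r = (e, f r)"
| "table (p ;; p') b e q r =
     (if q < b + psize p then table p b (b + psize p) q r else table p' (b + psize p) e q r)"
| "table (While c p) b e q r =
     (if q = b then (if c r then Suc b else e, noop r) else table p (Suc b) b q r)"

lemma psize_pos [simp]: "0 < psize p"
  by (induction p) auto

text \<open>Control leaves a block only through its exit state, so the machine has a bounded set of
  states and a run cannot skip past its exit.\<close>

lemma table_range:
  assumes "b \<le> q" "q < b + psize p"
  shows "fst (table p b e q r) \<in> insert e {b..<b + psize p}"
  using assms
proof (induction p arbitrary: b e)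
  case (Sequ p p')
  show ?case
  proof (cases "q < b + psize p")
    case True
    then have "fst (table p b (b + psize p) q r) \<in> insert (b + psize p) {b..<b + psize p}"
      using Sequ.prems by (intro Sequ.IH(1)) auto
    then show ?thesis
      using True by auto
  next
    case False
    then have "fst (table p' (b + psize p) e q r) \<in> insert e {b + psize p..<b + psize p + psize p'}"
      using Sequ.prems by (intro Sequ.IH(2)) auto
    then show ?thesis
      using False by auto
  qed
next
  case (While c p)
  then show ?case
    using While.IH[of "Suc b" b] psize_pos[of p] by (cases "q = b") auto
qed auto

lemma table_symbols:
  assumes "wf_prog p" "\<forall>a. r a < 4"
  shows "fst (snd (table p b e q r) a) < 4"
  using assms by (induction p arbitrary: b e) (auto simp: noop_def)

definition table_step ::
  "(nat \<Rightarrow> ('a \<Rightarrow> nat) \<Rightarrow> nat \<times> ('a \<Rightarrow> nat \<times> move)) \<Rightarrow> nat \<times> ('a \<Rightarrow> tape) \<Rightarrow> nat \<times> ('a \<Rightarrow> tape)" where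
  "table_step \<Delta> = (\<lambda>(q, T). let r = (\<lambda>b. read_tape (T b)) in
     (fst (\<Delta> q r), (\<lambda>a. act_tape (snd (\<Delta> q r) a) (T a))))"

lemma act_noop: "act_tape (noop (\<lambda>b. read_tape (T b)) a) (T a) = T a"
  by (cases "T a") (auto simp: noop_def act_tape_def read_tape_def)

text \<open>\<open>\<Delta>\<close> only has to agree with the code on the block of
  \<open>p\<close>; a subprogram is thus handled by the induction hypothesis inside the table of the
  whole program.\<close>

lemma table_correct:
  assumes "exec p T t T'"
    and "\<And>q r. b \<le> q \<Longrightarrow> q < b + psize p \<Longrightarrow> \<Delta> q r = table p b e q r"
  shows "(table_step \<Delta> ^^ t) (b, T) = (e, T')"
  using assms
proof (induction arbitrary: b e rule: exec.induct)
  case (exec_Act f T)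
  then show ?case
    by (simp add: table_step_def act_def Let_def)
next
  case (exec_Sequ p T t T' p' t' T'')
  have "(table_step \<Delta> ^^ t) (b, T) = (b + psize p, T')"
    using exec_Sequ.prems by (intro exec_Sequ.IH(1)) auto
  moreover have "(table_step \<Delta> ^^ t') (b + psize p, T') = (e, T'')"
    using exec_Sequ.prems by (intro exec_Sequ.IH(2)) auto
  ultimately show ?case
    by (simp add: add.commute[of t t'] funpow_add)
next
  case (exec_While_False c T p)
  then show ?case
    using exec_While_False.prems[of b]
    by (simp add: table_step_def Let_def act_noop)
next
  case (exec_While_True c T p t T' t' T'')
  have 1: "table_step \<Delta> (b, T) = (Suc b, T)"
    using exec_While_True.prems[of b] exec_While_True.hyps(1)
    by (simp add: table_step_def Let_def act_noop)
  have 2: "(table_step \<Delta> ^^ t) (Suc b, T) = (b, T')"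
    using exec_While_True.prems by (intro exec_While_True.IH(1)) auto
  have 3: "(table_step \<Delta> ^^ t') (b, T') = (e, T'')"
    using exec_While_True.prems by (intro exec_While_True.IH(2)) auto
  have "1 + t + t' = t' + (t + 1)" by simp
  then show ?case
    by (simp only: funpow_add o_apply) (simp add: 1 2 3)
qed

text \<open>Tape names become positions in \<open>xs\<close>, and \<open>map_of\<close> undoes this
  for the symbols read. State \<open>psize p\<close> is the exit of the code: there the symbol under
  the head of \<open>a0\<close> selects acceptance or rejection, at the price of one extra
  step.\<close>

definition machine :: "'a list \<Rightarrow> 'a prog \<Rightarrow> 'a \<Rightarrow> turing_machine" where
  "machine xs p a0 =
     \<lparr>num_tapes = length xs, num_states = psize p + 3, num_symbols = 4, start_state = 0,
      accept_state = psize p + 1, reject_state = psize p + 2,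
      transition = (\<lambda>q ss. let r = (\<lambda>a. the (map_of (zip xs ss) a)) in
        if q < psize p then (fst (table p 0 (psize p) q r), map (snd (table p 0 (psize p) q r)) xs)
        else (if r a0 = 2 then psize p + 1 else psize p + 2, map (noop r) xs))\<rparr>"

lemma machine_wf:
  assumes "set xs = UNIV" "wf_prog p"
  shows "Defs.turing_machine (machine xs p a0)"
proof -
  have "xs \<noteq> []" using assms(1) by auto
  have lt: "the (map_of (zip xs ss) a) < 4" if len: "length ss = length xs" and "\<forall>s\<in>set ss. s < 4" for ss a
  proof -
    have "a \<in> set xs" using assms(1) by simp
    then obtain s where s: "map_of (zip xs ss) a = Some s"
      using map_of_zip_is_Some[OF len[symmetric], of a] by auto
    then have "s \<in> set ss"
      by (meson map_of_SomeD set_zip_rightD)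
    then show ?thesis
      using that(2) s by simp
  qed
  have st: "fst (table p 0 (psize p) q r) < psize p + 3" if "q < psize p" for q r
    using table_range[of 0 q p "psize p" r] that by auto
  have sym: "fst x < 4" if "length ss = length xs" "\<forall>s\<in>set ss. s < 4"
    "x \<in> set (snd (transition (machine xs p a0) q ss))" for q ss x
  proof -
    define r where "r = (\<lambda>a. the (map_of (zip xs ss) a))"
    have r: "\<forall>a. r a < 4" using lt[OF that(1,2)] by (simp add: r_def)
    have tr: "snd (transition (machine xs p a0) q ss) =
        (if q < psize p then map (snd (table p 0 (psize p) q r)) xs else map (noop r) xs)"
      by (simp add: machine_def r_def Let_def)
    show ?thesis
      using that(3) table_symbols[OF assms(2) r] r unfolding tr
      by (auto simp: noop_def split: if_splits)
  qed
  have state: "fst (transition (machine xs p a0) q ss) < psize p + 3" for q ss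
    using st by (simp add: machine_def Let_def)
  have len: "length (snd (transition (machine xs p a0) q ss)) = length xs" for q ss
    by (simp add: machine_def Let_def)
  have "num_symbols (machine xs p a0) = 4" "num_states (machine xs p a0) = psize p + 3"
    "num_tapes (machine xs p a0) = length xs"
    by (simp_all add: machine_def)
  moreover have "start_state (machine xs p a0) < psize p + 3"
    "accept_state (machine xs p a0) < psize p + 3" "reject_state (machine xs p a0) < psize p + 3"
    "accept_state (machine xs p a0) \<noteq> reject_state (machine xs p a0)"
    by (simp_all add: machine_def)
  moreover have "1 \<le> length xs"
    using \<open>xs \<noteq> []\<close> by (cases xs) auto
  ultimately show ?thesis
    unfolding Defs.turing_machine_def
    using sym state len by (auto simp: case_prod_beta)
qed

lemma machine_step:
  assumes "set xs = UNIV" "q \<le> psize p"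
  shows "step (machine xs p a0) (q, map T xs) =
    (if q < psize p then (\<lambda>(q', T'). (q', map T' xs)) (table_step (table p 0 (psize p)) (q, T))
     else (if read_tape (T a0) = 2 then psize p + 1 else psize p + 2, map T xs))"
proof -
  have r: "(\<lambda>a. the (map_of (zip xs (map (\<lambda>x. read_tape (T x)) xs)) a)) = (\<lambda>b. read_tape (T b))"
    using assms(1) by (auto simp: map_of_zip_map)
  have m: "map2 f (map g xs) (map h xs) = map (\<lambda>x. f (g x) (h x)) xs" for f :: "'x \<Rightarrow> 'y \<Rightarrow> 'z" and g h
    by (induction xs) auto
  show ?thesis
    using assms(2) r[THEN fun_cong, of a0]
    by (auto simp: step_def halted_def machine_def Let_def o_def r table_step_def m act_noop)
qed

definition halting_table :: "'a prog \<Rightarrow> nat \<Rightarrow> ('a \<Rightarrow> nat) \<Rightarrow> nat \<times> ('a \<Rightarrow> nat \<times> move)" where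
  "halting_table p q r = (if q < psize p then table p 0 (psize p) q r else (q, noop r))"

text \<open>\<open>halting_table\<close> idles in the exit state, whereas the machine goes on to its
  verdict. The number \<open>n\<close> is the moment of arrival at the exit; the idle steps after it
  do not change the tapes.\<close>

lemma machine_run:
  assumes "set xs = UNIV" "q \<le> psize p"
    and "(table_step (halting_table p) ^^ t) (q, T) = (psize p, T')"
  shows "\<exists>n\<le>t. (step (machine xs p a0) ^^ n) (q, map T xs) = (psize p, map T' xs)"
  using assms(2,3)
proof (induction t arbitrary: q T)
  case (Suc t)
  obtain q1 T1 where q1: "table_step (halting_table p) (q, T) = (q1, T1)"
    by fastforce
  have rest: "(table_step (halting_table p) ^^ t) (q1, T1) = (psize p, T')"
    using Suc.prems(2) q1 by (simp add: funpow_Suc_right del: funpow.simps)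
  show ?case
  proof (cases "q < psize p")
    case True
    have "q1 \<le> psize p"
      using q1 table_range[of 0 q p "psize p" "\<lambda>b. read_tape (T b)"] True
      by (auto simp: table_step_def Let_def halting_table_def)
    then obtain n where n: "n \<le> t"
      "(step (machine xs p a0) ^^ n) (q1, map T1 xs) = (psize p, map T' xs)"
      using Suc.IH[OF _ rest] by blast
    have "step (machine xs p a0) (q, map T xs) = (q1, map T1 xs)"
      using machine_step[OF assms(1) Suc.prems(1), of a0 T] True q1
      by (simp add: table_step_def Let_def halting_table_def)
    then have "(step (machine xs p a0) ^^ Suc n) (q, map T xs) = (psize p, map T' xs)"
      using n(2) by (simp add: funpow_Suc_right del: funpow.simps)
    then show ?thesis using n(1) by (metis Suc_le_mono)
  next
    case False
    then have "table_step (halting_table p) (q, T) = (q, T)"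
      by (simp add: table_step_def Let_def halting_table_def act_noop)
    moreover then have "(table_step (halting_table p) ^^ m) (q, T) = (q, T)" for m
      by (induction m) auto
    ultimately have "q = psize p \<and> T = T'" using Suc.prems(2) by (metis Pair_inject)
    then show ?thesis by (metis funpow_0 zero_le)
  qed
qed (auto intro: exI[of _ 0])

definition initial_tapes :: "'a \<Rightarrow> bool list \<Rightarrow> 'a \<Rightarrow> tape" where
  "initial_tapes inp w = (\<lambda>a. if a = inp then input_tape w else blank_tape)"

lemma halted_funpow:
  "halted M c \<Longrightarrow> (step M ^^ n) c = c"
  by (induction n) (auto simp: step_def)

text \<open>A decider is inspected at exactly the prescribed time, while a run may be shorter: a
  halted configuration is a fixed point, so surplus steps are harmless.\<close>

lemma class_P_I:
  fixes p :: "'a :: finite prog" and P :: "nat poly"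
  assumes "wf_prog p"
    and run: "\<And>w. \<exists>T t. t \<le> poly P (length w) \<and> exec p (initial_tapes inp w) t T \<and>
      (read_tape (T a0) = 2 \<longleftrightarrow> w \<in> L)"
  shows "L \<in> class_P"
proof -
  obtain ys :: "'a list" where ys: "set ys = UNIV - {inp}" "distinct ys"
    using finite_distinct_list[of "UNIV - {inp}"] by auto
  \<comment> \<open>The machine model places the input on its first tape.\<close>
  define xs where "xs = inp # ys"
  have xs: "set xs = UNIV" using ys by (auto simp: xs_def)
  let ?M = "machine xs p a0"
  have "decides_in_time ?M L (poly (P + 1))"
    unfolding decides_in_time_def Let_def
  proof
    fix w
    obtain T t where T: "t \<le> poly P (length w)" "exec p (initial_tapes inp w) t T"
      "read_tape (T a0) = 2 \<longleftrightarrow> w \<in> L" using run by blast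
    have "map (initial_tapes inp w) ys = replicate (length ys) blank_tape"
      by (rule replicate_eqI) (use ys in \<open>auto simp: initial_tapes_def\<close>)
    then have init: "initial_config ?M w = (0, map (initial_tapes inp w) xs)"
      by (simp only: initial_config_def) (simp add: machine_def xs_def initial_tapes_def)
    have "(table_step (halting_table p) ^^ t) (0, initial_tapes inp w) = (psize p, T)"
      by (rule table_correct[OF T(2)]) (simp add: halting_table_def)
    then obtain n where n: "n \<le> t"
      "(step ?M ^^ n) (initial_config ?M w) = (psize p, map T xs)"
      using machine_run[OF xs, of 0 p t _ T a0] init by auto
    define c where "c = (if read_tape (T a0) = 2 then psize p + 1 else psize p + 2, map T xs)"
    have c: "(step ?M ^^ Suc n) (initial_config ?M w) = c"
      using n(2) machine_step[OF xs, of "psize p" p a0 T] by (simp add: c_def)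
    have h: "halted ?M c" "fst c = accept_state ?M \<longleftrightarrow> w \<in> L"
      using T(3) by (auto simp: c_def halted_def machine_def)
    have "poly (P + 1) (length w) = (poly P (length w) - n) + Suc n"
      using n(1) T(1) by simp
    then obtain d where "poly (P + 1) (length w) = d + Suc n" ..
    then have "(step ?M ^^ poly (P + 1) (length w)) (initial_config ?M w) = c"
      using c halted_funpow[OF h(1)] by (simp only: funpow_add o_apply)
    then show "halted ?M ((step ?M ^^ poly (P + 1) (length w)) (initial_config ?M w)) \<and>
      (fst ((step ?M ^^ poly (P + 1) (length w)) (initial_config ?M w)) = accept_state ?M) = (w \<in> L)"
      using h by simp
  qed
  then show ?thesis
    using machine_wf[OF xs assms(1)] unfolding class_P_def by blast
qed

section \<open>Tapes with a left end marker\<close>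

text \<open>In \<open>lift C H\<close> position 0 is the tape cell left of the input; it will hold the marker 3.\<close>

definition lift :: "('a \<Rightarrow> nat \<Rightarrow> nat) \<Rightarrow> ('a \<Rightarrow> nat) \<Rightarrow> 'a \<Rightarrow> tape" where
  "lift C H = (\<lambda>a. (\<lambda>z. if z < -1 then 0 else C a (nat (z + 1)), int (H a) - 1))"

text \<open>The time is an upper bound rather than an exact count, so that data-dependent costs can
  be relaxed to bounds in \<open>N\<close> alone when programs are composed.\<close>

definition run ::
  "'a prog \<Rightarrow> ('a \<Rightarrow> nat \<Rightarrow> nat) \<Rightarrow> ('a \<Rightarrow> nat) \<Rightarrow> ('a \<Rightarrow> nat \<Rightarrow> nat) \<Rightarrow> ('a \<Rightarrow> nat) \<Rightarrow> nat \<Rightarrow> bool" where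
  "run p C H C' H' t \<longleftrightarrow> (\<exists>t'\<le>t. exec p (lift C H) t' (lift C' H'))"

fun nat_move :: "move \<Rightarrow> nat \<Rightarrow> nat" where
  "nat_move Move_Left h = h - 1"
| "nat_move Stay h = h"
| "nat_move Move_Right h = h + 1"

lemma read_lift: "(\<lambda>b. read_tape (lift C H b)) = (\<lambda>b. C b (H b))"
  by (auto simp: read_tape_def lift_def)

text \<open>\<open>lift\<close> describes head positions from the marker cell on, hence the premise
  that no head at position 0 moves left.\<close>

lemma run_Act:
  assumes "\<And>a. snd (f (\<lambda>b. C b (H b)) a) = Move_Left \<Longrightarrow> 0 < H a"
  shows "run (Act f) C H (\<lambda>a. (C a)(H a := fst (f (\<lambda>b. C b (H b)) a)))
    (\<lambda>a. nat_move (snd (f (\<lambda>b. C b (H b)) a)) (H a)) 1"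
proof -
  have "act_tape (s, d) (lift C H a) =
      (\<lambda>z. if z < -1 then 0 else ((C a)(H a := s)) (nat (z + 1)), int (nat_move d (H a)) - 1)"
    if "d = Move_Left \<Longrightarrow> 0 < H a" for s d a
    using that by (cases d) (auto simp: act_tape_def lift_def fun_eq_iff)
  note move = this
  have "act f (lift C H) = lift (\<lambda>a. (C a)(H a := fst (f (\<lambda>b. C b (H b)) a)))
    (\<lambda>a. nat_move (snd (f (\<lambda>b. C b (H b)) a)) (H a))"
  proof (rule ext)
    fix a
    obtain s d where sd: "f (\<lambda>b. C b (H b)) a = (s, d)" by fastforce
    show "act f (lift C H) a = lift (\<lambda>a. (C a)(H a := fst (f (\<lambda>b. C b (H b)) a)))
      (\<lambda>a. nat_move (snd (f (\<lambda>b. C b (H b)) a)) (H a)) a"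
      unfolding act_def read_lift sd
      by (subst move) (use assms[of a] sd in \<open>auto simp: lift_def\<close>)
  qed
  then show ?thesis
    using exec_Act[of f "lift C H"] by (auto simp: run_def)
qed

lemma run_mono: "run p C H C' H' t \<Longrightarrow> t \<le> t' \<Longrightarrow> run p C H C' H' t'"
  unfolding run_def by (meson le_trans)

lemma run_Sequ: "run p C H C' H' t \<Longrightarrow> run p' C' H' C'' H'' t' \<Longrightarrow> run (p ;; p') C H C'' H'' (t + t')"
  unfolding run_def by (meson add_mono exec_Sequ)

lemma run_While_False: "\<not> c (\<lambda>b. C b (H b)) \<Longrightarrow> run (While c p) C H C H 1"
  using exec_While_False[of c "lift C H" p] by (auto simp: run_def read_lift)

lemma run_While_True:
  assumes "c (\<lambda>b. C b (H b))" "run p C H C' H' t" "run (While c p) C' H' C'' H'' t'"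
  shows "run (While c p) C H C'' H'' (1 + t + t')"
proof -
  obtain s s' where "s \<le> t" "s' \<le> t'" "exec p (lift C H) s (lift C' H')"
    "exec (While c p) (lift C' H') s' (lift C'' H'')"
    using assms(2,3) by (auto simp: run_def)
  then show ?thesis
    using exec_While_True[of c "lift C H" p s "lift C' H'" s'] assms(1)
    by (auto simp: run_def read_lift intro!: exI[of _ "1 + s + s'"])
qed

definition marked :: "('a \<Rightarrow> nat \<Rightarrow> nat) \<Rightarrow> bool" where
  "marked C \<longleftrightarrow> (\<forall>a p. C a p = 3 \<longleftrightarrow> p = 0)"

text \<open>A head that reads the marker does not move left, so left moves act as truncated
  subtraction on positions.\<close>

definition Shift :: "'a set \<Rightarrow> 'a set \<Rightarrow> 'a prog" where
  "Shift l r = Act (\<lambda>\<rho> a. (\<rho> a, if a \<in> l then if \<rho> a = 3 then Stay else Move_Left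
     else if a \<in> r then Move_Right else Stay))"

text \<open>Head positions serve as registers. While \<open>i\<close> counts down to 0, the heads in
  \<open>l\<close> are decreased by its value and those in \<open>r\<close> are increased by it;
  this one loop yields addition, truncated subtraction and rewinding.\<close>

definition drain :: "'a \<Rightarrow> 'a set \<Rightarrow> 'a set \<Rightarrow> 'a prog" where
  "drain i l r = While (\<lambda>\<rho>. \<rho> i \<noteq> 3) (Shift (insert i l) r)"

definition Write :: "'a \<Rightarrow> (('a \<Rightarrow> nat) \<Rightarrow> nat) \<Rightarrow> 'a prog" where
  "Write i f = Act (\<lambda>\<rho> a. (if a = i then f \<rho> else \<rho> a, Stay))"

lemma run_Shift_right: "run (Shift {} r) C H C (\<lambda>a. if a \<in> r then H a + 1 else H a) 1"
proof -
  define f where "f = (\<lambda>\<rho> a. (\<rho> a, if a \<in> {} then if \<rho> a = (3::nat) then Stay else Move_Left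
     else if a \<in> r then Move_Right else Stay))"
  have "run (Act f) C H (\<lambda>a. (C a)(H a := fst (f (\<lambda>b. C b (H b)) a)))
    (\<lambda>a. nat_move (snd (f (\<lambda>b. C b (H b)) a)) (H a)) 1"
    by (intro run_Act) (auto simp: f_def split: if_splits)
  moreover have "(\<lambda>a. (C a)(H a := fst (f (\<lambda>b. C b (H b)) a))) = C"
    by (auto simp: f_def)
  moreover have "(\<lambda>a. nat_move (snd (f (\<lambda>b. C b (H b)) a)) (H a)) =
      (\<lambda>a. if a \<in> r then H a + 1 else H a)"
    by (auto simp: f_def)
  ultimately show ?thesis by (simp add: Shift_def f_def)
qed

lemma run_Shift:
  assumes "marked C"
  shows "run (Shift l r) C H C (\<lambda>a. if a \<in> l then H a - 1 else if a \<in> r then H a + 1 else H a) 1"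
proof -
  define f where "f = (\<lambda>\<rho> a. (\<rho> a, if a \<in> l then if \<rho> a = (3::nat) then Stay else Move_Left
     else if a \<in> r then Move_Right else Stay))"
  have "run (Act f) C H (\<lambda>a. (C a)(H a := fst (f (\<lambda>b. C b (H b)) a)))
    (\<lambda>a. nat_move (snd (f (\<lambda>b. C b (H b)) a)) (H a)) 1"
    using assms by (intro run_Act) (auto simp: f_def marked_def split: if_splits)
  moreover have "(\<lambda>a. (C a)(H a := fst (f (\<lambda>b. C b (H b)) a))) = C"
    by (auto simp: f_def)
  moreover have "(\<lambda>a. nat_move (snd (f (\<lambda>b. C b (H b)) a)) (H a)) =
      (\<lambda>a. if a \<in> l then H a - 1 else if a \<in> r then H a + 1 else H a)"
    using assms by (auto simp: f_def marked_def)
  ultimately show ?thesis by (simp add: Shift_def f_def)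
qed

lemma run_drain:
  assumes "marked C"
  shows "run (drain i l r) C H C
    (\<lambda>a. if a \<in> insert i l then H a - H i else if a \<in> r then H a + H i else H a) (2 * H i + 1)"
proof (induction "H i" arbitrary: H)
  case 0
  have "run (drain i l r) C H C H 1"
    unfolding drain_def by (rule run_While_False) (use assms 0 in \<open>simp add: marked_def\<close>)
  moreover have "(\<lambda>a. if a \<in> insert i l then H a - H i else if a \<in> r then H a + H i else H a) = H"
    using 0 by auto
  ultimately show ?case using 0 by simp
next
  case (Suc n)
  define H1 where "H1 = (\<lambda>a. if a \<in> insert i l then H a - 1 else if a \<in> r then H a + 1 else H a)"
  have 1: "run (Shift (insert i l) r) C H C H1 1"
    using run_Shift[OF assms, of "insert i l" r H] by (simp add: H1_def)
  have "n = H1 i" using Suc.hyps(2) by (simp add: H1_def)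
  from Suc.hyps(1)[of H1, OF this] have 2: "run (drain i l r) C H1 C
    (\<lambda>a. if a \<in> insert i l then H1 a - H1 i else if a \<in> r then H1 a + H1 i else H1 a) (2 * n + 1)"
    using \<open>n = H1 i\<close> by simp
  have "run (drain i l r) C H C
    (\<lambda>a. if a \<in> insert i l then H1 a - H1 i else if a \<in> r then H1 a + H1 i else H1 a) (1 + 1 + (2 * n + 1))"
    unfolding drain_def
    by (rule run_While_True[OF _ 1]) (use assms Suc.hyps(2) 2 in \<open>auto simp: marked_def drain_def\<close>)
  moreover have "(\<lambda>a. if a \<in> insert i l then H1 a - H1 i else if a \<in> r then H1 a + H1 i else H1 a) =
      (\<lambda>a. if a \<in> insert i l then H a - H i else if a \<in> r then H a + H i else H a)"
    unfolding H1_def using Suc.hyps(2) by auto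
  ultimately show ?case using Suc.hyps(2)[symmetric] by simp
qed

lemma run_Write: "run (Write i f) C H (C(i := (C i)(H i := f (\<lambda>b. C b (H b))))) H 1"
proof -
  define g where "g = (\<lambda>\<rho> a. (if a = i then f \<rho> else \<rho> a, Stay))"
  have "run (Act g) C H (\<lambda>a. (C a)(H a := fst (g (\<lambda>b. C b (H b)) a)))
    (\<lambda>a. nat_move (snd (g (\<lambda>b. C b (H b)) a)) (H a)) 1"
    by (intro run_Act) (auto simp: g_def)
  moreover have "(\<lambda>a. (C a)(H a := fst (g (\<lambda>b. C b (H b)) a))) = C(i := (C i)(H i := f (\<lambda>b. C b (H b))))"
    by (auto simp: g_def)
  ultimately show ?thesis by (simp add: Write_def g_def)
qed

text \<open>The bound \<open>N\<close> is stored in unary: tape \<open>d\<close> carries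
  \<open>N\<close> ones and then a blank, so the walk of its head to the blank makes
  \<open>N\<close> rounds. The head position is at the same time the loop variable, shifted by one
  because cell 0 is the marker.\<close>

definition loop :: "'a \<Rightarrow> 'a prog \<Rightarrow> 'a prog" where
  "loop d p = Shift {} {d} ;; While (\<lambda>\<rho>. \<rho> d \<noteq> 0) (p ;; Shift {} {d}) ;; drain d {} {}"

definition counts :: "nat \<Rightarrow> (nat \<Rightarrow> nat) \<Rightarrow> bool" where
  "counts N c \<longleftrightarrow> (\<forall>p\<in>{1..N}. c p = 1) \<and> c (Suc N) = 0"

text \<open>\<open>P\<close> describes the configuration with \<open>d\<close> at rest, although
  during round \<open>i\<close> its head is at \<open>Suc i\<close>; this is why the body runs with
  \<open>d\<close> overwritten on both sides. Each round costs a test and an advance besides the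
  body, and the final rewinding adds two more steps per cell.\<close>

lemma run_loop:
  assumes body: "\<And>i C H. i < N \<Longrightarrow> P i C H \<Longrightarrow>
      \<exists>C' H'. run p C (H(d := Suc i)) C' (H'(d := Suc i)) t \<and> P (Suc i) C' H'"
    and inv: "\<And>i C H. P i C H \<Longrightarrow> H d = 0 \<and> marked C \<and> counts N (C d)"
    and "P 0 C H"
  shows "\<exists>C' H'. run (loop d p) C H C' H' (N * (t + 4) + 6) \<and> P N C' H'"
proof -
  let ?W = "While (\<lambda>\<rho>. \<rho> d \<noteq> 0) (p ;; Shift {} {d})"
  have W: "\<exists>C' H'. run ?W C (H(d := Suc i)) C' (H'(d := Suc N)) ((N - i) * (t + 2) + 1) \<and> P N C' H'"
    if "P i C H" "i \<le> N" for i C H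
    using that(2,1)
  proof (induction i arbitrary: C H rule: inc_induct)
    case base
    have "run ?W C (H(d := Suc N)) C (H(d := Suc N)) 1"
      by (rule run_While_False) (use inv[OF base] in \<open>simp add: counts_def\<close>)
    then show ?case using base
      by (intro exI[of _ C] exI[of _ H] conjI) (simp_all del: fun_upd_apply)
  next
    case (step i)
    obtain C1 H1 where 1: "run p C (H(d := Suc i)) C1 (H1(d := Suc i)) t" "P (Suc i) C1 H1"
      using body[OF step.hyps(2) step.prems] by blast
    have "(\<lambda>a. if a \<in> {d} then (H1(d := Suc i)) a + 1 else (H1(d := Suc i)) a) = H1(d := Suc (Suc i))"
      by auto
    then have 2: "run (Shift {} {d}) C1 (H1(d := Suc i)) C1 (H1(d := Suc (Suc i))) 1"
      using run_Shift_right[of "{d}" C1 "H1(d := Suc i)"] by (simp del: fun_upd_apply)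
    obtain C2 H2 where 3: "run ?W C1 (H1(d := Suc (Suc i))) C2 (H2(d := Suc N)) ((N - Suc i) * (t + 2) + 1)"
      "P N C2 H2"
      using step.IH[OF 1(2)] by blast
    have "run ?W C (H(d := Suc i)) C2 (H2(d := Suc N)) (1 + (t + 1) + ((N - Suc i) * (t + 2) + 1))"
      by (rule run_While_True[OF _ run_Sequ[OF 1(1) 2] 3(1)])
        (use inv[OF step.prems] step.hyps(2) in \<open>auto simp: counts_def\<close>)
    moreover have "1 + (t + 1) + ((N - Suc i) * (t + 2) + 1) = (N - i) * (t + 2) + 1"
      using step.hyps(2) by (subst Suc_diff_Suc[symmetric, of i N]) auto
    ultimately show ?case using 3(2) by metis
  qed
  obtain C' H' where W': "run ?W C (H(d := Suc 0)) C' (H'(d := Suc N)) (N * (t + 2) + 1)" "P N C' H'"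
    using W[OF assms(3)] by auto
  have "(\<lambda>a. if a \<in> {d} then H a + 1 else H a) = H(d := Suc 0)"
    using inv[OF assms(3)] by auto
  then have 1: "run (Shift {} {d}) C H C (H(d := Suc 0)) 1"
    using run_Shift_right[of "{d}" C H] by simp
  have "(\<lambda>a. if a \<in> insert d {} then (H'(d := Suc N)) a - (H'(d := Suc N)) d else
      if a \<in> {} then (H'(d := Suc N)) a + (H'(d := Suc N)) d else (H'(d := Suc N)) a) = H'"
    using inv[OF W'(2)] by auto
  then have 2: "run (drain d {} {}) C' (H'(d := Suc N)) C' H' (2 * Suc N + 1)"
    using run_drain[of C' d "{}" "{}" "H'(d := Suc N)"] inv[OF W'(2)] by simp
  show ?thesis
    unfolding loop_def
    by (intro exI conjI, rule run_mono[OF run_Sequ[OF 1 run_Sequ[OF W'(1) 2]]])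
      (use W'(2) in \<open>auto simp: algebra_simps\<close>)
qed

section \<open>Polynomially bounded functions\<close>

definition poly_bounded :: "(nat \<Rightarrow> nat) \<Rightarrow> bool" where
  "poly_bounded f \<longleftrightarrow> (\<exists>P :: nat poly. \<forall>N. f N \<le> poly P N)"

named_theorems poly_bounded_intros

lemma poly_bounded_const [poly_bounded_intros]: "poly_bounded (\<lambda>_. c)"
  unfolding poly_bounded_def by (rule exI[of _ "[:c:]"]) simp

lemma poly_bounded_id [poly_bounded_intros]: "poly_bounded (\<lambda>N. N)"
  unfolding poly_bounded_def by (rule exI[of _ "[:0, 1:]"]) simp

lemma poly_bounded_add [poly_bounded_intros]:
  "poly_bounded f \<Longrightarrow> poly_bounded g \<Longrightarrow> poly_bounded (\<lambda>N. f N + g N)"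
  unfolding poly_bounded_def
proof (elim exE)
  fix P Q :: "nat poly"
  assume "\<forall>N. f N \<le> poly P N" "\<forall>N. g N \<le> poly Q N"
  then show "\<exists>P. \<forall>N. f N + g N \<le> poly P N"
    by (intro exI[of _ "P + Q"]) (auto intro: add_mono)
qed

lemma poly_bounded_mult [poly_bounded_intros]:
  "poly_bounded f \<Longrightarrow> poly_bounded g \<Longrightarrow> poly_bounded (\<lambda>N. f N * g N)"
  unfolding poly_bounded_def
proof (elim exE)
  fix P Q :: "nat poly"
  assume "\<forall>N. f N \<le> poly P N" "\<forall>N. g N \<le> poly Q N"
  then show "\<exists>P. \<forall>N. f N * g N \<le> poly P N"
    by (intro exI[of _ "P * Q"]) (auto intro: mult_le_mono)
qed

section \<open>Relational programs and their compilation\<close>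

datatype ('r, 'v) fm =
    Rel 'r "'v list"
  | Less 'v 'v
  | Neg "('r, 'v) fm"
  | Conj "('r, 'v) fm" "('r, 'v) fm"
  | Ex 'v "('r, 'v) fm"

datatype ('r, 'v) cmd =
    Upd 'r "'v list" "('r, 'v) fm"
  | Then "('r, 'v) cmd" "('r, 'v) cmd"  (infixr "then\<^sub>c" 50)
  | For 'v "('r, 'v) cmd"

type_synonym 'r memory = "'r \<Rightarrow> nat list \<Rightarrow> bool"

primrec holds :: "nat \<Rightarrow> 'r memory \<Rightarrow> ('v \<Rightarrow> nat) \<Rightarrow> ('r, 'v) fm \<Rightarrow> bool" where
  "holds N m env (Rel r xs) \<longleftrightarrow> m r (map env xs)"
| "holds N m env (Less x y) \<longleftrightarrow> env x < env y"
| "holds N m env (Neg \<phi>) \<longleftrightarrow> \<not> holds N m env \<phi>"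
| "holds N m env (Conj \<phi> \<psi>) \<longleftrightarrow> holds N m env \<phi> \<and> holds N m env \<psi>"
| "holds N m env (Ex x \<phi>) \<longleftrightarrow> (\<exists>i<N. holds N m (env(x := i)) \<phi>)"

primrec upds :: "('v \<Rightarrow> nat) \<Rightarrow> 'v list \<Rightarrow> nat list \<Rightarrow> 'v \<Rightarrow> nat" where
  "upds env [] ys = env"
| "upds env (x # xs) ys = upds (env(x := hd ys)) xs (tl ys)"

definition tuples :: "nat \<Rightarrow> nat \<Rightarrow> nat list set" where
  "tuples N k = {ys. length ys = k \<and> set ys \<subseteq> {..<N}}"

primrec sem :: "nat \<Rightarrow> ('r, 'v) cmd \<Rightarrow> ('v \<Rightarrow> nat) \<Rightarrow> 'r memory \<Rightarrow> 'r memory" where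
  "sem N (Upd r xs \<phi>) env m =
     m(r := \<lambda>ys. if ys \<in> tuples N (length xs) then holds N m (upds env xs ys) \<phi> else m r ys)"
| "sem N (c then\<^sub>c c') env m = sem N c' env (sem N c env m)"
| "sem N (For x c) env m = fold (\<lambda>i. sem N c (env(x := i))) [0..<N] m"

text \<open>A bound variable lives in the head position of its own tape. Rebinding it inside its
  scope would destroy the outer value, hence binders must be fresh.\<close>

primrec wf_fm :: "('r \<Rightarrow> nat) \<Rightarrow> 'v set \<Rightarrow> ('r, 'v) fm \<Rightarrow> bool" where
  "wf_fm ar V (Rel r xs) \<longleftrightarrow> length xs = ar r \<and> set xs \<subseteq> V"
| "wf_fm ar V (Less x y) \<longleftrightarrow> x \<in> V \<and> y \<in> V \<and> x \<noteq> y"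
| "wf_fm ar V (Neg \<phi>) \<longleftrightarrow> wf_fm ar V \<phi>"
| "wf_fm ar V (Conj \<phi> \<psi>) \<longleftrightarrow> wf_fm ar V \<phi> \<and> wf_fm ar V \<psi>"
| "wf_fm ar V (Ex x \<phi>) \<longleftrightarrow> x \<notin> V \<and> wf_fm ar (insert x V) \<phi>"

primrec wf_cmd :: "('r \<Rightarrow> nat) \<Rightarrow> 'v set \<Rightarrow> ('r, 'v) cmd \<Rightarrow> bool" where
  "wf_cmd ar V (Upd r xs \<phi>) \<longleftrightarrow> length xs = ar r \<and> xs \<noteq> [] \<and> distinct xs \<and> set xs \<inter> V = {} \<and>
     wf_fm ar (V \<union> set xs) \<phi>"
| "wf_cmd ar V (c then\<^sub>c c') \<longleftrightarrow> wf_cmd ar V c \<and> wf_cmd ar V c'"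
| "wf_cmd ar V (For x c) \<longleftrightarrow> x \<notin> V \<and> wf_cmd ar (insert x V) c"

text \<open>\<open>Arr\<close> and \<open>Sh\<close> hold a relation and its shadow copy, one cell
  per tuple; the head of \<open>Var x\<close> holds the value of \<open>x\<close>.
  \<open>Stack\<close> keeps truth values of subformulas and \<open>Hold\<close> the second operand
  of a connective. \<open>Counter\<close> is the unary bound for multiplications;
  \<open>Scratch\<close> and \<open>Diff\<close> are registers.\<close>

datatype ('r, 'v) tp = Arr 'r | Sh 'r | Var 'v | Stack | Hold | Counter | Scratch | Diff

instance tp :: (finite, finite) finite
proof
  have "x \<in> range Arr \<union> range Sh \<union> range Var \<union> {Stack, Hold, Counter, Scratch, Diff}"
    for x :: "('a, 'b) tp"
    by (cases x) auto
  then have "(UNIV :: ('a, 'b) tp set) \<subseteq>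
      range Arr \<union> range Sh \<union> range Var \<union> {Stack, Hold, Counter, Scratch, Diff}"
    by blast
  then show "finite (UNIV :: ('a, 'b) tp set)"
    by (rule finite_subset) simp
qed

section \<open>Head arithmetic and the compiler\<close>

definition addN :: "('r, 'v) tp \<Rightarrow> ('r, 'v) tp prog" where
  "addN a = loop Counter (Shift {} {a})"

definition mulN :: "('r, 'v) tp \<Rightarrow> ('r, 'v) tp prog" where
  "mulN a = While (\<lambda>\<rho>. \<rho> a \<noteq> 3) (Shift {a} {} ;; addN Scratch) ;; drain Scratch {} {a}"

definition add :: "('r, 'v) tp \<Rightarrow> ('r, 'v) tp \<Rightarrow> ('r, 'v) tp prog" where
  "add a x = drain x {} {a, Scratch} ;; drain Scratch {} {x}"

text \<open>Horner's scheme in base \<open>N\<close> on the head position of \<open>a\<close>, with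
  the head positions of \<open>xs\<close> as digits.\<close>

primrec go :: "('r, 'v) tp \<Rightarrow> ('r, 'v) tp list \<Rightarrow> ('r, 'v) tp prog" where
  "go a [] = Shift {} {}"
| "go a (x # xs) = mulN a ;; add a x ;; go a xs"

definition push :: "((('r, 'v) tp \<Rightarrow> nat) \<Rightarrow> nat) \<Rightarrow> ('r, 'v) tp prog" where
  "push f = Shift {} {Stack} ;; Write Stack f"

definition pop_to :: "('r, 'v) tp \<Rightarrow> ('r, 'v) tp prog" where
  "pop_to a = Act (\<lambda>\<rho> b. (if b = a then \<rho> Stack else if b = Stack then 0 else \<rho> b,
     if b = Stack then Move_Left else Stay))"

text \<open>Only one cell of \<open>Stack\<close> is under the head at a time, so the upper operand
  is parked on \<open>Hold\<close> before the lower one is replaced. Both vacated cells are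
  blanked.\<close>

definition combine :: "(nat \<Rightarrow> nat \<Rightarrow> nat) \<Rightarrow> ('r, 'v) tp prog" where
  "combine g = Shift {} {Hold} ;; pop_to Hold ;;
     Act (\<lambda>\<rho> b. (if b = Stack then g (\<rho> Stack) (\<rho> Hold) else if b = Hold then 0 else \<rho> b,
       if b = Hold then Move_Left else Stay))"

text \<open>Truth values use the codes of the input bits, so the input tape can serve as a relation
  without conversion. Neither code is the blank or the marker, and untouched blank cells read as
  false since only 2 counts as true.\<close>

definition enc :: "bool \<Rightarrow> nat" where
  "enc b = (if b then 2 else 1)"

primrec eval_fm :: "('r, 'v) fm \<Rightarrow> ('r, 'v) tp prog" where
  "eval_fm (Rel r xs) = go (Arr r) (map Var xs) ;; push (\<lambda>\<rho>. enc (\<rho> (Arr r) = 2)) ;; drain (Arr r) {} {}"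
| "eval_fm (Less x y) = add Diff (Var y) ;; drain (Var x) {Diff} {Scratch} ;; drain Scratch {} {Var x} ;;
     push (\<lambda>\<rho>. enc (\<rho> Diff \<noteq> 3)) ;; drain Diff {} {}"
| "eval_fm (Neg \<phi>) = eval_fm \<phi> ;; Write Stack (\<lambda>\<rho>. enc (\<rho> Stack \<noteq> 2))"
| "eval_fm (Conj \<phi> \<psi>) = eval_fm \<phi> ;; eval_fm \<psi> ;; combine (\<lambda>a b. enc (a = 2 \<and> b = 2))"
| "eval_fm (Ex x \<phi>) = push (\<lambda>_. enc False) ;;
     loop (Var x) (eval_fm \<phi> ;; combine (\<lambda>a b. enc (a = 2 \<or> b = 2)))"

primrec nest :: "'v list \<Rightarrow> ('r, 'v) tp prog \<Rightarrow> ('r, 'v) tp prog" where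
  "nest [] p = p"
| "nest (x # xs) p = loop (Var x) (nest xs p)"

text \<open>
  An update first computes all new values into a shadow copy of the relation, as the formula may
  refer to the old values.
\<close>

definition store_shadow :: "'r \<Rightarrow> 'v list \<Rightarrow> ('r, 'v) fm \<Rightarrow> ('r, 'v) tp prog" where
  "store_shadow r xs \<phi> =
     nest xs (eval_fm \<phi> ;; go (Sh r) (map Var xs) ;; pop_to (Sh r) ;; drain (Sh r) {} {})"

text \<open>A relation and its shadow use the same addresses, so after the write both heads stand at
  the same position and a single \<open>drain\<close> rewinds them.\<close>

definition copy_shadow :: "'r \<Rightarrow> 'v list \<Rightarrow> ('r, 'v) tp prog" where
  "copy_shadow r xs = nest xs (go (Sh r) (map Var xs) ;; go (Arr r) (map Var xs) ;;
     Write (Arr r) (\<lambda>\<rho>. enc (\<rho> (Sh r) = 2)) ;; drain (Sh r) {Arr r} {})"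

primrec compile :: "('r, 'v) cmd \<Rightarrow> ('r, 'v) tp prog" where
  "compile (Upd r xs \<phi>) = store_shadow r xs \<phi> ;; copy_shadow r xs"
| "compile (c then\<^sub>c c') = compile c ;; compile c'"
| "compile (For x c) = loop (Var x) (compile c)"

lemma wf_prog_Shift [simp]: "wf_prog (Shift l r)"
  by (simp add: Shift_def)

lemma wf_prog_drain [simp]: "wf_prog (drain i l r)"
  by (simp add: drain_def)

lemma wf_prog_loop [simp]: "wf_prog (loop d p) \<longleftrightarrow> wf_prog p"
  by (simp add: loop_def)

lemma wf_prog_Write [simp]: "wf_prog (Write i (\<lambda>\<rho>. enc (b \<rho>)))"
  by (simp add: Write_def enc_def)

lemma wf_prog_addN [simp]: "wf_prog (addN a)"
  by (simp add: addN_def)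

lemma wf_prog_mulN [simp]: "wf_prog (mulN a)"
  by (simp add: mulN_def)

lemma wf_prog_add [simp]: "wf_prog (add a x)"
  by (simp add: add_def)

lemma wf_prog_push [simp]: "wf_prog (push (\<lambda>\<rho>. enc (b \<rho>)))"
  by (simp add: push_def)

lemma wf_prog_pop_to [simp]: "wf_prog (pop_to a)"
  by (simp add: pop_to_def)

lemma wf_prog_combine [simp]: "wf_prog (combine (\<lambda>u v. enc (b u v)))"
  by (simp add: combine_def enc_def)

lemma wf_prog_nest [simp]: "wf_prog (nest xs p) \<longleftrightarrow> wf_prog p"
  by (induction xs) auto

lemma wf_prog_go [simp]: "wf_prog (go a xs)"
  by (induction xs) auto

lemma wf_prog_eval_fm [simp]: "wf_prog (eval_fm \<phi>)"
  by (induction \<phi>) auto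

lemma wf_prog_compile [simp]: "wf_prog (compile c)"
  by (induction c) (auto simp: store_shadow_def copy_shadow_def)

section \<open>Correctness and cost of the head arithmetic\<close>

lemma run_addN:
  assumes "marked C" "counts N (C Counter)" "H Counter = 0" "a \<noteq> Counter"
  shows "run (addN a) C H C (H(a := H a + N)) (N * 5 + 6)"
proof -
  have "\<exists>C' H'. run (loop Counter (Shift {} {a})) C H C' H' (N * (1 + 4) + 6) \<and>
      (C' = C \<and> H' = H(a := H a + N))"
  proof (rule run_loop[where P = "\<lambda>i C' H'. C' = C \<and> H' = H(a := H a + i)"], goal_cases)
    case (1 i C' H')
    have "(\<lambda>b. if b \<in> {a} then (H'(Counter := Suc i)) b + 1 else (H'(Counter := Suc i)) b) =
        (H(a := H a + Suc i))(Counter := Suc i)"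
      using 1 assms by auto
    then have "run (Shift {} {a}) C (H'(Counter := Suc i)) C ((H(a := H a + Suc i))(Counter := Suc i)) 1"
      using run_Shift_right[of "{a}" C "H'(Counter := Suc i)"] by (simp del: fun_upd_apply)
    then show ?case using 1 by blast
  qed (use assms in auto)
  then show ?thesis by (simp add: addN_def mult.commute)
qed

lemma run_mulN:
  assumes "marked C" "counts N (C Counter)" "H Counter = 0" "H Scratch = 0"
    and "a \<noteq> Counter" "a \<noteq> Scratch"
  shows "run (mulN a) C H C (H(a := H a * N)) (H a * (N * 7 + 8) + 2)"
proof -
  let ?W = "While (\<lambda>\<rho>. \<rho> a \<noteq> 3) (Shift {a} {} ;; addN Scratch)"
  \<comment> \<open>Generalised to a nonzero \<open>Scratch\<close>, in which the product
    accumulates.\<close>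
  have W: "run ?W C H' C (H'(a := 0, Scratch := H' Scratch + H' a * N)) (H' a * (N * 5 + 8) + 1)"
    if "H' Counter = 0" for H'
    using that
  proof (induction "H' a" arbitrary: H')
    case 0
    have eq: "H'(a := 0, Scratch := H' Scratch + H' a * N) = H'"
      using 0 by auto
    have "run ?W C H' C H' 1"
      by (rule run_While_False) (use 0 assms(1) in \<open>simp add: marked_def\<close>)
    then show ?case
      unfolding eq by (rule run_mono) simp
  next
    case (Suc n)
    have "(\<lambda>b. if b \<in> {a} then H' b - 1 else if b \<in> {} then H' b + 1 else H' b) = H'(a := n)"
      using Suc.hyps(2)[symmetric] by auto
    then have 1: "run (Shift {a} {}) C H' C (H'(a := n)) 1"
      using run_Shift[OF assms(1), of "{a}" "{}" H'] by simp
    define H2 where "H2 = (H'(a := n))(Scratch := H' Scratch + N)"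
    have 2: "run (addN Scratch) C (H'(a := n)) C H2 (N * 5 + 6)"
      using run_addN[of C N "H'(a := n)" Scratch] assms Suc.prems by (simp add: H2_def)
    have a: "n = H2 a" "H2 Counter = 0"
      using assms Suc.prems by (auto simp: H2_def)
    have 3: "run ?W C H2 C (H2(a := 0, Scratch := H2 Scratch + H2 a * N)) (n * (N * 5 + 8) + 1)"
      using Suc.hyps(1)[OF a] a(1) by simp
    have "H2(a := 0, Scratch := H2 Scratch + H2 a * N) = H'(a := 0, Scratch := H' Scratch + H' a * N)"
      using Suc.hyps(2)[symmetric] assms(6) by (auto simp: H2_def)
    then have "run ?W C H' C (H'(a := 0, Scratch := H' Scratch + H' a * N))
        (1 + (1 + (N * 5 + 6)) + (n * (N * 5 + 8) + 1))"
      using Suc.hyps(2)[symmetric] assms(1) 3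
      by (intro run_While_True[OF _ run_Sequ[OF 1 2]]) (auto simp: marked_def)
    then show ?case
      by (rule run_mono) (simp add: Suc.hyps(2)[symmetric])
  qed
  define H1 where "H1 = H(a := 0, Scratch := H Scratch + H a * N)"
  have "(\<lambda>b. if b \<in> insert Scratch {} then H1 b - H1 Scratch else if b \<in> {a} then H1 b + H1 Scratch else H1 b) =
      H(a := H a * N)"
    using assms by (auto simp: H1_def)
  then have 2: "run (drain Scratch {} {a}) C H1 C (H(a := H a * N)) (2 * (H a * N) + 1)"
    using run_drain[OF assms(1), of Scratch "{}" "{a}" H1] assms(4) by (simp add: H1_def)
  show ?thesis
    unfolding mulN_def
    by (rule run_mono[OF run_Sequ[OF W[of H, OF assms(3)] 2[unfolded H1_def]]]) (simp add: algebra_simps)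
qed

lemma run_add:
  assumes "marked C" "H Scratch = 0" "x \<noteq> a" "a \<noteq> Scratch" "x \<noteq> Scratch"
  shows "run (add a x) C H C (H(a := H a + H x)) (4 * H x + 2)"
proof -
  define H1 where "H1 = H(x := 0, a := H a + H x, Scratch := H x)"
  have "(\<lambda>b. if b \<in> insert x {} then H b - H x else if b \<in> {a, Scratch} then H b + H x else H b) = H1"
    using assms by (auto simp: H1_def)
  then have 1: "run (drain x {} {a, Scratch}) C H C H1 (2 * H x + 1)"
    using run_drain[OF assms(1), of x "{}" "{a, Scratch}" H] by simp
  have "(\<lambda>b. if b \<in> insert Scratch {} then H1 b - H1 Scratch else if b \<in> {x} then H1 b + H1 Scratch else H1 b) =
      H(a := H a + H x)"
    using assms by (auto simp: H1_def)
  then have 2: "run (drain Scratch {} {x}) C H1 C (H(a := H a + H x)) (2 * H x + 1)"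
    using run_drain[OF assms(1), of Scratch "{}" "{x}" H1] by (simp add: H1_def)
  show ?thesis
    unfolding add_def by (rule run_mono[OF run_Sequ[OF 1 2]]) simp
qed

lemma run_rewind:
  assumes "marked C"
  shows "run (drain a {} {}) C H C (H(a := 0)) (2 * H a + 1)"
proof -
  have "(\<lambda>b. if b \<in> insert a {} then H b - H a else if b \<in> {} then H b + H a else H b) = H(a := 0)"
    by auto
  then show ?thesis using run_drain[OF assms, of a "{}" "{}" H] by simp
qed

lemma run_push:
  "run (push f) C H (C(Stack := (C Stack)(Suc (H Stack) := f (\<lambda>b. C b ((H(Stack := Suc (H Stack))) b)))))
    (H(Stack := Suc (H Stack))) 2"
proof -
  have "(\<lambda>a. if a \<in> {Stack} then H a + 1 else H a) = H(Stack := Suc (H Stack))"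
    by auto
  then have 1: "run (Shift {} {Stack}) C H C (H(Stack := Suc (H Stack))) 1"
    using run_Shift_right[of "{Stack}" C H] by simp
  show ?thesis
    unfolding push_def
    using run_Sequ[OF 1 run_Write[of Stack f C "H(Stack := Suc (H Stack))"]] by (simp add: numeral_2_eq_2)
qed

lemma run_pop_to:
  assumes "H Stack = Suc s" "a \<noteq> Stack"
  shows "run (pop_to a) C H (C(a := (C a)(H a := C Stack (Suc s)), Stack := (C Stack)(Suc s := 0)))
    (H(Stack := s)) 1"
proof -
  define f where "f = (\<lambda>\<rho> b. (if b = a then \<rho> Stack else if b = Stack then (0::nat) else \<rho> b,
     if b = Stack then Move_Left else Stay))"
  have "run (Act f) C H (\<lambda>a. (C a)(H a := fst (f (\<lambda>b. C b (H b)) a)))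
    (\<lambda>a. nat_move (snd (f (\<lambda>b. C b (H b)) a)) (H a)) 1"
    by (intro run_Act) (use assms in \<open>auto simp: f_def split: if_splits\<close>)
  moreover have "(\<lambda>b. (C b)(H b := fst (f (\<lambda>b. C b (H b)) b))) =
      C(a := (C a)(H a := C Stack (Suc s)), Stack := (C Stack)(Suc s := 0))"
    using assms by (auto simp: f_def)
  moreover have "(\<lambda>a. nat_move (snd (f (\<lambda>b. C b (H b)) a)) (H a)) = H(Stack := s)"
    using assms by (auto simp: f_def)
  ultimately show ?thesis by (simp add: pop_to_def f_def)
qed

lemma run_combine:
  fixes C :: "('r, 'v) tp \<Rightarrow> nat \<Rightarrow> nat"
  assumes "H Stack = Suc (Suc s)" "H Hold = 0" "C Hold (Suc 0) = 0"
  shows "run (combine g) C H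
    (C(Stack := (C Stack)(Suc (Suc s) := 0, Suc s := g (C Stack (Suc s)) (C Stack (Suc (Suc s))))))
    (H(Stack := Suc s)) 3"
proof -
  define H1 where "H1 = H(Hold := Suc 0)"
  have "(\<lambda>a. if a \<in> {Hold} then H a + 1 else H a) = H1"
    using assms by (auto simp: H1_def)
  then have 1: "run (Shift {} {Hold}) C H C H1 1"
    using run_Shift_right[of "{Hold}" C H] by simp
  define C2 where "C2 = C(Hold := (C Hold)(H1 Hold := C Stack (Suc (Suc s))),
    Stack := (C Stack)(Suc (Suc s) := 0))"
  define H2 where "H2 = H1(Stack := Suc s)"
  have 2: "run (pop_to Hold) C H1 C2 H2 1"
    using run_pop_to[of H1 "Suc s" Hold C] assms by (simp add: H1_def C2_def H2_def)
  define f :: "(('r, 'v) tp \<Rightarrow> nat) \<Rightarrow> ('r, 'v) tp \<Rightarrow> nat \<times> move"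
    where "f = (\<lambda>\<rho> b. (if b = Stack then g (\<rho> Stack) (\<rho> Hold) else if b = Hold then 0 else \<rho> b,
       if b = Hold then Move_Left else Stay))"
  have "run (Act f) C2 H2 (\<lambda>a. (C2 a)(H2 a := fst (f (\<lambda>b. C2 b (H2 b)) a)))
    (\<lambda>a. nat_move (snd (f (\<lambda>b. C2 b (H2 b)) a)) (H2 a)) 1"
    by (intro run_Act) (auto simp: f_def H2_def H1_def split: if_splits)
  moreover have "(\<lambda>a. (C2 a)(H2 a := fst (f (\<lambda>b. C2 b (H2 b)) a))) =
    C(Stack := (C Stack)(Suc (Suc s) := 0, Suc s := g (C Stack (Suc s)) (C Stack (Suc (Suc s)))))"
    using assms by (auto simp: f_def H2_def H1_def C2_def fun_eq_iff)
  moreover have "(\<lambda>a. nat_move (snd (f (\<lambda>b. C2 b (H2 b)) a)) (H2 a)) = H(Stack := Suc s)"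
    using assms by (auto simp: f_def H2_def H1_def)
  ultimately have 3: "run (Act f) C2 H2 (C(Stack := (C Stack)(Suc (Suc s) := 0,
      Suc s := g (C Stack (Suc s)) (C Stack (Suc (Suc s)))))) (H(Stack := Suc s)) 1"
    by simp
  show ?thesis
    using run_Sequ[OF 1 run_Sequ[OF 2 3]] by (simp add: combine_def f_def numeral_3_eq_3)
qed

section \<open>Addresses of tuples on a relation tape\<close>

primrec posn :: "nat \<Rightarrow> nat \<Rightarrow> nat list \<Rightarrow> nat" where
  "posn N h [] = h"
| "posn N h (d # ds) = posn N (h * N + d) ds"

primrec go_time :: "nat \<Rightarrow> nat \<Rightarrow> nat \<Rightarrow> nat" where
  "go_time N h 0 = 1"
| "go_time N h (Suc l) = h * (N * 7 + 8) + 2 + (4 * N + 2) + go_time N (h * N + N) l"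

lemma go_time_mono: "h \<le> h' \<Longrightarrow> go_time N h l \<le> go_time N h' l"
  by (induction l arbitrary: h h') (auto intro!: add_mono mult_le_mono)

text \<open>The digit count \<open>l\<close> is an arity fixed by the program. For constant
  \<open>l\<close>, iterating \<open>h * N + N\<close> keeps addresses and times polynomial in
  \<open>N\<close>.\<close>

lemma poly_bounded_go_time: "poly_bounded g \<Longrightarrow> poly_bounded (\<lambda>N. go_time N (g N) l)"
proof (induction l arbitrary: g)
  case (Suc l)
  show ?case
    unfolding go_time.simps by (intro poly_bounded_intros Suc.IH Suc.prems)
qed (simp_all add: poly_bounded_intros)

primrec posn_bound :: "nat \<Rightarrow> nat \<Rightarrow> nat \<Rightarrow> nat" where
  "posn_bound N h 0 = h"
| "posn_bound N h (Suc l) = posn_bound N (h * N + N) l"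

lemma posn_bound_mono: "h \<le> h' \<Longrightarrow> posn_bound N h l \<le> posn_bound N h' l"
  by (induction l arbitrary: h h') (auto intro!: add_mono mult_le_mono)

lemma posn_le: "set ds \<subseteq> {..N} \<Longrightarrow> posn N h ds \<le> posn_bound N h (length ds)"
proof (induction ds arbitrary: h)
  case (Cons d ds)
  then have "posn N (h * N + d) ds \<le> posn_bound N (h * N + d) (length ds)" by simp
  also have "\<dots> \<le> posn_bound N (h * N + N) (length ds)"
    using Cons.prems by (intro posn_bound_mono) simp
  finally show ?case by simp
qed simp

lemma poly_bounded_posn_bound: "poly_bounded g \<Longrightarrow> poly_bounded (\<lambda>N. posn_bound N (g N) l)"
proof (induction l arbitrary: g)
  case (Suc l)
  show ?case
    unfolding posn_bound.simps by (intro poly_bounded_intros Suc.IH Suc.prems)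
qed (simp_all add: poly_bounded_intros)

lemma run_go:
  assumes "marked C" "counts N (C Counter)" "H Counter = 0" "H Scratch = 0"
    and "a \<notin> {Counter, Scratch} \<union> set xs" "Scratch \<notin> set xs" "\<forall>x\<in>set xs. H x \<le> N"
  shows "run (go a xs) C H C (H(a := posn N (H a) (map H xs))) (go_time N (H a) (length xs))"
  using assms(3-7)
proof (induction xs arbitrary: H)
  case Nil
  then show ?case using run_Shift_right[of "{}" C H] by simp
next
  case (Cons x xs)
  have 1: "run (mulN a) C H C (H(a := H a * N)) (H a * (N * 7 + 8) + 2)"
    using run_mulN[of C N H a] assms(1,2) Cons.prems by auto
  have 2: "run (add a x) C (H(a := H a * N)) C (H(a := H a * N + H x)) (4 * H x + 2)"
    using run_add[of C "H(a := H a * N)" x a] assms(1,2) Cons.prems by auto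
  define H1 where "H1 = H(a := H a * N + H x)"
  have H1: "H1 a = H a * N + H x" "H1(a := p) = H(a := p)" "map H1 xs = map H xs" for p
    using Cons.prems by (auto simp: H1_def)
  have "run (go a xs) C H1 C (H1(a := posn N (H1 a) (map H1 xs))) (go_time N (H1 a) (length xs))"
    using Cons.prems by (intro Cons.IH) (auto simp: H1_def)
  then have 3: "run (go a xs) C (H(a := H a * N + H x)) C (H(a := posn N (H a) (map H (x # xs))))
      (go_time N (H a * N + H x) (length xs))"
    unfolding H1 by (simp add: H1_def)
  have "go_time N (H a * N + H x) (length xs) \<le> go_time N (H a * N + N) (length xs)"
    using Cons.prems by (intro go_time_mono) simp
  then have "H a * (N * 7 + 8) + 2 + (4 * H x + 2 + go_time N (H a * N + H x) (length xs))
     \<le> go_time N (H a) (length (x # xs))"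
    using Cons.prems(5) by simp
  then show ?case
    unfolding go.simps by (rule run_mono[OF run_Sequ[OF 1 run_Sequ[OF 2 3]]])
qed

text \<open>The canonical head positions between program blocks: a variable in scope with value
  \<open>i\<close> is at \<open>Suc i\<close>, one out of scope at 0, which is what a loop over it
  expects; apart from \<open>Stack\<close> all other heads are at rest.\<close>

definition heads :: "'v set \<Rightarrow> ('v \<Rightarrow> nat) \<Rightarrow> nat \<Rightarrow> ('r, 'v) tp \<Rightarrow> nat" where
  "heads V env s = (\<lambda>a. case a of Var x \<Rightarrow> if x \<in> V then Suc (env x) else 0 | Stack \<Rightarrow> s | _ \<Rightarrow> 0)"

lemma heads_simps [simp]:
  "heads V env s (Arr r) = 0" "heads V env s (Sh r) = 0"
  "heads V env s (Var x) = (if x \<in> V then Suc (env x) else 0)"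
  "heads V env s Stack = s" "heads V env s Hold = 0" "heads V env s Counter = 0"
  "heads V env s Scratch = 0" "heads V env s Diff = 0"
  by (simp_all add: heads_def)

lemma heads_Stack: "(heads V env s)(Stack := s') = heads V env s'"
  by (rule ext) (simp add: heads_def split: tp.split)

lemma heads_Var: "x \<notin> V \<Longrightarrow> (heads V env s)(Var x := Suc i) = heads (insert x V) (env(x := i)) s"
  by (rule ext) (auto simp: heads_def split: tp.split)

definition tapes_ok :: "nat \<Rightarrow> (('r, 'v) tp \<Rightarrow> nat \<Rightarrow> nat) \<Rightarrow> bool" where
  "tapes_ok N C \<longleftrightarrow> marked C \<and> counts N (C Counter) \<and> (\<forall>x. counts N (C (Var x))) \<and> C Hold (Suc 0) = 0"

definition mem_ok ::
  "('r \<Rightarrow> nat) \<Rightarrow> nat \<Rightarrow> 'r memory \<Rightarrow> (('r, 'v) tp \<Rightarrow> nat \<Rightarrow> nat) \<Rightarrow> bool" where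
  "mem_ok ar N m C \<longleftrightarrow>
     (\<forall>r. \<forall>ys\<in>tuples N (ar r). C (Arr r) (posn N 0 (map Suc ys)) = 2 \<longleftrightarrow> m r ys)"

text \<open>Popping writes a blank. With blanks above the stack pointer this restores the former
  contents exactly.\<close>

definition clean :: "nat \<Rightarrow> (('r, 'v) tp \<Rightarrow> nat \<Rightarrow> nat) \<Rightarrow> bool" where
  "clean s C \<longleftrightarrow> (\<forall>p>s. C Stack p = 0)"

lemma enc_eq [simp]: "enc b = 2 \<longleftrightarrow> b" "enc b \<noteq> 3" "enc b \<noteq> 0"
  by (auto simp: enc_def)

abbreviation pushed ::
  "(('r, 'v) tp \<Rightarrow> nat \<Rightarrow> nat) \<Rightarrow> nat \<Rightarrow> nat \<Rightarrow> ('r, 'v) tp \<Rightarrow> nat \<Rightarrow> nat" where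
  "pushed C s b \<equiv> C(Stack := (C Stack)(Suc s := b))"

lemma tapes_ok_Stack: "tapes_ok N C \<Longrightarrow> tapes_ok N (pushed C s (enc b))"
  by (auto simp: tapes_ok_def marked_def)

lemma mem_ok_Stack [simp]: "mem_ok ar N m (C(Stack := c)) = mem_ok ar N m C"
  by (simp add: mem_ok_def)

lemma clean_Stack: "clean s C \<Longrightarrow> clean (Suc s) (pushed C s b)"
  by (simp add: clean_def)

section \<open>Evaluation of formulas on the stack\<close>

lemma run_combine_heads:
  assumes "clean s C" "C Hold (Suc 0) = 0"
  shows "run (combine g) (C(Stack := (C Stack)(Suc s := a, Suc (Suc s) := b))) (heads V env (Suc (Suc s)))
    (pushed C s (g a b)) (heads V env (Suc s)) 3"
proof -
  define C1 where "C1 = C(Stack := (C Stack)(Suc s := a, Suc (Suc s) := b))"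
  have "C1(Stack := (C1 Stack)(Suc (Suc s) := 0, Suc s := g (C1 Stack (Suc s)) (C1 Stack (Suc (Suc s))))) =
      (pushed C s (g a b))"
    using assms(1) by (auto simp: C1_def clean_def fun_eq_iff)
  then show ?thesis
    using run_combine[of "heads V env (Suc (Suc s))" s C1 g] assms(2)
    by (simp add: heads_Stack C1_def[symmetric]) (simp add: C1_def)
qed

lemma run_go_vars:
  assumes "tapes_ok N C" "\<forall>x\<in>set xs. H (Var x) = Suc (env x) \<and> env x < N"
    and "H Counter = 0" "H Scratch = 0" "H a = 0" "a \<notin> {Counter, Scratch} \<union> range Var"
  shows "run (go a (map Var xs)) C H C (H(a := posn N 0 (map Suc (map env xs)))) (go_time N 0 (length xs))"
proof -
  have "run (go a (map Var xs)) C H C (H(a := posn N (H a) (map H (map Var xs))))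
      (go_time N (H a) (length xs))"
    using assms run_go[of C N H a "map Var xs"] by (auto simp: tapes_ok_def Suc_le_eq simp del: map_map)
  moreover have "map H (map Var xs) = map Suc (map env xs)"
    using assms(2) by simp
  ultimately show ?thesis
    using assms(5) by (simp del: map_map)
qed

lemma run_push_heads:
  "run (push f) C (heads V env s)
    (pushed C s (f (\<lambda>b. C b (heads V env (Suc s) b)))) (heads V env (Suc s)) 2"
  using run_push[of f C "heads V env s"] by (simp add: heads_Stack)

lemma run_eval_Rel:
  assumes "tapes_ok N C" "mem_ok ar N m C" "\<forall>x\<in>V. env x < N" "length xs = ar r" "set xs \<subseteq> V"
  shows "run (eval_fm (Rel r xs)) C (heads V env s)
    (pushed C s (enc (m r (map env xs)))) (heads V env (Suc s))
    (go_time N 0 (length xs) + (2 + (2 * posn_bound N 0 (length xs) + 1)))"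
proof -
  let ?H = "heads V env s" and ?p = "posn N 0 (map Suc (map env xs))"
  have ys: "map env xs \<in> tuples N (ar r)"
    using assms(3-5) by (auto simp: tuples_def)
  have "set (map Suc (map env xs)) \<subseteq> {..N}"
    using ys by (auto simp: tuples_def Suc_le_eq)
  then have le: "?p \<le> posn_bound N 0 (length xs)"
    using posn_le[of "map Suc (map env xs)" N 0] by simp
  have 1: "run (go (Arr r) (map Var xs)) C ?H C (?H(Arr r := ?p)) (go_time N 0 (length xs))"
    by (rule run_go_vars) (use assms in auto)
  define C1 where "C1 = (pushed C s (enc (m r (map env xs))))"
  define H1 where "H1 = ?H(Arr r := ?p, Stack := Suc s)"
  have cell: "C (Arr r) ?p = 2 \<longleftrightarrow> m r (map env xs)"
    using assms(2) ys unfolding mem_ok_def by blast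
  have 2: "run (push (\<lambda>\<rho>. enc (\<rho> (Arr r) = 2))) C (?H(Arr r := ?p)) C1 H1 2"
    using run_push[of "\<lambda>\<rho>. enc (\<rho> (Arr r) = 2)" C "?H(Arr r := ?p)"]
    by (simp add: C1_def H1_def cell del: map_map)
  have "marked C1"
    using tapes_ok_Stack[OF assms(1)] by (simp add: C1_def tapes_ok_def)
  moreover have "H1(Arr r := 0) = heads V env (Suc s)"
    by (rule ext) (simp add: H1_def heads_def split: tp.split)
  ultimately have 3: "run (drain (Arr r) {} {}) C1 H1 C1 (heads V env (Suc s)) (2 * ?p + 1)"
    using run_rewind[of C1 "Arr r" H1] by (simp add: H1_def)
  have "run (eval_fm (Rel r xs)) C ?H C1 (heads V env (Suc s)) (go_time N 0 (length xs) + (2 + (2 * ?p + 1)))"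
    unfolding eval_fm.simps by (intro run_Sequ[OF 1 run_Sequ[OF 2 3]])
  then show ?thesis
    unfolding C1_def by (rule run_mono) (use le in simp)
qed

text \<open>Truncated subtraction decides the order: \<open>Diff\<close> receives the position of
  \<open>y\<close> minus that of \<open>x\<close> and is off the marker exactly when this is
  positive. \<open>Scratch\<close> keeps the position of \<open>x\<close> for its
  restoration.\<close>

lemma run_eval_Less:
  fixes C :: "('r, 'v) tp \<Rightarrow> nat \<Rightarrow> nat"
  assumes "tapes_ok N C" "\<forall>x\<in>V. env x < N" "x \<in> V" "y \<in> V" "x \<noteq> y"
  shows "run (eval_fm (Less x y)) C (heads V env s)
    (pushed C s (enc (env x < env y))) (heads V env (Suc s))
    (12 * N + 20)"
proof -
  let ?H = "heads V env s :: ('r, 'v) tp \<Rightarrow> nat"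
  have mk: "marked C" using assms(1) by (simp add: tapes_ok_def)
  have 1: "run (add Diff (Var y)) C ?H C (?H(Diff := Suc (env y))) (4 * Suc (env y) + 2)"
    using run_add[OF mk, of ?H "Var y" Diff] assms(4) by simp
  let ?H1 = "?H(Diff := Suc (env y))"
  have eq2: "(\<lambda>a. if a \<in> insert (Var x) {Diff} then ?H1 a - ?H1 (Var x)
      else if a \<in> {Scratch} then ?H1 a + ?H1 (Var x) else ?H1 a) =
      ?H(Diff := env y - env x, Var x := 0, Scratch := Suc (env x))" (is "_ = ?H2")
    using assms(3) by (auto simp: fun_eq_iff)
  have 2: "run (drain (Var x) {Diff} {Scratch}) C ?H1 C ?H2 (2 * Suc (env x) + 1)"
    using run_drain[OF mk, of "Var x" "{Diff}" "{Scratch}" ?H1] assms(3) unfolding eq2 by simp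
  have eq3: "(\<lambda>a. if a \<in> insert Scratch {} then ?H2 a - ?H2 Scratch
      else if a \<in> {Var x} then ?H2 a + ?H2 Scratch else ?H2 a) = ?H(Diff := env y - env x)" (is "_ = ?H3")
    using assms(3) by (auto simp: fun_eq_iff)
  have 3: "run (drain Scratch {} {Var x}) C ?H2 C ?H3 (2 * Suc (env x) + 1)"
    using run_drain[OF mk, of Scratch "{}" "{Var x}" ?H2] unfolding eq3 by simp
  define C1 where "C1 = (pushed C s (enc (env x < env y)))"
  define H4 where "H4 = ?H3(Stack := Suc s)"
  have 4: "run (push (\<lambda>\<rho>. enc (\<rho> Diff \<noteq> 3))) C ?H3 C1 H4 2"
    using run_push[of "\<lambda>\<rho>. enc (\<rho> Diff \<noteq> 3)" C ?H3] mk
    by (simp add: C1_def H4_def marked_def not_le)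
  have "marked C1"
    using tapes_ok_Stack[OF assms(1)] by (simp add: C1_def tapes_ok_def)
  moreover have "H4(Diff := 0) = heads V env (Suc s)"
    by (rule ext) (simp add: H4_def heads_def split: tp.split)
  ultimately have 5: "run (drain Diff {} {}) C1 H4 C1 (heads V env (Suc s)) (2 * (env y - env x) + 1)"
    using run_rewind[of C1 Diff H4] by (simp add: H4_def)
  have "run (eval_fm (Less x y)) C ?H C1 (heads V env (Suc s))
     ((4 * Suc (env y) + 2) + ((2 * Suc (env x) + 1) + ((2 * Suc (env x) + 1) + (2 + (2 * (env y - env x) + 1)))))"
    unfolding eval_fm.simps by (intro run_Sequ[OF 1 run_Sequ[OF 2 run_Sequ[OF 3 run_Sequ[OF 4 5]]]])
  moreover have "env x < N" "env y < N"
    using assms(2-4) by auto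
  ultimately show ?thesis
    unfolding C1_def by (elim run_mono) simp
qed

text \<open>The bound depends on \<open>N\<close> alone, uniformly in memory, environment and stack
  height; this lets it be multiplied by the number of rounds of an enclosing loop.\<close>

definition evaluates ::
  "('r \<Rightarrow> nat) \<Rightarrow> 'v set \<Rightarrow> ('r, 'v) fm \<Rightarrow> (nat \<Rightarrow> nat) \<Rightarrow> bool" where
  "evaluates ar V \<phi> q \<longleftrightarrow> poly_bounded q \<and>
    (\<forall>N m env C s. tapes_ok N C \<longrightarrow> mem_ok ar N m C \<longrightarrow> clean s C \<longrightarrow> (\<forall>x\<in>V. env x < N) \<longrightarrow>
      run (eval_fm \<phi>) C (heads V env s)
        (pushed C s (enc (holds N m env \<phi>))) (heads V env (Suc s)) (q N))"

lemma evaluatesI: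
  assumes "poly_bounded q"
    and "\<And>N m env C s. tapes_ok N C \<Longrightarrow> mem_ok ar N m C \<Longrightarrow> clean s C \<Longrightarrow> \<forall>x\<in>V. env x < N \<Longrightarrow>
      run (eval_fm \<phi>) C (heads V env s)
        (pushed C s (enc (holds N m env \<phi>))) (heads V env (Suc s)) (q N)"
  shows "\<exists>q. evaluates ar V \<phi> q"
  unfolding evaluates_def by (intro exI[of _ q] conjI allI impI assms)

lemma evaluates_poly: "evaluates ar V \<phi> q \<Longrightarrow> poly_bounded q"
  by (simp add: evaluates_def)

lemma evaluatesD:
  assumes "evaluates ar V \<phi> q" "tapes_ok N C" "mem_ok ar N m C" "clean s C" "\<forall>x\<in>V. env x < N"
  shows "run (eval_fm \<phi>) C (heads V env s)
    (pushed C s (enc (holds N m env \<phi>))) (heads V env (Suc s)) (q N)"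
  using assms unfolding evaluates_def by blast

lemma ex_evaluates: "wf_fm ar V \<phi> \<Longrightarrow> \<exists>q. evaluates ar V \<phi> q"
proof (induction \<phi> arbitrary: V)
  case (Rel r xs)
  let ?q = "\<lambda>N. go_time N 0 (length xs) + (2 + (2 * posn_bound N 0 (length xs) + 1))"
  have "poly_bounded ?q"
    using poly_bounded_go_time[of "\<lambda>_. 0"] poly_bounded_posn_bound[of "\<lambda>_. 0"]
    by (intro poly_bounded_intros) (auto intro: poly_bounded_intros)
  then show ?case
    by (rule evaluatesI, unfold holds.simps, intro run_eval_Rel[where ar = ar]) (use Rel.prems in auto)
next
  case (Less x y)
  have "poly_bounded (\<lambda>N. 12 * N + 20)"
    by (intro poly_bounded_intros)
  then show ?case
    by (rule evaluatesI, unfold holds.simps, intro run_eval_Less[where V = V]) (use Less.prems in auto)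
next
  case (Neg \<phi>)
  then obtain q where q: "evaluates ar V \<phi> q"
    by auto
  have "poly_bounded (\<lambda>N. q N + 1)"
    by (intro poly_bounded_intros evaluates_poly[OF q])
  moreover have "run (eval_fm (Neg \<phi>)) C (heads V env s)
      (pushed C s (enc (holds N m env (Neg \<phi>)))) (heads V env (Suc s)) (q N + 1)"
    if "tapes_ok N C" "mem_ok ar N m C" "clean s C" "\<forall>x\<in>V. env x < N" for N m env C s
  proof -
    let ?C1 = "pushed C s (enc (holds N m env \<phi>))"
    have "?C1(Stack := (?C1 Stack)(Suc s := enc (\<not> holds N m env \<phi>))) =
        (pushed C s (enc (holds N m env (Neg \<phi>))))"
      by simp
    then have "run (Write Stack (\<lambda>\<rho>. enc (\<rho> Stack \<noteq> 2))) ?C1 (heads V env (Suc s))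
        (pushed C s (enc (holds N m env (Neg \<phi>)))) (heads V env (Suc s)) 1"
      using run_Write[of Stack "\<lambda>\<rho>. enc (\<rho> Stack \<noteq> 2)" ?C1 "heads V env (Suc s)"] by simp
    then show ?thesis
      unfolding eval_fm.simps using run_Sequ[OF evaluatesD[OF q that]] by blast
  qed
  ultimately show ?case by (rule evaluatesI)
next
  case (Conj \<phi> \<psi>)
  obtain q where q: "evaluates ar V \<phi> q"
    using Conj.IH(1)[of V] Conj.prems by auto
  obtain q' where q': "evaluates ar V \<psi> q'"
    using Conj.IH(2)[of V] Conj.prems by auto
  have "poly_bounded (\<lambda>N. q N + (q' N + 3))"
    by (intro poly_bounded_intros evaluates_poly[OF q] evaluates_poly[OF q'])
  moreover have "run (eval_fm (Conj \<phi> \<psi>)) C (heads V env s)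
      (pushed C s (enc (holds N m env (Conj \<phi> \<psi>)))) (heads V env (Suc s)) (q N + (q' N + 3))"
    if "tapes_ok N C" "mem_ok ar N m C" "clean s C" "\<forall>x\<in>V. env x < N" for N m env C s
  proof -
    let ?a = "enc (holds N m env \<phi>)" and ?b = "enc (holds N m env \<psi>)"
    let ?C1 = "pushed C s ?a"
    have 1: "run (eval_fm \<phi>) C (heads V env s) ?C1 (heads V env (Suc s)) (q N)"
      by (rule evaluatesD[OF q that])
    have "run (eval_fm \<psi>) ?C1 (heads V env (Suc s)) (?C1(Stack := (?C1 Stack)(Suc (Suc s) := ?b)))
        (heads V env (Suc (Suc s))) (q' N)"
      using that by (intro evaluatesD[OF q']) (auto simp: tapes_ok_Stack clean_Stack)
    then have 2: "run (eval_fm \<psi>) ?C1 (heads V env (Suc s))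
        (C(Stack := (C Stack)(Suc s := ?a, Suc (Suc s) := ?b))) (heads V env (Suc (Suc s))) (q' N)"
      by simp
    have 3: "run (combine (\<lambda>a b. enc (a = 2 \<and> b = 2)))
        (C(Stack := (C Stack)(Suc s := ?a, Suc (Suc s) := ?b))) (heads V env (Suc (Suc s)))
        (pushed C s (enc (holds N m env (Conj \<phi> \<psi>)))) (heads V env (Suc s)) 3"
      using run_combine_heads[of s C "\<lambda>a b. enc (a = 2 \<and> b = 2)" ?a ?b V env] that
      by (simp add: tapes_ok_def)
    show ?thesis
      unfolding eval_fm.simps by (rule run_Sequ[OF 1 run_Sequ[OF 2 3]])
  qed
  ultimately show ?case by (rule evaluatesI)
next
  case (Ex x \<phi>)
  have x: "x \<notin> V" "wf_fm ar (insert x V) \<phi>" using Ex.prems by auto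
  obtain q where q: "evaluates ar (insert x V) \<phi> q"
    using Ex.IH[OF x(2)] by auto
  have "poly_bounded (\<lambda>N. 2 + (N * ((q N + 3) + 4) + 6))"
    by (intro poly_bounded_intros evaluates_poly[OF q])
  moreover have "run (eval_fm (Ex x \<phi>)) C (heads V env s)
      (pushed C s (enc (holds N m env (Ex x \<phi>)))) (heads V env (Suc s))
      (2 + (N * ((q N + 3) + 4) + 6))"
    if ok: "tapes_ok N C" "mem_ok ar N m C" "clean s C" "\<forall>x\<in>V. env x < N" for N m env C s
  proof -
    \<comment> \<open>\<open>D 0\<close> is the empty disjunction, which is why \<open>False\<close>
      is pushed before the loop.\<close>
    define D where "D i = (pushed C s (enc (\<exists>j<i. holds N m (env(x := j)) \<phi>)))" for i
    have 1: "run (push (\<lambda>_. enc False)) C (heads V env s) (D 0) (heads V env (Suc s)) 2"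
      using run_push_heads[of "\<lambda>_. enc False" C V env s] by (simp add: D_def)
    have "\<exists>C' H'. run (loop (Var x) (eval_fm \<phi> ;; combine (\<lambda>a b. enc (a = 2 \<or> b = 2))))
        (D 0) (heads V env (Suc s)) C' H' (N * ((q N + 3) + 4) + 6) \<and> (C' = D N \<and> H' = heads V env (Suc s))"
    proof (rule run_loop[where P = "\<lambda>i C' H'. C' = D i \<and> H' = heads V env (Suc s)"], goal_cases)
      case (1 i C' H')
      let ?V = "insert x V" and ?e = "env(x := i)"
      let ?a = "enc (\<exists>j<i. holds N m (env(x := j)) \<phi>)" and ?b = "enc (holds N m ?e \<phi>)"
      have H': "H'(Var x := Suc i) = heads ?V ?e (Suc s)"
        using 1 heads_Var[OF x(1)] by simp
      have "run (eval_fm \<phi>) (D i) (heads ?V ?e (Suc s)) ((D i)(Stack := (D i Stack)(Suc (Suc s) := ?b)))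
          (heads ?V ?e (Suc (Suc s))) (q N)"
        using ok x 1(1) by (intro evaluatesD[OF q]) (auto simp: D_def tapes_ok_Stack clean_Stack)
      then have 2: "run (eval_fm \<phi>) (D i) (heads ?V ?e (Suc s))
          (C(Stack := (C Stack)(Suc s := ?a, Suc (Suc s) := ?b))) (heads ?V ?e (Suc (Suc s))) (q N)"
        by (simp add: D_def)
      have "enc (?a = 2 \<or> ?b = 2) = enc (\<exists>j<Suc i. holds N m (env(x := j)) \<phi>)"
        by (auto simp: less_Suc_eq intro: arg_cong[of _ _ enc])
      then have 3: "run (combine (\<lambda>a b. enc (a = 2 \<or> b = 2)))
          (C(Stack := (C Stack)(Suc s := ?a, Suc (Suc s) := ?b))) (heads ?V ?e (Suc (Suc s)))
          (D (Suc i)) (heads ?V ?e (Suc s)) 3"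
        using run_combine_heads[of s C "\<lambda>a b. enc (a = 2 \<or> b = 2)" ?a ?b ?V ?e] ok
        by (simp add: tapes_ok_def D_def)
      show ?case
        using run_Sequ[OF 2 3] H' 1 by metis
    next
      case (2 i C' H')
      then show ?case
        using x ok tapes_ok_Stack[of N C s] by (auto simp: D_def tapes_ok_def)
    qed simp
    then have 2: "run (loop (Var x) (eval_fm \<phi> ;; combine (\<lambda>a b. enc (a = 2 \<or> b = 2))))
        (D 0) (heads V env (Suc s)) (D N) (heads V env (Suc s)) (N * ((q N + 3) + 4) + 6)"
      by blast
    show ?thesis
      using run_Sequ[OF 1 2] by (simp add: D_def)
  qed
  ultimately show ?case by (rule evaluatesI)
qed

text \<open>The digits \<open>Suc y\<close> run through 1 to \<open>N\<close>: this is bijective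
  base-\<open>N\<close> numeration. Once the digit is lowered by 1, division by \<open>N\<close>
  recovers the accumulator; \<open>h\<close> and \<open>h'\<close> are general so that the digits
  can be peeled off by induction.\<close>

lemma posn_inj:
  assumes "length ys = length zs" "set ys \<subseteq> {..<N}" "set zs \<subseteq> {..<N}"
    "posn N h (map Suc ys) = posn N h' (map Suc zs)"
  shows "h = h' \<and> ys = zs"
  using assms
proof (induction ys zs arbitrary: h h' rule: list_induct2)
  case (Cons y ys z zs)
  have eq: "h * N + Suc y = h' * N + Suc z \<and> ys = zs"
    by (intro Cons.IH) (use Cons.prems in simp_all)
  then have *: "h * N + y = h' * N + z" by simp
  have "y < N" "z < N" using Cons.prems by simp_all
  have "h = (h * N + y) div N" using \<open>y < N\<close> by simp
  also have "\<dots> = h'" unfolding * using \<open>z < N\<close> by simp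
  finally show ?case using eq by simp
qed simp

text \<open>Addresses of nonempty tuples avoid cell 0, so writing a relation never destroys the
  marker.\<close>

lemma posn_pos:
  assumes "0 < h \<or> ys \<noteq> []"
  shows "0 < posn N h (map Suc ys)"
  using assms by (induction ys arbitrary: h) auto

section \<open>Nested loops over tuples and updates of whole relations\<close>

lemma tuples_Suc: "tuples N (Suc k) = {i # ys | i ys. i < N \<and> ys \<in> tuples N k}"
  by (auto simp: tuples_def length_Suc_conv)

primrec nest_time :: "nat \<Rightarrow> nat \<Rightarrow> nat \<Rightarrow> nat" where
  "nest_time N t 0 = t"
| "nest_time N t (Suc l) = N * (nest_time N t l + 4) + 6"

lemma poly_bounded_nest_time: "poly_bounded t \<Longrightarrow> poly_bounded (\<lambda>N. nest_time N (t N) l)"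
proof (induction l)
  case (Suc l)
  show ?case
    unfolding nest_time.simps by (intro poly_bounded_intros Suc.IH Suc.prems)
qed simp

text \<open>\<open>D\<close> records the tuples already visited, so that \<open>Q\<close> can
  distinguish finished cells from pending ones.\<close>

lemma run_nest:
  assumes "\<And>ys D C. ys \<in> tuples N (length xs) \<Longrightarrow> Q D C \<Longrightarrow>
      \<exists>C'. run p C (heads (V \<union> set xs) (upds env xs ys) s) C' (heads (V \<union> set xs) (upds env xs ys) s) t \<and>
        Q (insert ys D) C'"
    and "\<And>D C. Q D C \<Longrightarrow> tapes_ok N C"
    and "distinct xs" "set xs \<inter> V = {}" "Q D C"
  shows "\<exists>C'. run (nest xs p) C (heads V env s) C' (heads V env s) (nest_time N t (length xs)) \<and>
    Q (D \<union> tuples N (length xs)) C'"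
  using assms
proof (induction xs arbitrary: V env Q D C)
  case Nil
  have "tuples N 0 = {[]}"
    by (auto simp: tuples_def)
  then show ?case
    using Nil.prems(1)[of "[]" D C] Nil.prems(5) by simp
next
  case (Cons x xs)
  let ?D = "\<lambda>i. D \<union> {j # zs | j zs. j < i \<and> zs \<in> tuples N (length xs)}"
  have "\<exists>C' H'. run (loop (Var x) (nest xs p)) C (heads V env s) C' H'
      (N * (nest_time N t (length xs) + 4) + 6) \<and> (H' = heads V env s \<and> Q (?D N) C')"
  proof (rule run_loop[where P = "\<lambda>i C' H'. H' = heads V env s \<and> Q (?D i) C'"], goal_cases)
    case (1 i C1 H1)
    have H1: "H1(Var x := Suc i) = heads (insert x V) (env(x := i)) s"
      using 1 Cons.prems(4) heads_Var[of x V env s i] by simp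
    \<comment> \<open>The inner loops use an invariant in the set \<open>E\<close> of tails:
      \<open>Q\<close> holds at the tuples with first entry below \<open>i\<close> together with all
      \<open>i # zs\<close> for \<open>zs \<in> E\<close>. The empty set is its starting
      value.\<close>
    have ex: "\<exists>C'. run (nest xs p) C1 (heads (insert x V) (env(x := i)) s) C' (heads (insert x V) (env(x := i)) s)
        (nest_time N t (length xs)) \<and> Q (?D i \<union> Cons i ` ({} \<union> tuples N (length xs))) C'"
    proof (rule Cons.IH, goal_cases)
      case (1 ys E C2)
      have "\<exists>C'. run p C2 (heads (V \<union> set (x # xs)) (upds env (x # xs) (i # ys)) s) C'
          (heads (V \<union> set (x # xs)) (upds env (x # xs) (i # ys)) s) t \<and>
        Q (insert (i # ys) (?D i \<union> Cons i ` E)) C'"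
        by (rule Cons.prems(1)) (use 1 \<open>i < N\<close> in \<open>auto simp: tuples_Suc\<close>)
      then show ?case by (simp del: fun_upd_apply)
    next
      case (2 E C2)
      then show ?case by (rule Cons.prems(2))
    qed (use 1 Cons.prems in auto)
    have D: "?D i \<union> Cons i ` ({} \<union> tuples N (length xs)) = ?D (Suc i)"
      by (auto simp: less_Suc_eq)
    obtain C2 where "run (nest xs p) C1 (heads (insert x V) (env(x := i)) s) C2
        (heads (insert x V) (env(x := i)) s) (nest_time N t (length xs))" "Q (?D (Suc i)) C2"
      using ex unfolding D by blast
    then show ?case
      unfolding H1 using Cons.prems(4)
      by (intro exI[of _ C2] exI[of _ "heads V env s"]) (simp add: heads_Var del: fun_upd_apply)
  next
    case (2 i C1 H1)
    then have "tapes_ok N C1" using Cons.prems(2)[of "?D i" C1] by simp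
    then show ?case
      using 2 Cons.prems(4) by (simp add: tapes_ok_def)
  next
    case 3
    then show ?case using Cons.prems(5) by simp
  qed
  then obtain C2 where C2: "run (loop (Var x) (nest xs p)) C (heads V env s) C2 (heads V env s)
      (N * (nest_time N t (length xs) + 4) + 6)" "Q (?D N) C2"
    by (elim exE conjE) simp
  have "?D N = D \<union> tuples N (length (x # xs))"
    by (simp add: tuples_Suc)
  then show ?case
    using C2 by (intro exI[of _ C2]) simp
qed

lemma upds_notin: "x \<notin> set xs \<Longrightarrow> upds env xs ys x = env x"
  by (induction xs arbitrary: env ys) auto

lemma map_upds: "length ys = length xs \<Longrightarrow> distinct xs \<Longrightarrow> map (upds env xs ys) xs = ys"
proof (induction xs arbitrary: env ys)
  case (Cons x xs)
  then show ?case by (cases ys) (auto simp: upds_notin)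
qed simp

lemma upds_less:
  assumes "ys \<in> tuples N (length xs)" "distinct xs" "\<forall>x\<in>V. env x < N" "y \<in> V \<union> set xs"
  shows "upds env xs ys y < N"
proof (cases "y \<in> set xs")
  case True
  then have "upds env xs ys y \<in> set (map (upds env xs ys) xs)" by simp
  also have "map (upds env xs ys) xs = ys"
    using assms(1,2) by (intro map_upds) (simp add: tuples_def)
  finally show ?thesis
    using assms(1) by (auto simp: tuples_def)
next
  case False
  then show ?thesis using assms upds_notin[of y xs env ys] by auto
qed

definition state_ok :: "('r \<Rightarrow> nat) \<Rightarrow> nat \<Rightarrow> 'r memory \<Rightarrow> (('r, 'v) tp \<Rightarrow> nat \<Rightarrow> nat) \<Rightarrow> bool" where
  "state_ok ar N m C \<longleftrightarrow> tapes_ok N C \<and> mem_ok ar N m C \<and> clean 0 C"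

abbreviation pos :: "nat \<Rightarrow> nat list \<Rightarrow> nat" where
  "pos N ys \<equiv> posn N 0 (map Suc ys)"

lemma pos_inj: "ys \<in> tuples N k \<Longrightarrow> zs \<in> tuples N k \<Longrightarrow> pos N ys = pos N zs \<Longrightarrow> ys = zs"
  using posn_inj[of ys zs N 0 0] by (simp add: tuples_def)

lemma pos_le:
  assumes "ys \<in> tuples N k"
  shows "pos N ys \<le> posn_bound N 0 k"
proof -
  have "set (map Suc ys) \<subseteq> {..N}"
    using assms by (auto simp: tuples_def Suc_le_eq)
  then show ?thesis
    using posn_le[of "map Suc ys" N 0] assms by (simp add: tuples_def)
qed

lemma tapes_ok_update:
  "tapes_ok N C \<Longrightarrow> 0 < p \<Longrightarrow> a \<in> range Arr \<union> range Sh \<Longrightarrow> tapes_ok N (C(a := (C a)(p := enc b)))"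
  by (auto simp: tapes_ok_def marked_def)

definition store_time :: "(nat \<Rightarrow> nat) \<Rightarrow> nat \<Rightarrow> nat \<Rightarrow> nat" where
  "store_time q N k = nest_time N (q N + (go_time N 0 k + (1 + (2 * posn_bound N 0 k + 1)))) k"

definition copy_time :: "nat \<Rightarrow> nat \<Rightarrow> nat" where
  "copy_time N k = nest_time N (go_time N 0 k + (go_time N 0 k + (1 + (2 * posn_bound N 0 k + 1)))) k"

text \<open>Only \<open>Sh r\<close> is changed in the end, so the memory stays \<open>m\<close>
  from tuple to tuple and each of them is evaluated against the old values.\<close>

lemma run_update_shadow:
  fixes C :: "('r, 'v) tp \<Rightarrow> nat \<Rightarrow> nat"
  assumes q: "evaluates ar (V \<union> set xs) \<phi> q"
    and xs: "length xs = ar r" "xs \<noteq> []" "distinct xs" "set xs \<inter> V = {}"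
    and env: "\<forall>x\<in>V. env x < N" and C: "state_ok ar N m C"
  shows "\<exists>C'. run (store_shadow r xs \<phi>) C (heads V env 0) C' (heads V env 0) (store_time q N (length xs)) \<and>
    state_ok ar N m C' \<and>
    (\<forall>ys\<in>tuples N (length xs). C' (Sh r) (pos N ys) = 2 \<longleftrightarrow> holds N m (upds env xs ys) \<phi>)"
proof -
  define Q where "Q D C \<longleftrightarrow> state_ok ar N m C \<and> (\<forall>ys\<in>D \<inter> tuples N (length xs).
      C (Sh r) (pos N ys) = 2 \<longleftrightarrow> holds N m (upds env xs ys) \<phi>)" for D and C :: "('r, 'v) tp \<Rightarrow> nat \<Rightarrow> nat"
  have "\<exists>C'. run (store_shadow r xs \<phi>) C (heads V env 0) C' (heads V env 0) (store_time q N (length xs)) \<and>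
    Q ({} \<union> tuples N (length xs)) C'"
    unfolding store_shadow_def store_time_def
  proof (rule run_nest, goal_cases)
    case (1 ys D C0)
    let ?W = "V \<union> set xs" and ?e = "upds env xs ys" and ?p = "pos N ys"
    let ?g = "holds N m ?e \<phi>"
    have e: "\<forall>x\<in>?W. ?e x < N"
      using upds_less[OF 1(1) xs(3) env] by blast
    have mp: "map ?e xs = ys"
      using 1(1) xs(3) by (intro map_upds) (simp_all add: tuples_def)
    have ok: "tapes_ok N C0" "mem_ok ar N m C0" "clean 0 C0"
      using 1(2) by (simp_all add: Q_def state_ok_def)
    have p: "0 < ?p"
      using 1(1) xs(2) by (intro posn_pos) (auto simp: tuples_def)
    define C1 where "C1 = C0(Stack := (C0 Stack)(Suc 0 := enc ?g))"
    have s1: "run (eval_fm \<phi>) C0 (heads ?W ?e 0) C1 (heads ?W ?e (Suc 0)) (q N)"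
      unfolding C1_def by (rule evaluatesD[OF q ok e])
    have C1: "tapes_ok N C1"
      unfolding C1_def by (rule tapes_ok_Stack[OF ok(1)])
    define H1 where "H1 = (heads ?W ?e (Suc 0))(Sh r := ?p)"
    have s2: "run (go (Sh r) (map Var xs)) C1 (heads ?W ?e (Suc 0)) C1 H1 (go_time N 0 (length xs))"
      unfolding H1_def mp[symmetric, THEN arg_cong, of "\<lambda>z. pos N z"]
      by (rule run_go_vars[OF C1]) (use e in auto)
    define C2 where "C2 = C0(Sh r := (C0 (Sh r))(?p := enc ?g))"
    have "C1(Sh r := (C1 (Sh r))(H1 (Sh r) := C1 Stack (Suc 0)), Stack := (C1 Stack)(Suc 0 := 0)) = C2"
      using ok(3) by (auto simp: C1_def C2_def H1_def clean_def fun_eq_iff)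
    then have s3: "run (pop_to (Sh r)) C1 H1 C2 (H1(Stack := 0)) 1"
      using run_pop_to[of H1 0 "Sh r" C1] by (simp add: H1_def)
    have C2: "tapes_ok N C2"
      unfolding C2_def by (rule tapes_ok_update[OF ok(1) p]) simp
    have "(H1(Stack := 0))(Sh r := 0) = heads ?W ?e 0"
      by (rule ext) (simp add: H1_def heads_def split: tp.split)
    then have s4: "run (drain (Sh r) {} {}) C2 (H1(Stack := 0)) C2 (heads ?W ?e 0) (2 * ?p + 1)"
      using run_rewind[of C2 "Sh r" "H1(Stack := 0)"] C2 by (simp add: H1_def tapes_ok_def)
    have "run (eval_fm \<phi> ;; go (Sh r) (map Var xs) ;; pop_to (Sh r) ;; drain (Sh r) {} {})
        C0 (heads ?W ?e 0) C2 (heads ?W ?e 0)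
        (q N + (go_time N 0 (length xs) + (1 + (2 * posn_bound N 0 (length xs) + 1))))"
      by (rule run_mono[OF run_Sequ[OF s1 run_Sequ[OF s2 run_Sequ[OF s3 s4]]]])
        (use pos_le[OF 1(1)] in simp)
    moreover have "Q (insert ys D) C2"
    proof -
      have "state_ok ar N m C2"
        using ok C2 by (simp add: state_ok_def mem_ok_def clean_def C2_def)
      moreover have "C2 (Sh r) (pos N zs) = 2 \<longleftrightarrow> holds N m (upds env xs zs) \<phi>"
        if "zs \<in> insert ys D \<inter> tuples N (length xs)" for zs
        using that 1 pos_inj[of zs N "length xs" ys] by (cases "zs = ys") (auto simp: C2_def Q_def)
      ultimately show ?thesis by (simp add: Q_def)
    qed
    ultimately show ?case by blast
  next
    case (2 D C0)
    then show ?case by (simp add: Q_def state_ok_def)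
  next
    case 5
    then show ?case using C by (simp add: Q_def)
  qed (use xs in auto)
  then show ?thesis by (simp add: Q_def)
qed

lemma run_copy_shadow:
  fixes C :: "('r, 'v) tp \<Rightarrow> nat \<Rightarrow> nat"
  assumes xs: "length xs = ar r" "xs \<noteq> []" "distinct xs" "set xs \<inter> V = {}"
    and env: "\<forall>x\<in>V. env x < N" and C: "state_ok ar N m C"
    and g: "\<forall>ys\<in>tuples N (length xs). C (Sh r) (pos N ys) = 2 \<longleftrightarrow> g ys"
  shows "\<exists>C'. run (copy_shadow r xs) C (heads V env 0) C' (heads V env 0) (copy_time N (length xs)) \<and>
    state_ok ar N (m(r := \<lambda>ys. if ys \<in> tuples N (length xs) then g ys else m r ys)) C'"
proof -
  \<comment> \<open>Cells of \<open>Arr r\<close> outside \<open>D\<close> are left unspecified; at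
    the end every addressable one has been visited.\<close>
  define Q where "Q D C \<longleftrightarrow> tapes_ok N C \<and> clean 0 C \<and>
      (\<forall>r'. r' \<noteq> r \<longrightarrow> (\<forall>ys\<in>tuples N (ar r'). C (Arr r') (pos N ys) = 2 \<longleftrightarrow> m r' ys)) \<and>
      (\<forall>ys\<in>tuples N (length xs). C (Sh r) (pos N ys) = 2 \<longleftrightarrow> g ys) \<and>
      (\<forall>ys\<in>D \<inter> tuples N (length xs). C (Arr r) (pos N ys) = 2 \<longleftrightarrow> g ys)"
    for D and C :: "('r, 'v) tp \<Rightarrow> nat \<Rightarrow> nat"
  have "\<exists>C'. run (copy_shadow r xs) C (heads V env 0) C' (heads V env 0) (copy_time N (length xs)) \<and>
    Q ({} \<union> tuples N (length xs)) C'"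
    unfolding copy_shadow_def copy_time_def
  proof (rule run_nest, goal_cases)
    case (1 ys D C0)
    let ?W = "V \<union> set xs" and ?e = "upds env xs ys" and ?p = "pos N ys"
    have e: "\<forall>x\<in>?W. ?e x < N"
      using upds_less[OF 1(1) xs(3) env] by blast
    have mp: "map ?e xs = ys"
      using 1(1) xs(3) by (intro map_upds) (simp_all add: tuples_def)
    have ok: "tapes_ok N C0" "clean 0 C0"
      using 1(2) by (simp_all add: Q_def)
    have sh: "C0 (Sh r) ?p = 2 \<longleftrightarrow> g ys"
      using 1 by (simp add: Q_def)
    have p: "0 < ?p"
      using 1(1) xs(2) by (intro posn_pos) (auto simp: tuples_def)
    define H1 where "H1 = (heads ?W ?e 0)(Sh r := ?p)"
    have s1: "run (go (Sh r) (map Var xs)) C0 (heads ?W ?e 0) C0 H1 (go_time N 0 (length xs))"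
      unfolding H1_def mp[symmetric, THEN arg_cong, of "\<lambda>z. pos N z"]
      by (rule run_go_vars[OF ok(1)]) (use e in auto)
    define H2 where "H2 = H1(Arr r := ?p)"
    have s2: "run (go (Arr r) (map Var xs)) C0 H1 C0 H2 (go_time N 0 (length xs))"
      unfolding H2_def mp[symmetric, THEN arg_cong, of "\<lambda>z. pos N z"]
      by (rule run_go_vars[OF ok(1)]) (use e in \<open>auto simp: H1_def\<close>)
    define C2 where "C2 = C0(Arr r := (C0 (Arr r))(?p := enc (g ys)))"
    have s3: "run (Write (Arr r) (\<lambda>\<rho>. enc (\<rho> (Sh r) = 2))) C0 H2 C2 H2 1"
      using run_Write[of "Arr r" "\<lambda>\<rho>. enc (\<rho> (Sh r) = 2)" C0 H2] sh by (simp add: C2_def H2_def H1_def)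
    have C2: "tapes_ok N C2"
      unfolding C2_def by (rule tapes_ok_update[OF ok(1) p]) simp
    have eq: "(\<lambda>a. if a \<in> insert (Sh r) {Arr r} then H2 a - H2 (Sh r)
        else if a \<in> {} then H2 a + H2 (Sh r) else H2 a) = heads ?W ?e 0"
      by (rule ext) (simp add: H2_def H1_def heads_def split: tp.split)
    have s4: "run (drain (Sh r) {Arr r} {}) C2 H2 C2 (heads ?W ?e 0) (2 * ?p + 1)"
      using run_drain[of C2 "Sh r" "{Arr r}" "{}" H2] C2 unfolding eq
      by (simp add: H2_def H1_def tapes_ok_def)
    have "run (go (Sh r) (map Var xs) ;; go (Arr r) (map Var xs) ;;
       Write (Arr r) (\<lambda>\<rho>. enc (\<rho> (Sh r) = 2)) ;; drain (Sh r) {Arr r} {})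
        C0 (heads ?W ?e 0) C2 (heads ?W ?e 0)
        (go_time N 0 (length xs) + (go_time N 0 (length xs) + (1 + (2 * posn_bound N 0 (length xs) + 1))))"
      by (rule run_mono[OF run_Sequ[OF s1 run_Sequ[OF s2 run_Sequ[OF s3 s4]]]])
        (use pos_le[OF 1(1)] in simp)
    moreover have "Q (insert ys D) C2"
    proof -
      have "C2 (Arr r) (pos N zs) = 2 \<longleftrightarrow> g zs"
        if "zs \<in> insert ys D \<inter> tuples N (length xs)" for zs
        using that 1 pos_inj[of zs N "length xs" ys] by (cases "zs = ys") (auto simp: C2_def Q_def)
      moreover have "clean 0 C2" using ok(2) by (simp add: clean_def C2_def)
      moreover have "C2 (Sh r) = C0 (Sh r)" "\<And>r'. r' \<noteq> r \<Longrightarrow> C2 (Arr r') = C0 (Arr r')"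
        by (simp_all add: C2_def)
      ultimately show ?thesis using C2 1(2) by (simp add: Q_def)
    qed
    ultimately show ?case by blast
  next
    case (2 D C0)
    then show ?case by (simp add: Q_def)
  next
    case 5
    then show ?case using C g by (simp add: Q_def state_ok_def mem_ok_def)
  qed (use xs in auto)
  moreover have "state_ok ar N (m(r := \<lambda>ys. if ys \<in> tuples N (length xs) then g ys else m r ys)) C'"
    if "Q ({} \<union> tuples N (length xs)) C'" for C'
    using that xs(1) by (simp add: Q_def state_ok_def mem_ok_def)
  ultimately show ?thesis by blast
qed

section \<open>Correctness of the compiler\<close>

definition implements ::
  "('r \<Rightarrow> nat) \<Rightarrow> 'v set \<Rightarrow> ('r, 'v) cmd \<Rightarrow> (nat \<Rightarrow> nat) \<Rightarrow> bool" where
  "implements ar V c q \<longleftrightarrow> poly_bounded q \<and>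
    (\<forall>N m env C. state_ok ar N m C \<longrightarrow> (\<forall>x\<in>V. env x < N) \<longrightarrow>
      (\<exists>C'. run (compile c) C (heads V env 0) C' (heads V env 0) (q N) \<and> state_ok ar N (sem N c env m) C'))"

lemma ex_implements: "wf_cmd ar V c \<Longrightarrow> \<exists>q. implements ar V c q"
proof (induction c arbitrary: V)
  case (Upd r xs \<phi>)
  then have xs: "length xs = ar r" "xs \<noteq> []" "distinct xs" "set xs \<inter> V = {}"
    by auto
  obtain q where q: "evaluates ar (V \<union> set xs) \<phi> q"
    using Upd.prems ex_evaluates[of ar "V \<union> set xs" \<phi>] by auto
  let ?q1 = "\<lambda>N. store_time q N (length xs)" and ?q2 = "\<lambda>N. copy_time N (length xs)"
  have g: "poly_bounded (\<lambda>N. go_time N 0 (length xs))" "poly_bounded (\<lambda>N. posn_bound N 0 (length xs))"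
    by (intro poly_bounded_go_time[of "\<lambda>_. 0"] poly_bounded_posn_bound[of "\<lambda>_. 0"] poly_bounded_const)+
  have "poly_bounded (\<lambda>N. ?q1 N + ?q2 N)"
    unfolding store_time_def copy_time_def
    by (intro poly_bounded_add poly_bounded_nest_time poly_bounded_mult poly_bounded_const g evaluates_poly[OF q])
  moreover have "\<exists>C'. run (compile (Upd r xs \<phi>)) C (heads V env 0) C' (heads V env 0) (?q1 N + ?q2 N) \<and>
      state_ok ar N (sem N (Upd r xs \<phi>) env m) C'"
    if ok: "state_ok ar N m C" "\<forall>x\<in>V. env x < N" for N m env C
  proof -
    obtain C1 where C1: "run (store_shadow r xs \<phi>) C (heads V env 0) C1 (heads V env 0) (?q1 N)" "state_ok ar N m C1"
      "\<forall>ys\<in>tuples N (length xs). C1 (Sh r) (pos N ys) = 2 \<longleftrightarrow> holds N m (upds env xs ys) \<phi>"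
      using run_update_shadow[OF q xs ok(2,1)] by blast
    obtain C2 where C2: "run (copy_shadow r xs) C1 (heads V env 0) C2 (heads V env 0) (?q2 N)" "state_ok ar N (sem N (Upd r xs \<phi>) env m) C2"
      using run_copy_shadow[OF xs ok(2) C1(2,3)] by auto
    show ?thesis
      unfolding compile.simps using run_Sequ[OF C1(1) C2(1)] C2(2) by blast
  qed
  ultimately show ?case
    unfolding implements_def by (intro exI[of _ "\<lambda>N. ?q1 N + ?q2 N"] conjI allI impI) auto
next
  case (Then c c')
  obtain q where q: "implements ar V c q" using Then by auto
  obtain q' where q': "implements ar V c' q'" using Then by auto
  have "poly_bounded (\<lambda>N. q N + q' N)"
    using q q' by (auto simp: implements_def intro: poly_bounded_add)
  moreover have "\<exists>C'. run (compile (c then\<^sub>c c')) C (heads V env 0) C' (heads V env 0) (q N + q' N) \<and>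
      state_ok ar N (sem N (c then\<^sub>c c') env m) C'"
    if ok: "state_ok ar N m C" "\<forall>x\<in>V. env x < N" for N m env C
  proof -
    obtain C1 where C1: "run (compile c) C (heads V env 0) C1 (heads V env 0) (q N)"
      "state_ok ar N (sem N c env m) C1"
      using q ok unfolding implements_def by blast
    obtain C2 where C2: "run (compile c') C1 (heads V env 0) C2 (heads V env 0) (q' N)"
      "state_ok ar N (sem N c' env (sem N c env m)) C2"
      using q' ok C1(2) unfolding implements_def by blast
    show ?thesis
      unfolding compile.simps sem.simps using run_Sequ[OF C1(1) C2(1)] C2(2) by blast
  qed
  ultimately show ?case
    unfolding implements_def by (intro exI[of _ "\<lambda>N. q N + q' N"] conjI allI impI) auto
next
  case (For x c)
  then have x: "x \<notin> V" "wf_cmd ar (insert x V) c" by auto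
  obtain q where q: "implements ar (insert x V) c q" using For.IH[OF x(2)] by auto
  have "poly_bounded (\<lambda>N. N * (q N + 4) + 6)"
    using q by (auto simp: implements_def intro!: poly_bounded_add poly_bounded_mult poly_bounded_const poly_bounded_id)
  moreover have "\<exists>C'. run (compile (For x c)) C (heads V env 0) C' (heads V env 0) (N * (q N + 4) + 6) \<and>
      state_ok ar N (sem N (For x c) env m) C'"
    if ok: "state_ok ar N m C" "\<forall>x\<in>V. env x < N" for N m env and C :: "('a, 'b) tp \<Rightarrow> nat \<Rightarrow> nat"
  proof -
    let ?m = "\<lambda>i. fold (\<lambda>i. sem N c (env(x := i))) [0..<i] m"
    have "\<exists>C' H'. run (loop (Var x) (compile c)) C (heads V env 0) C' H' (N * (q N + 4) + 6) \<and>
        (H' = heads V env 0 \<and> state_ok ar N (?m N) C')"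
    proof (rule run_loop[where P = "\<lambda>i C' H'. H' = heads V env 0 \<and> state_ok ar N (?m i) C'"], goal_cases)
      case (1 i C1 H1)
      then have H1: "H1(Var x := Suc i) = heads (insert x V) (env(x := i)) 0"
        using x(1) by (simp add: heads_Var)
      have "\<forall>y\<in>insert x V. (env(x := i)) y < N"
        using ok(2) x(1) 1 by auto
      then obtain C2 where C2: "run (compile c) C1 (heads (insert x V) (env(x := i)) 0) C2
          (heads (insert x V) (env(x := i)) 0) (q N)" "state_ok ar N (sem N c (env(x := i)) (?m i)) C2"
        using q 1 unfolding implements_def by blast
      have "?m (Suc i) = sem N c (env(x := i)) (?m i)"
        by simp
      then show ?case
        unfolding H1 using C2 x(1)
        by (intro exI[of _ C2] exI[of _ "heads V env 0"]) (simp add: heads_Var del: fun_upd_apply)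
    next
      case (2 i C1 H1)
      then show ?case using x(1) by (simp add: state_ok_def tapes_ok_def)
    next
      case 3
      then show ?case using ok by simp
    qed
    then show ?thesis by (elim exE conjE) (simp, blast)
  qed
  ultimately show ?case
    unfolding implements_def by (intro exI[of _ "\<lambda>N. N * (q N + 4) + 6"] conjI allI impI) auto
qed

section \<open>Installing the markers and the unary bounds\<close>

definition boot :: "'r \<Rightarrow> ('r, 'v) tp prog" where
  "boot inp = Act (\<lambda>\<rho> a. (\<rho> a, Move_Left)) ;; Act (\<lambda>\<rho> a. (3, Stay)) ;; Shift {} UNIV ;;
     While (\<lambda>\<rho>. \<rho> (Arr inp) \<noteq> 0)
       (Act (\<lambda>\<rho> a. (if a \<in> insert Counter (range Var) then 1 else \<rho> a, Move_Right))) ;;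
     drain (Arr inp) UNIV {}"

text \<open>The parameter \<open>i\<close> counts the cells already filled with ones on the counter
  and variable tapes: 0 is the situation before the walk along the input and \<open>length w\<close>
  the one after it.\<close>

definition boot_contents :: "'r \<Rightarrow> bool list \<Rightarrow> nat \<Rightarrow> ('r, 'v) tp \<Rightarrow> nat \<Rightarrow> nat" where
  "boot_contents inp w i = (\<lambda>a p. if p = 0 then 3
     else if a = Arr inp then if p \<le> length w then enc (w ! (p - 1)) else 0
     else if a \<in> insert Counter (range Var) \<and> p \<le> i then 1 else 0)"

definition init_memory :: "'r \<Rightarrow> bool list \<Rightarrow> 'r memory" where
  "init_memory inp w = (\<lambda>r ys. r = inp \<and> w ! hd ys)"

lemma initial_tapes_lift:
  fixes inp :: 'r
  shows "initial_tapes (Arr inp) w = lift (\<lambda>a :: ('r, 'v) tp. (boot_contents inp w 0 a)(0 := 0)) (\<lambda>_. 1)"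
proof -
  have "(if 0 \<le> z \<and> z < int (length w) then if w ! nat z then 2 else 1 else 0) =
      (if z < - 1 then 0 else ((boot_contents inp w 0 (Arr inp :: ('r, 'v) tp))(0 := 0)) (nat (z + 1)))" for z :: int
  proof -
    consider "z < -1" | "z = -1" | "0 \<le> z" "z < int (length w)" | "int (length w) \<le> z" by linarith
    then show ?thesis
    proof cases
      case 3
      then have "nat (z + 1) - 1 = nat z" "nat (z + 1) \<le> length w" "nat (z + 1) \<noteq> 0" by linarith+
      then show ?thesis using 3 by (simp add: boot_contents_def enc_def)
    qed (auto simp: boot_contents_def)
  qed
  note eq = this
  show ?thesis
  proof (rule ext)
    fix a :: "('r, 'v) tp"
    show "initial_tapes (Arr inp) w a = lift (\<lambda>a. (boot_contents inp w 0 a)(0 := 0)) (\<lambda>_. 1) a"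
    proof (cases "a = Arr inp")
      case True
      show ?thesis
        unfolding True initial_tapes_def lift_def input_tape_def eq by simp
    next
      case False
      then show ?thesis
        by (auto simp: initial_tapes_def lift_def blank_tape_def boot_contents_def)
    qed
  qed
qed

lemma marked_boot_contents: "marked (boot_contents inp w i)"
  by (auto simp: marked_def boot_contents_def)

text \<open>The input starts at cell 1, and one step left of it there is room for the marker. All
  heads then walk right together until the input tape shows a blank, writing the length of the input
  in unary on every tape that drives a loop.\<close>

lemma run_boot:
  fixes inp :: 'r and w and C0 :: "('r, 'v) tp \<Rightarrow> nat \<Rightarrow> nat"
  defines "C0 \<equiv> \<lambda>a. (boot_contents inp w 0 a)(0 := 0)"
  shows "run (boot inp) C0 (\<lambda>_. 1) (boot_contents inp w (length w)) (\<lambda>_. 0) (5 * length w + 10)"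
proof -
  let ?C = "boot_contents inp w :: nat \<Rightarrow> ('r, 'v) tp \<Rightarrow> nat \<Rightarrow> nat" and ?N = "length w"
  let ?f = "\<lambda>(\<rho> :: ('r, 'v) tp \<Rightarrow> nat) a. (if a \<in> insert Counter (range Var) then 1 else \<rho> a, Move_Right)"
  let ?W = "While (\<lambda>\<rho>. \<rho> (Arr inp) \<noteq> 0) (Act ?f)"
  have W: "run ?W (?C i) (\<lambda>_. Suc i) (?C ?N) (\<lambda>_. Suc ?N) (2 * (?N - i) + 1)" if "i \<le> ?N" for i
    using that
  proof (induction i rule: inc_induct)
    case base
    have "run ?W (?C ?N) (\<lambda>_. Suc ?N) (?C ?N) (\<lambda>_. Suc ?N) 1"
      by (rule run_While_False) (simp add: boot_contents_def)
    then show ?case by simp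
  next
    case (step i)
    have "run (Act ?f) (?C i) (\<lambda>_. Suc i)
        (\<lambda>a. (?C i a)(Suc i := fst (?f (\<lambda>b. ?C i b (Suc i)) a)))
        (\<lambda>a. nat_move (snd (?f (\<lambda>b. ?C i b (Suc i)) a)) (Suc i)) 1"
      by (rule run_Act) simp
    moreover have "(\<lambda>a. (?C i a)(Suc i := fst (?f (\<lambda>b. ?C i b (Suc i)) a))) = ?C (Suc i)"
      by (auto simp: boot_contents_def fun_eq_iff)
    ultimately have "run (Act ?f) (?C i) (\<lambda>_. Suc i) (?C (Suc i)) (\<lambda>_. Suc (Suc i)) 1"
      by simp
    then have "run ?W (?C i) (\<lambda>_. Suc i) (?C ?N) (\<lambda>_. Suc ?N) (1 + 1 + (2 * (?N - Suc i) + 1))"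
      by (rule run_While_True[rotated]) (use step in \<open>simp_all add: boot_contents_def\<close>)
    then show ?case
      by (rule run_mono) (use step in simp)
  qed
  have 1: "run (Act (\<lambda>\<rho> a. (\<rho> a, Move_Left))) C0 (\<lambda>_. 1) C0 (\<lambda>_. 0) 1"
    using run_Act[of "\<lambda>\<rho> a. (\<rho> a, Move_Left)" C0 "\<lambda>_. 1"] by simp
  have "run (Act (\<lambda>\<rho> a. (3, Stay))) C0 (\<lambda>_. 0) (\<lambda>a. (C0 a)(0 := 3)) (\<lambda>_. 0) 1"
    using run_Act[of "\<lambda>\<rho> a. (3, Stay)" C0 "\<lambda>_. 0"] by simp
  moreover have "(\<lambda>a. (C0 a)(0 := 3)) = ?C 0"
    by (auto simp: C0_def boot_contents_def fun_eq_iff)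
  ultimately have 2: "run (Act (\<lambda>\<rho> a. (3, Stay))) C0 (\<lambda>_. 0) (?C 0) (\<lambda>_. 0) 1"
    by simp
  have 3: "run (Shift {} UNIV) (?C 0) (\<lambda>_. 0) (?C 0) (\<lambda>_. Suc 0) 1"
    using run_Shift_right[of UNIV "?C 0" "\<lambda>_. 0"] by simp
  have 4: "run (drain (Arr inp) UNIV {}) (?C ?N) (\<lambda>_. Suc ?N) (?C ?N) (\<lambda>_. 0) (2 * Suc ?N + 1)"
    using run_drain[OF marked_boot_contents, of "Arr inp" UNIV "{}" inp w ?N "\<lambda>_. Suc ?N"] by simp
  show ?thesis
    unfolding boot_def
    by (rule run_mono[OF run_Sequ[OF 1 run_Sequ[OF 2 run_Sequ[OF 3 run_Sequ[OF W[of 0] 4]]]]]) simp_all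
qed

text \<open>The address of \<open>[i]\<close> is \<open>Suc i\<close>, exactly where bit
  \<open>i\<close> of the input lies once the marker occupies cell 0; the input tape therefore
  already is a unary relation. The other relations start empty since their cells are blank.\<close>

lemma state_ok_boot:
  assumes "ar inp = 1"
  shows "state_ok ar (length w) (init_memory inp w) (boot_contents inp w (length w))"
proof -
  have "tapes_ok (length w) (boot_contents inp w (length w))"
    using marked_boot_contents by (auto simp: tapes_ok_def counts_def boot_contents_def)
  moreover have "clean 0 (boot_contents inp w (length w))"
    by (auto simp: clean_def boot_contents_def)
  moreover have "mem_ok ar (length w) (init_memory inp w) (boot_contents inp w (length w))"
    unfolding mem_ok_def
  proof (intro allI ballI)
    fix r ys
    assume ys: "ys \<in> tuples (length w) (ar r)"
    show "boot_contents inp w (length w) (Arr r) (pos (length w) ys) = 2 \<longleftrightarrow> init_memory inp w r ys"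
    proof (cases "r = inp")
      case True
      then obtain i where "ys = [i]" "i < length w"
        using ys assms by (auto simp: tuples_def length_Suc_conv)
      then show ?thesis using True by (simp add: boot_contents_def init_memory_def)
    qed (simp add: boot_contents_def init_memory_def)
  qed
  ultimately show ?thesis by (simp add: state_ok_def)
qed

text \<open>The last step of the machine masks the answer with \<open>w \<noteq> []\<close>, since no cell of a relation is
  addressable when \<open>w\<close> is empty.\<close>

theorem relational_program_class_P:
  fixes c :: "('r :: finite, 'v :: finite) cmd"
  assumes wf: "wf_cmd ar {} c" and ar: "ar inp = 1" "ar out = 1"
    and correct: "\<And>w. w \<in> L \<longleftrightarrow> w \<noteq> [] \<and> sem (length w) c env (init_memory inp w) out [0]"
  shows "L \<in> class_P"
proof -
  obtain q where q: "implements ar {} c q" using ex_implements[OF wf] by blast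
  let ?f = "\<lambda>\<rho> :: ('r, 'v) tp \<Rightarrow> nat. enc (\<rho> Counter = 1 \<and> \<rho> (Arr out) = 2)"
  let ?p = "boot inp ;; compile c ;; Shift {} UNIV ;; Write (Arr out) ?f"
  have "poly_bounded (\<lambda>N. (5 * N + 10) + (q N + 2))"
    using q by (auto simp: implements_def intro!: poly_bounded_add poly_bounded_mult poly_bounded_const poly_bounded_id)
  then obtain P :: "nat poly" where P: "\<And>N. (5 * N + 10) + (q N + 2) \<le> poly P N"
    by (auto simp: poly_bounded_def)
  have wfp: "wf_prog ?p"
    by (auto simp: boot_def)
  have "\<exists>T t. t \<le> poly P (length w) \<and> exec ?p (initial_tapes (Arr inp) w) t T \<and>
      (read_tape (T (Arr out)) = 2 \<longleftrightarrow> w \<in> L)" for w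
  proof -
    let ?N = "length w" and ?C0 = "boot_contents inp w (length w) :: ('r, 'v) tp \<Rightarrow> nat \<Rightarrow> nat"
    let ?H = "heads {} env 0 :: ('r, 'v) tp \<Rightarrow> nat"
    have H: "?H = (\<lambda>_. 0)"
      by (rule ext) (simp add: heads_def split: tp.split)
    obtain C where C: "run (compile c) ?C0 (\<lambda>_. 0) C (\<lambda>_. 0) (q ?N)"
      "state_ok ar ?N (sem ?N c env (init_memory inp w)) C"
      using q state_ok_boot[of ar inp w, OF ar(1)] H unfolding implements_def by (metis empty_iff)
    \<comment> \<open>The tuple \<open>[0]\<close> has address 1, and cell 1 of
      \<open>Counter\<close> holds a one exactly if the input is nonempty.\<close>
    have 3: "run (Shift {} UNIV) C (\<lambda>_. 0) C (\<lambda>_. 1) 1"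
      using run_Shift_right[of UNIV C "\<lambda>_. 0"] by simp
    define C' where "C' = C(Arr out := (C (Arr out))(1 := ?f (\<lambda>b. C b 1)))"
    have 4: "run (Write (Arr out) ?f) C (\<lambda>_. 1) C' (\<lambda>_. 1) 1"
      unfolding C'_def by (rule run_Write)
    have "run ?p (\<lambda>a. (boot_contents inp w 0 a)(0 := 0)) (\<lambda>_. 1) C' (\<lambda>_. 1) ((5 * ?N + 10) + (q ?N + (1 + 1)))"
      by (rule run_Sequ[OF run_boot run_Sequ[OF C(1) run_Sequ[OF 3 4]]])
    then obtain t where t: "t \<le> (5 * ?N + 10) + (q ?N + 2)"
      "exec ?p (initial_tapes (Arr inp) w) t (lift C' (\<lambda>_. 1))"
      unfolding initial_tapes_lift by (auto simp: run_def)
    have "read_tape (lift C' (\<lambda>_. 1) (Arr out)) = C' (Arr out) 1"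
      by (simp add: read_tape_def lift_def)
    also have "\<dots> = 2 \<longleftrightarrow> C Counter 1 = 1 \<and> C (Arr out) 1 = 2"
      by (simp add: C'_def)
    also have "\<dots> \<longleftrightarrow> w \<in> L"
    proof (cases "w = []")
      case True
      then show ?thesis
        using C(2) correct[of w] by (simp add: state_ok_def tapes_ok_def counts_def)
    next
      case False
      then have "[0] \<in> tuples ?N (ar out)" using ar by (simp add: tuples_def)
      then have "C (Arr out) (pos ?N [0]) = 2 \<longleftrightarrow> sem ?N c env (init_memory inp w) out [0]"
        using C(2) unfolding state_ok_def mem_ok_def by blast
      moreover have "C Counter 1 = 1"
        using C(2) False by (simp add: state_ok_def tapes_ok_def counts_def Suc_le_eq)
      ultimately show ?thesis using correct[of w] False by simp
    qed
    finally show ?thesis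
      using t P[of ?N] le_trans by blast
  qed
  then show ?thesis
    by (rule class_P_I[OF wfp])
qed

section \<open>Convexly independent sets of split graphs\<close>

lemma vwalk_arcs_nth: "Suc i < length p \<Longrightarrow> (p ! i, p ! Suc i) \<in> set (vwalk_arcs p)"
proof (induction p arbitrary: i rule: vwalk_arcs.induct)
  case (3 x y xs)
  then show ?case by (cases i) auto
qed auto

locale split_partition = pair_graph G for G :: "'a pair_pre_digraph" +
  fixes K I :: "'a set"
  assumes verts: "K \<union> I = pverts G" and disjoint: "K \<inter> I = {}"
    and clique: "u \<in> K \<Longrightarrow> v \<in> K \<Longrightarrow> u \<noteq> v \<Longrightarrow> (u, v) \<in> parcs G"
    and indep: "u \<in> I \<Longrightarrow> v \<in> I \<Longrightarrow> (u, v) \<notin> parcs G"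
begin

definition adj :: "'a \<Rightarrow> 'a \<Rightarrow> bool" where
  "adj u v \<longleftrightarrow> (u, v) \<in> parcs G"

definition nbh :: "'a \<Rightarrow> 'a set" where
  "nbh u = {v. adj u v}"

lemma adj_sym: "adj u v \<Longrightarrow> adj v u"
  using pair_sym_arcs by (auto simp: adj_def symmetric_def sym_def)

lemma adj_irrefl: "\<not> adj u u"
  using pair_no_loops[of "(u, u)"] by (auto simp: adj_def)

lemma adj_verts: "adj u v \<Longrightarrow> u \<in> K \<union> I \<and> v \<in> K \<union> I"
  using in_arcsD1 in_arcsD2 verts by (auto simp: adj_def)

lemma adj_clique: "u \<in> K \<Longrightarrow> v \<in> K \<Longrightarrow> u \<noteq> v \<Longrightarrow> adj u v"
  using clique by (simp add: adj_def)

lemma adj_indep: "u \<in> I \<Longrightarrow> adj u v \<Longrightarrow> v \<in> K"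
  using indep adj_verts[of u v] by (auto simp: adj_def)

section \<open>Induced paths in a split graph\<close>

lemma induced_path_adj:
  assumes "induced_path G p" "i < length p" "j < length p"
  shows "adj (p ! i) (p ! j) \<longleftrightarrow> j = Suc i \<or> i = Suc j"
proof
  show "adj (p ! i) (p ! j) \<Longrightarrow> j = Suc i \<or> i = Suc j"
    using assms by (auto simp: induced_path_def adj_def)
  have "adj (p ! k) (p ! Suc k)" if "Suc k < length p" for k
    using assms(1) vwalk_arcs_nth[OF that] by (auto simp: induced_path_def vpath_def vwalk_def adj_def)
  then show "j = Suc i \<or> i = Suc j \<Longrightarrow> adj (p ! i) (p ! j)"
    using assms(2,3) adj_sym by blast
qed

lemma induced_path_distinct: "induced_path G p \<Longrightarrow> distinct p \<and> set p \<subseteq> K \<union> I \<and> p \<noteq> []"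
  using verts by (auto simp: induced_path_def vpath_def vwalk_def)

text \<open>A vertex of \<open>I\<close> has all its neighbours in the clique, so its two neighbours
  on the path would be joined by a chord.\<close>

lemma interior_in_clique:
  assumes "induced_path G p" "0 < i" "Suc i < length p"
  shows "p ! i \<in> K"
proof (rule ccontr)
  assume "p ! i \<notin> K"
  have ne: "p ! (i - 1) \<noteq> p ! Suc i"
    using assms induced_path_distinct[OF assms(1)] by (simp add: nth_eq_iff_index_eq)
  have "p ! i \<in> I"
    using assms \<open>p ! i \<notin> K\<close> induced_path_distinct[OF assms(1)] by (meson Suc_lessD UnE nth_mem subsetD)
  moreover have "adj (p ! i) (p ! (i - 1))" "adj (p ! i) (p ! Suc i)"
    using assms by (auto simp: induced_path_adj)
  ultimately have "adj (p ! (i - 1)) (p ! Suc i)"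
    using adj_indep adj_clique ne by blast
  moreover have "i - 1 < length p" "i - 1 \<noteq> Suc (Suc i)" "Suc i \<noteq> Suc (i - 1)"
    using assms by simp_all
  ultimately show False
    using assms(3) induced_path_adj[OF assms(1), of "i - 1" "Suc i"] by blast
qed

text \<open>The two path neighbours of an interior vertex are not adjacent, so they are not both in
  the clique. One of them lies in \<open>I\<close>, hence cannot be interior and must be an end of
  the path; \<open>m\<close> is the index of the other.\<close>

lemma interior_end:
  assumes "induced_path G p" "0 < i" "Suc i < length p"
  obtains j m where "{j, m} = {i - 1, Suc i}" "p ! j \<in> {hd p, last p}" "p ! j \<in> I"
    "adj (p ! j) (p ! i)" "adj (p ! i) (p ! m)" "\<not> adj (p ! j) (p ! m)" "p ! j \<noteq> p ! m" "m < length p"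
proof -
  have p: "p \<noteq> []" "distinct p" "set p \<subseteq> K \<union> I"
    using induced_path_distinct[OF assms(1)] by auto
  have adj: "adj (p ! (i - 1)) (p ! i)" "adj (p ! Suc i) (p ! i)"
      "\<not> adj (p ! (i - 1)) (p ! Suc i)" "\<not> adj (p ! Suc i) (p ! (i - 1))"
    using assms by (auto simp: induced_path_adj)
  have adj': "adj (p ! i) (p ! (i - 1))" "adj (p ! i) (p ! Suc i)"
    using adj by (auto intro: adj_sym)
  have ne: "p ! (i - 1) \<noteq> p ! Suc i"
    using assms p by (simp add: nth_eq_iff_index_eq)
  have "p ! (i - 1) \<in> I \<or> p ! Suc i \<in> I"
    using adj ne adj_clique adj_verts by blast
  then show thesis
  proof
    assume I: "p ! (i - 1) \<in> I"
    have "i - 1 = 0"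
      using I interior_in_clique[OF assms(1), of "i - 1"] assms disjoint by fastforce
    then have "p ! (i - 1) = hd p" using p by (simp add: hd_conv_nth)
    then show thesis
      by (intro that[of "i - 1" "Suc i"]) (use I adj adj' ne assms in simp_all)
  next
    assume I: "p ! Suc i \<in> I"
    have "\<not> Suc (Suc i) < length p"
      using I interior_in_clique[OF assms(1), of "Suc i"] disjoint by auto
    then have "length p - 1 = Suc i" using assms(3) by linarith
    then have "p ! Suc i = last p"
      using p(1) by (simp add: last_conv_nth)
    then have hd_last: "p ! Suc i \<in> {hd p, last p}" by simp
    have "{Suc i, i - 1} = {i - 1, Suc i}" by blast
    then show thesis
      using hd_last I adj(2) adj'(1) adj(4) ne[symmetric] by (rule that) (use assms in simp)
  qed
qed

section \<open>Convex sets that keep one vertex out of a hull\<close>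

lemma convexI:
  assumes "C \<subseteq> pverts G"
    and "\<And>p i. induced_path G p \<Longrightarrow> hd p \<in> C \<Longrightarrow> last p \<in> C \<Longrightarrow> 0 < i \<Longrightarrow> Suc i < length p \<Longrightarrow> p ! i \<in> C"
  shows "monophonically_convex G C"
  unfolding monophonically_convex_def
proof (intro conjI allI impI assms(1) subsetI)
  fix p x
  assume p: "induced_path G p \<and> hd p \<in> C \<and> last p \<in> C" and "x \<in> set p"
  then obtain i where i: "i < length p" "p ! i = x" by (auto simp: in_set_conv_nth)
  have ne: "p \<noteq> []" using \<open>x \<in> set p\<close> by auto
  show "x \<in> C"
  proof (cases "0 < i \<and> Suc i < length p")
    case True
    then show ?thesis using assms(2) p i by blast
  next
    case False
    then have "i = 0 \<or> i = length p - 1" using i(1) by auto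
    then show ?thesis using i(2) p ne by (auto simp: hd_conv_nth last_conv_nth)
  qed
qed

lemma convex_remove_indep: "v \<in> I \<Longrightarrow> monophonically_convex G (pverts G - {v})"
proof (rule convexI)
  fix p i
  assume "v \<in> I" "induced_path G p" "0 < i" "Suc i < length p"
  then show "p ! i \<in> pverts G - {v}"
    using interior_in_clique[of p i] disjoint verts by auto
qed auto

text \<open>Every interior vertex of an induced path is adjacent to an end in \<open>I\<close>. Ends
  in this set that lie in \<open>I\<close> belong to \<open>T\<close>, and those are not adjacent to
  \<open>v\<close>.\<close>

lemma convex_remove_far:
  assumes "T \<subseteq> I" "\<forall>i\<in>T. \<not> adj i v"
  shows "monophonically_convex G (T \<union> (K - {v}))"
proof (rule convexI)
  fix p i
  assume p: "induced_path G p" "hd p \<in> T \<union> (K - {v})" "last p \<in> T \<union> (K - {v})" "0 < i" "Suc i < length p"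
  obtain j where "p ! j \<in> {hd p, last p}" "p ! j \<in> I" "adj (p ! j) (p ! i)"
    using interior_end[OF p(1,4,5)] by metis
  then have "p ! i \<noteq> v"
    using p(2,3) assms(2) disjoint by auto
  then show "p ! i \<in> T \<union> (K - {v})"
    using interior_in_clique[OF p(1,4,5)] by simp
qed (use assms verts in auto)

text \<open>All interior vertices lie in the neighbourhood of \<open>t\<close>, which contains the
  other neighbourhoods. If one were \<open>v\<close>, the end in \<open>I\<close> next to it would
  be \<open>t\<close>, and its other path neighbour would be adjacent to \<open>v\<close> but not to
  \<open>t\<close>; such a vertex can be neither interior nor an end in this set.\<close>

lemma convex_remove_private:
  assumes "T \<subseteq> I" "t \<in> T"
    and "\<forall>i\<in>T. i \<noteq> t \<longrightarrow> \<not> adj i v \<and> nbh i \<subseteq> nbh t"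
  shows "monophonically_convex G (T \<union> (nbh t - {v}))" (is "monophonically_convex G ?C")
proof (rule convexI)
  have nbhK: "nbh t \<subseteq> K"
    using assms(1,2) adj_indep by (auto simp: nbh_def)
  show "?C \<subseteq> pverts G"
    using assms(1) nbhK verts by auto
  have int: "p ! i \<in> nbh t"
    if p: "induced_path G p" "hd p \<in> ?C" "last p \<in> ?C" "0 < i" "Suc i < length p" for p i
  proof -
    obtain j where j: "p ! j \<in> {hd p, last p}" "p ! j \<in> I" "adj (p ! j) (p ! i)"
      using interior_end[OF p(1,4,5)] by metis
    then have "p ! j \<in> T"
      using p(2,3) nbhK disjoint by auto
    then show ?thesis
      using assms(3) j(3) by (auto simp: nbh_def)
  qed
  fix p i
  assume p: "induced_path G p" "hd p \<in> ?C" "last p \<in> ?C" "0 < i" "Suc i < length p"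
  have "p ! i \<noteq> v"
  proof
    assume v: "p ! i = v"
    obtain j m where j: "p ! j \<in> {hd p, last p}" "p ! j \<in> I" "adj (p ! j) (p ! i)"
      "adj (p ! i) (p ! m)" "\<not> adj (p ! j) (p ! m)" "p ! j \<noteq> p ! m" "m < length p"
      using interior_end[OF p(1,4,5)] by metis
    then have "p ! j \<in> T"
      using p(2,3) nbhK disjoint by auto
    then have t: "p ! j = t"
      using assms(3) j(3) v by auto
    have "p ! m \<notin> nbh t" using j(5) t by (simp add: nbh_def)
    have "adj (p ! m) v" using j(4) v adj_sym by simp
    then have "p ! m \<notin> T" using assms(3) j(6) t by metis
    show False
    proof (cases "0 < m \<and> Suc m < length p")
      case True
      then show False using int[OF p(1-3)] \<open>p ! m \<notin> nbh t\<close> by blast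
    next
      case False
      then have "m = 0 \<or> m = length p - 1" using j(7) by auto
      then have "p ! m = hd p \<or> p ! m = last p"
        using p(5) by (cases p) (auto simp: hd_conv_nth last_conv_nth)
      then show False using p(2,3) \<open>p ! m \<notin> nbh t\<close> \<open>p ! m \<notin> T\<close> by auto
    qed
  qed
  then show "p ! i \<in> ?C"
    using int[OF p] by simp
qed

lemma induced_path_3:
  assumes "adj a b" "adj b c" "\<not> adj a c" "a \<noteq> c"
  shows "induced_path G [a, b, c]"
proof -
  have "a \<noteq> b" "b \<noteq> c" using assms adj_irrefl by auto
  moreover have "\<not> adj c a" using assms adj_sym by blast
  moreover have "a \<in> pverts G" "b \<in> pverts G" "c \<in> pverts G"
    using assms adj_verts verts by auto
  ultimately show ?thesis
    using assms adj_irrefl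
    by (auto simp: induced_path_def vpath_def vwalk_def adj_def less_Suc_eq numeral_3_eq_3)
qed

lemma induced_path_4:
  assumes "adj a b" "adj b c" "adj c d" "\<not> adj a c" "\<not> adj a d" "\<not> adj b d" "a \<noteq> c" "a \<noteq> d" "b \<noteq> d"
  shows "induced_path G [a, b, c, d]"
proof -
  have "a \<noteq> b" "b \<noteq> c" "c \<noteq> d" using assms adj_irrefl by auto
  moreover have "\<not> adj c a" "\<not> adj d a" "\<not> adj d b" using assms adj_sym by blast+
  moreover have "a \<in> pverts G" "b \<in> pverts G" "c \<in> pverts G" "d \<in> pverts G"
    using assms adj_verts verts by auto
  ultimately show ?thesis
    using assms adj_irrefl
    by (auto simp: induced_path_def vpath_def vwalk_def adj_def less_Suc_eq numeral_eq_Suc)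
qed

text \<open>Necessity comes from three induced paths through \<open>v\<close> with ends in
  \<open>S - {v}\<close>: \<open>t, v, i\<close> if \<open>i\<close> is a second neighbour of
  \<open>v\<close>, \<open>t, v, k, i\<close> if \<open>k\<close> is adjacent to \<open>i\<close>
  but not to \<open>t\<close>, and \<open>t, v, w\<close> if \<open>w\<close> is a clique vertex not
  adjacent to \<open>t\<close>. Sufficiency exhibits a convex set that contains the rest of
  \<open>S\<close> but not \<open>v\<close>.\<close>

lemma independent_iff:
  "monophonic_convexly_independent G S \<longleftrightarrow> S \<subseteq> K \<union> I \<and>
    (\<forall>v\<in>S \<inter> K. \<forall>t\<in>S \<inter> I. adj t v \<longrightarrow>
      (\<forall>i\<in>S \<inter> I. i \<noteq> t \<longrightarrow> \<not> adj i v \<and> nbh i \<subseteq> nbh t) \<and> S \<inter> K \<subseteq> nbh t)" (is "?L \<longleftrightarrow> ?R")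
proof
  assume L: ?L
  then have S: "S \<subseteq> K \<union> I" using verts by (simp add: monophonic_convexly_independent_def)
  have no_path: False if "v \<in> S" "induced_path G p" "v \<in> set p" "hd p \<in> S - {v}" "last p \<in> S - {v}" for v p
  proof -
    have SV: "S - {v} \<subseteq> pverts G" using S verts by auto
    have "set p \<subseteq> monophonic_hull G (S - {v})"
      using monophonically_convex_hull(1,2)[OF SV] that(2,4,5)
      unfolding monophonically_convex_def by (meson subsetD)
    then show False
      using L that(1,3) unfolding monophonic_convexly_independent_def by blast
  qed
  show ?R
  proof (intro conjI S ballI impI subsetI)
    fix v t i
    assume v: "v \<in> S \<inter> K" and t: "t \<in> S \<inter> I" "adj t v" and i: "i \<in> S \<inter> I" "i \<noteq> t"
    have vI: "v \<noteq> t" "v \<noteq> i" using v t i disjoint by auto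
    have ti: "\<not> adj t i" using t i indep by (simp add: adj_def)
    show *: "\<not> adj i v"
    proof
      assume "adj i v"
      then have "induced_path G [t, v, i]"
        using t ti i adj_sym by (intro induced_path_3) auto
      then show False
        using no_path[of v "[t, v, i]"] v t i vI by auto
    qed
    fix k assume k: "k \<in> nbh i"
    show "k \<in> nbh t"
    proof (rule ccontr)
      assume nk: "k \<notin> nbh t"
      have kK: "k \<in> K" using k i adj_indep by (auto simp: nbh_def)
      have "k \<noteq> v" using nk t by (auto simp: nbh_def)
      then have "induced_path G [t, v, k, i]"
        using t ti i v vI k nk kK * adj_sym adj_clique disjoint
        by (intro induced_path_4) (auto simp: nbh_def)
      then show False
        using no_path[of v "[t, v, k, i]"] v t i vI by auto
    qed
  next
    fix v t w
    assume v: "v \<in> S \<inter> K" and t: "t \<in> S \<inter> I" "adj t v" and w: "w \<in> S \<inter> K"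
    show "w \<in> nbh t"
    proof (rule ccontr)
      assume nw: "w \<notin> nbh t"
      have "w \<noteq> v" "v \<noteq> t" "w \<noteq> t" using nw t v w disjoint by (auto simp: nbh_def)
      then have "induced_path G [t, v, w]"
        using t v w nw adj_clique by (intro induced_path_3) (auto simp: nbh_def)
      then show False
        using no_path[of v "[t, v, w]"] v t w \<open>w \<noteq> v\<close> \<open>v \<noteq> t\<close> by auto
    qed
  qed
next
  assume R: ?R
  show ?L
    unfolding monophonic_convexly_independent_def
  proof (intro conjI ballI)
    show SV: "S \<subseteq> pverts G" using R verts by auto
    fix v assume v: "v \<in> S"
    have avoid: "v \<notin> monophonic_hull G (S - {v})"
      if "monophonically_convex G C" "S - {v} \<subseteq> C" "v \<notin> C" for C
      using monophonically_convex_hull(3)[of "S - {v}" G C] SV that by auto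
    consider "v \<in> I" | "v \<in> K" "\<forall>i\<in>S \<inter> I. \<not> adj i v" | t where "v \<in> K" "t \<in> S \<inter> I" "adj t v"
      using v R by auto
    then show "v \<notin> monophonic_hull G (S - {v})"
    proof cases
      case 1
      show ?thesis
        by (rule avoid[OF convex_remove_indep[OF 1]]) (use SV in auto)
    next
      case 2
      show ?thesis
        by (rule avoid[OF convex_remove_far[of "S \<inter> I" v]]) (use 2 R disjoint in auto)
    next
      case 3
      have "(\<forall>i\<in>S \<inter> I. i \<noteq> t \<longrightarrow> \<not> adj i v \<and> nbh i \<subseteq> nbh t) \<and> S \<inter> K \<subseteq> nbh t"
        using R 3 v by blast
      then show ?thesis
        by (intro avoid[OF convex_remove_private[of "S \<inter> I" t v]]) (use 3 R disjoint in auto)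
    qed
  qed
qed

end

section \<open>Reduction to bipartite independent sets\<close>

text \<open>The bound \<open>t\<close> allows partitions of the subgraph on the first
  \<open>t\<close> vertices, which is what the incremental search maintains.\<close>

definition split_on :: "(nat \<Rightarrow> nat \<Rightarrow> bool) \<Rightarrow> nat \<Rightarrow> (nat \<Rightarrow> bool) \<Rightarrow> bool" where
  "split_on A t kk \<longleftrightarrow> (\<forall>y<t. \<forall>z<t. y \<noteq> z \<longrightarrow>
     (kk y \<and> kk z \<longrightarrow> A y z) \<and> (\<not> kk y \<and> \<not> kk z \<longrightarrow> \<not> A y z))"

text \<open>
  For a vertex \<open>i\<close> of the independent part, the two parts consist of the other vertices \<open>u\<close> of the
  independent part with \<open>N(u) \<subseteq> N(i)\<close> and of \<open>N(i)\<close>.  All other indices \<open>i\<close> stand for the case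
  of a set without edges between the clique and the independent part.
\<close>

definition left_part :: "(nat \<Rightarrow> nat \<Rightarrow> bool) \<Rightarrow> nat \<Rightarrow> (nat \<Rightarrow> bool) \<Rightarrow> nat \<Rightarrow> nat set" where
  "left_part A n kk i =
     {u. u < n \<and> \<not> kk u \<and> (i < n \<and> \<not> kk i \<longrightarrow> u \<noteq> i \<and> (\<forall>z<n. A u z \<longrightarrow> A i z))}"

definition right_part :: "(nat \<Rightarrow> nat \<Rightarrow> bool) \<Rightarrow> nat \<Rightarrow> (nat \<Rightarrow> bool) \<Rightarrow> nat \<Rightarrow> nat set" where
  "right_part A n kk i = {v. v < n \<and> (if i < n \<and> \<not> kk i then A i v else kk v)}"

text \<open>Edges inside a side are ignored; in the application the right side consists of mutually
  adjacent clique vertices.\<close>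

definition bip_indep :: "('a \<Rightarrow> 'a \<Rightarrow> bool) \<Rightarrow> 'a set \<Rightarrow> 'a set \<Rightarrow> 'a set \<Rightarrow> bool" where
  "bip_indep A L R J \<longleftrightarrow> J \<subseteq> L \<union> R \<and> (\<forall>u\<in>J \<inter> L. \<forall>v\<in>J \<inter> R. \<not> A u v)"

text \<open>By \<open>independent_iff\<close> at most one vertex of the independent part has a
  neighbour in \<open>S\<close>. The index \<open>i\<close> guesses it, and the summand 1 counts it,
  since both parts leave it out.\<close>

lemma independent_set_iff_bip_indep:
  fixes G :: "nat pair_pre_digraph"
  assumes "pair_graph G" "pverts G = {0..<n}" "split_on A n kk"
    and A: "\<And>u v. u < n \<Longrightarrow> v < n \<Longrightarrow> A u v \<longleftrightarrow> (u, v) \<in> parcs G"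
  shows "(\<exists>S. monophonic_convexly_independent G S \<and> k \<le> card S) \<longleftrightarrow>
    (\<exists>i\<le>n. \<exists>J. bip_indep A (left_part A n kk i) (right_part A n kk i) J \<and>
      k \<le> card J + (if i < n \<and> \<not> kk i then 1 else 0))" (is "?L \<longleftrightarrow> ?R")
proof -
  define K where "K = {y. y < n \<and> kk y}"
  define I where "I = {y. y < n \<and> \<not> kk y}"
  interpret pg: pair_graph G
    by (rule assms(1))
  interpret split_partition G K I
  proof (intro split_partition.intro split_partition_axioms.intro assms(1))
    fix u v
    show "u \<in> K \<Longrightarrow> v \<in> K \<Longrightarrow> u \<noteq> v \<Longrightarrow> (u, v) \<in> parcs G"
      using assms(3) A by (auto simp: split_on_def K_def)
    show "u \<in> I \<Longrightarrow> v \<in> I \<Longrightarrow> (u, v) \<notin> parcs G"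
      using assms(3) A[of u v] pg.pair_no_loops[of "(u, v)"]
      by (cases "u = v") (auto simp: split_on_def I_def)
  qed (auto simp: K_def I_def assms(2))
  have AA: "A u v \<longleftrightarrow> adj u v" if "u < n" "v < n" for u v
    using A[OF that] by (simp add: adj_def)
  have adj_n: "adj u v \<Longrightarrow> u < n \<and> v < n" for u v
    using adj_verts[of u v] by (auto simp: K_def I_def)
  have KI: "K \<union> I = {0..<n}" using verts assms(2) by simp
  have left: "left_part A n kk i = (if i \<in> I then {u\<in>I. u \<noteq> i \<and> nbh u \<subseteq> nbh i} else I)" for i
    using AA adj_n by (auto simp: left_part_def I_def nbh_def)
  have right: "right_part A n kk i = (if i \<in> I then nbh i else K)" for i
    using AA adj_n by (auto simp: right_part_def I_def K_def nbh_def)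
  have one: "(if i < n \<and> \<not> kk i then 1 else 0) = (if i \<in> I then 1 else 0 :: nat)" for i
    by (simp add: I_def)
  have leftI: "left_part A n kk i \<subseteq> I" for i by (auto simp: left)
  have rightK: "right_part A n kk i \<subseteq> K" for i using adj_indep by (auto simp: right nbh_def)
  have no_A: "\<not> A u v" if "u \<in> I" "v \<in> K" "\<not> adj u v" for u v
    using that AA by (simp add: I_def K_def)
  show ?thesis
  proof
    assume ?L
    then obtain S where S: "monophonic_convexly_independent G S" "k \<le> card S" by blast
    note S1 = S(1)[unfolded independent_iff]
    then have fin: "finite S" using KI finite_subset by fastforce
    show ?R
    proof (cases "\<exists>v\<in>S \<inter> K. \<exists>t\<in>S \<inter> I. adj t v")
      case True
      then obtain v t where v: "v \<in> S \<inter> K" "t \<in> S \<inter> I" "adj t v" by blast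
      then have t: "\<forall>i\<in>S \<inter> I. i \<noteq> t \<longrightarrow> nbh i \<subseteq> nbh t" "S \<inter> K \<subseteq> nbh t"
        using S1 by blast+
      \<comment> \<open>All of \<open>S \<inter> K\<close> lies in the neighbourhood of
        \<open>t\<close>, so each \<open>w\<close> can take the role of \<open>v\<close>.\<close>
      have "\<not> adj u w" if "u \<in> S \<inter> I" "u \<noteq> t" "w \<in> S \<inter> K" for u w
      proof -
        have "adj t w" using t(2) that(3) by (auto simp: nbh_def)
        then show ?thesis using S1 that v(2) by blast
      qed
      then have no_edge: "\<not> A u w" if "u \<in> S \<inter> I" "u \<noteq> t" "w \<in> S \<inter> K" for u w
        using that by (intro no_A) auto
      have "t \<in> I" using v by simp
      have "bip_indep A (left_part A n kk t) (right_part A n kk t) (S - {t})"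
        unfolding bip_indep_def
      proof (intro conjI ballI)
        show "S - {t} \<subseteq> left_part A n kk t \<union> right_part A n kk t"
          using S1 t \<open>t \<in> I\<close> by (auto simp: left right)
        show "\<not> A u w" if "u \<in> (S - {t}) \<inter> left_part A n kk t" "w \<in> (S - {t}) \<inter> right_part A n kk t" for u w
          using that leftI[of t] rightK[of t] by (intro no_edge) auto
      qed
      moreover have "card S = card (S - {t}) + 1"
        using fin v(2) by (metis IntD1 Suc_eq_plus1 card_Suc_Diff1)
      ultimately show ?thesis
        using S(2) v(2) by (intro exI[of _ t]) (auto simp: I_def)
    next
      case False
      have "n \<notin> I" by (simp add: I_def)
      then have lr: "left_part A n kk n = I" "right_part A n kk n = K"
        by (simp_all add: left right)
      have "bip_indep A (left_part A n kk n) (right_part A n kk n) S"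
        unfolding bip_indep_def lr
      proof (intro conjI ballI)
        show "S \<subseteq> I \<union> K" using S1 by blast
        show "\<not> A u v" if "u \<in> S \<inter> I" "v \<in> S \<inter> K" for u v
          using that False by (intro no_A) auto
      qed
      then show ?thesis
        using S(2) by (intro exI[of _ n]) auto
    qed
  next
    assume ?R
    then obtain i J where iJ: "bip_indep A (left_part A n kk i) (right_part A n kk i) J"
      "k \<le> card J + (if i \<in> I then 1 else 0)" unfolding one by blast
    have J: "J \<subseteq> K \<union> I" "J \<inter> K = J \<inter> right_part A n kk i" "J \<inter> I = J \<inter> left_part A n kk i"
    proof -
      have "J \<subseteq> left_part A n kk i \<union> right_part A n kk i"
        using iJ(1) by (simp add: bip_indep_def)
      then show "J \<subseteq> K \<union> I" "J \<inter> K = J \<inter> right_part A n kk i" "J \<inter> I = J \<inter> left_part A n kk i"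
        using leftI[of i] rightK[of i] disjoint by blast+
    qed
    have no_edge: "\<not> adj u v" if "u \<in> J \<inter> I" "v \<in> J \<inter> K" for u v
      using iJ(1) that J AA adj_n[of u v] unfolding bip_indep_def by blast
    have fin: "finite J" using J(1) KI finite_subset by fastforce
    show ?L
    proof (cases "i \<in> I")
      case False
      then have "monophonic_convexly_independent G J"
        unfolding independent_iff using J(1) no_edge by blast
      then show ?thesis using iJ(2) False by auto
    next
      case True
      have iJ': "i \<notin> J" using J True disjoint by (auto simp: left)
      have "monophonic_convexly_independent G (insert i J)"
        unfolding independent_iff
      proof (intro conjI ballI impI)
        show "insert i J \<subseteq> K \<union> I" using True J(1) by simp
        fix v t
        assume v: "v \<in> insert i J \<inter> K" and t: "t \<in> insert i J \<inter> I" "adj t v"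
        have v': "v \<in> J \<inter> K" using v True disjoint by auto
        have "t = i" using no_edge v' t by blast
        show "insert i J \<inter> K \<subseteq> nbh t"
          using \<open>t = i\<close> J(2) True disjoint by (auto simp: right)
        fix u assume u: "u \<in> insert i J \<inter> I" "u \<noteq> t"
        then have "u \<in> J \<inter> I" using \<open>t = i\<close> by auto
        then show "\<not> adj u v" "nbh u \<subseteq> nbh t"
          using no_edge v' J(3) True \<open>t = i\<close> by (auto simp: left)
      qed
      then show ?thesis using iJ(2) True iJ' fin by (intro exI[of _ "insert i J"]) simp
    qed
  qed
qed

section \<open>Bipartite independent sets by auctions\<close>

text \<open>
  \<open>Ow u v\<close> says that \<open>u\<close> currently owns \<open>v\<close>, and \<open>pr v\<close> is the price of \<open>v\<close>.
\<close>

definition auction_inv ::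
  "('a \<Rightarrow> 'a \<Rightarrow> bool) \<Rightarrow> 'a set \<Rightarrow> 'a set \<Rightarrow> nat \<Rightarrow> ('a \<Rightarrow> nat) \<Rightarrow> ('a \<Rightarrow> 'a \<Rightarrow> bool) \<Rightarrow> bool" where
  "auction_inv A L R N pr Ow \<longleftrightarrow>
     (\<forall>u v. Ow u v \<longrightarrow> u \<in> L \<and> v \<in> R \<and> A u v) \<and>
     (\<forall>u v v'. Ow u v \<longrightarrow> Ow u v' \<longrightarrow> v = v') \<and>
     (\<forall>u u' v. Ow u v \<longrightarrow> Ow u' v \<longrightarrow> u = u') \<and>
     (\<forall>v\<in>R. 0 < pr v \<longleftrightarrow> (\<exists>u. Ow u v)) \<and>
     (\<forall>u v z. Ow u v \<longrightarrow> z \<in> R \<longrightarrow> A u z \<longrightarrow> pr v \<le> pr z + 1) \<and>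
     (\<forall>v. pr v \<le> N)"

definition can_bid ::
  "('a \<Rightarrow> 'a \<Rightarrow> bool) \<Rightarrow> 'a set \<Rightarrow> 'a set \<Rightarrow> nat \<Rightarrow> ('a \<Rightarrow> nat) \<Rightarrow> ('a \<Rightarrow> 'a \<Rightarrow> bool) \<Rightarrow> 'a \<Rightarrow> 'a \<Rightarrow> bool" where
  "can_bid A L R N pr Ow u v \<longleftrightarrow> u \<in> L \<and> v \<in> R \<and> A u v \<and> (\<forall>z. \<not> Ow u z) \<and>
     (\<forall>z\<in>R. A u z \<longrightarrow> pr v \<le> pr z) \<and> pr v < N"

text \<open>Only the price of \<open>v\<close> grows, so the inequality survives for every other
  owner, and the previous owner of \<open>v\<close> loses it. The bidder took a cheapest neighbour,
  so after the increment it pays at most one more than any neighbour costs.\<close>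

lemma auction_inv_bid:
  assumes "auction_inv A L R N pr Ow" "can_bid A L R N pr Ow u v"
  shows "auction_inv A L R N (pr(v := pr v + 1)) (\<lambda>a b. (Ow a b \<and> b \<noteq> v) \<or> (a = u \<and> b = v))"
  unfolding auction_inv_def
proof (intro conjI)
  note inv = assms(1)[unfolded auction_inv_def] and bid = assms(2)[unfolded can_bid_def]
  let ?Ow = "\<lambda>a b. (Ow a b \<and> b \<noteq> v) \<or> (a = u \<and> b = v)" and ?pr = "pr(v := pr v + 1)"
  show "\<forall>a b. ?Ow a b \<longrightarrow> a \<in> L \<and> b \<in> R \<and> A a b" using inv bid by blast
  show "\<forall>a b b'. ?Ow a b \<longrightarrow> ?Ow a b' \<longrightarrow> b = b'" using inv bid by blast
  show "\<forall>a a' b. ?Ow a b \<longrightarrow> ?Ow a' b \<longrightarrow> a = a'" using inv by blast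
  show "\<forall>b\<in>R. 0 < ?pr b \<longleftrightarrow> (\<exists>a. ?Ow a b)" using inv by auto
  show "\<forall>b. ?pr b \<le> N" using inv bid by auto
  have le: "pr z \<le> ?pr z" for z by simp
  show "\<forall>a b z. ?Ow a b \<longrightarrow> z \<in> R \<longrightarrow> A a z \<longrightarrow> ?pr b \<le> ?pr z + 1"
  proof (intro allI impI)
    fix a b z
    assume Ow: "?Ow a b" and z: "z \<in> R" "A a z"
    from Ow show "?pr b \<le> ?pr z + 1"
    proof
      assume "Ow a b \<and> b \<noteq> v"
      then have "pr b \<le> pr z + 1" using inv z by blast
      then show ?thesis using \<open>Ow a b \<and> b \<noteq> v\<close> by auto
    next
      assume "a = u \<and> b = v"
      then have "pr v \<le> pr z" using bid z by blast
      then show ?thesis using \<open>a = u \<and> b = v\<close> by auto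
    qed
  qed
qed

lemma auction_optimal:
  fixes L R :: "'a set"
  assumes inv: "auction_inv A L R N pr Ow" and stop: "\<And>u v. \<not> can_bid A L R N pr Ow u v"
    and fin: "finite L" "finite R" "L \<inter> R = {}" and N: "card R < N"
  shows "\<exists>J. bip_indep A L R J \<and> card J = card (L \<union> {v\<in>R. pr v = 0})"
    and "bip_indep A L R J \<Longrightarrow> card J \<le> card (L \<union> {v\<in>R. pr v = 0})"
proof -
  note i = inv[unfolded auction_inv_def]
  define R0 where "R0 = {v\<in>R. pr v = 0}"
  have cardX: "card (L \<union> R0) = card L + card R0"
    using fin by (intro card_Un_disjoint) (auto simp: R0_def)
  have upper: "card J \<le> card (L \<union> R0)" if J: "bip_indep A L R J" for J
  proof -
    \<comment> \<open>Each member of \<open>J\<close> with a positive price is charged to its owner,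
      a left vertex outside \<open>J\<close>; only right vertices of price 0 come free.\<close>
    let ?Rp = "{v\<in>J \<inter> R. 0 < pr v}"
    have "\<forall>v\<in>?Rp. \<exists>u. Ow u v" using i by blast
    then obtain f where f: "\<forall>v\<in>?Rp. Ow (f v) v" by metis
    have "inj_on f ?Rp" using f i by (intro inj_onI) metis
    moreover have "f ` ?Rp \<subseteq> L - J"
    proof
      fix u assume "u \<in> f ` ?Rp"
      then obtain v where v: "v \<in> ?Rp" "u = f v" by blast
      then have "u \<in> L" "A u v" using f i by blast+
      then show "u \<in> L - J" using v J by (auto simp: bip_indep_def)
    qed
    ultimately have "card ?Rp \<le> card (L - J)"
      by (rule card_inj_on_le) (use fin in simp)
    moreover have "J \<subseteq> (J \<inter> L) \<union> (R0 \<union> ?Rp)"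
      using J by (auto simp: bip_indep_def R0_def)
    then have "card J \<le> card ((J \<inter> L) \<union> (R0 \<union> ?Rp))"
      using fin by (intro card_mono) (auto simp: R0_def)
    moreover have "card ((J \<inter> L) \<union> (R0 \<union> ?Rp)) \<le> card (J \<inter> L) + card (R0 \<union> ?Rp)"
      by (rule card_Un_le)
    moreover have "card (R0 \<union> ?Rp) \<le> card R0 + card ?Rp"
      by (rule card_Un_le)
    moreover have "card L = card (J \<inter> L) + card (L - J)"
      using card_Int_Diff[OF fin(1), of J] by (simp add: Int_commute)
    ultimately show ?thesis using cardX by simp
  qed
  then show "bip_indep A L R J \<Longrightarrow> card J \<le> card (L \<union> {v\<in>R. pr v = 0})"
    by (simp add: R0_def)
  \<comment> \<open>The \<open>N\<close> levels from 1 to \<open>N\<close> outnumber the right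
    vertices, so one of them is nobody's price.\<close>
  have "\<exists>l\<in>{1..N}. l \<notin> pr ` R"
  proof (rule ccontr)
    assume "\<not> ?thesis"
    then have "card {1..N} \<le> card (pr ` R)" using fin by (intro card_mono) auto
    also have "\<dots> \<le> card R" using fin by (intro card_image_le)
    finally show False using N by simp
  qed
  then obtain l where "l \<in> {1..N}" "l \<notin> pr ` R" by blast
  then have l: "1 \<le> l" "l \<le> N" "\<forall>v\<in>R. pr v \<noteq> l" by auto
  \<comment> \<open>Left vertices without a purchase satisfy the condition vacuously and are
    included. An owner that pays more than \<open>l\<close> sees no neighbour cheaper than
    \<open>l\<close>, since neighbours cost at least its price minus one.\<close>
  define Lh where "Lh = {u\<in>L. \<forall>v. Ow u v \<longrightarrow> l < pr v}"
  define Rl where "Rl = {v\<in>R. pr v < l}"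
  \<comment> \<open>Otherwise a cheapest neighbour would admit another bid.\<close>
  have full: "N \<le> pr v" if u: "u \<in> L" "\<forall>v. \<not> Ow u v" and v: "v \<in> R" "A u v" for u v
  proof (rule ccontr)
    assume "\<not> N \<le> pr v"
    define z where "z = arg_min_on pr {z\<in>R. A u z}"
    have ne: "{z\<in>R. A u z} \<noteq> {}" "finite {z\<in>R. A u z}" using v fin by auto
    have "z \<in> {z\<in>R. A u z}" unfolding z_def by (rule arg_min_if_finite(1)[OF ne(2,1)])
    moreover have min: "pr z \<le> pr y" if "y \<in> {z\<in>R. A u z}" for y
      unfolding z_def using arg_min_least[OF ne(2,1) that, where f = pr] by simp
    moreover have "pr z < N" using min[of v] v \<open>\<not> N \<le> pr v\<close> by simp
    ultimately have "can_bid A L R N pr Ow u z" using u by (auto simp: can_bid_def)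
    then show False using stop by blast
  qed
  have "bip_indep A L R (Lh \<union> Rl)"
    unfolding bip_indep_def
  proof (intro conjI ballI notI)
    show "Lh \<union> Rl \<subseteq> L \<union> R" by (auto simp: Lh_def Rl_def)
    fix u v assume "u \<in> (Lh \<union> Rl) \<inter> L" "v \<in> (Lh \<union> Rl) \<inter> R" "A u v"
    then have u: "u \<in> Lh" and v: "v \<in> Rl" using fin by (auto simp: Lh_def Rl_def)
    show False
    proof (cases "\<exists>v'. Ow u v'")
      case True
      then obtain v' where v': "Ow u v'" by blast
      then have "l < pr v'" using u by (simp add: Lh_def)
      moreover have "pr v' \<le> pr v + 1" using i v' v \<open>A u v\<close> by (auto simp: Rl_def)
      ultimately show False using v by (simp add: Rl_def)
    next
      case False
      then have "N \<le> pr v" using full[of u v] u v \<open>A u v\<close> by (auto simp: Lh_def Rl_def)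
      then show False using v l by (simp add: Rl_def)
    qed
  qed
  moreover have "card (Lh \<union> Rl) = card (L \<union> R0)"
  proof (rule antisym)
    show "card (Lh \<union> Rl) \<le> card (L \<union> R0)" using upper calculation by blast
    \<comment> \<open>The left vertices dropped from \<open>L\<close> own distinct vertices with
      prices above 0 and at most \<open>l\<close>. As \<open>l\<close> is not a price, these are
      cheaper than \<open>l\<close> and make up the loss.\<close>
    have "\<forall>u\<in>L - Lh. \<exists>v. Ow u v \<and> pr v \<le> l" by (auto simp: Lh_def not_less)
    then obtain g where g: "\<forall>u\<in>L - Lh. Ow u (g u) \<and> pr (g u) \<le> l" by metis
    have "inj_on g (L - Lh)" using g i by (intro inj_onI) metis
    moreover have "g ` (L - Lh) \<subseteq> Rl - R0"
    proof
      fix v assume "v \<in> g ` (L - Lh)"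
      then obtain u where u: "u \<in> L - Lh" "v = g u" by blast
      then have "Ow u v" "pr v \<le> l" using g by auto
      then have "v \<in> R" "0 < pr v" using i by blast+
      then show "v \<in> Rl - R0" using \<open>pr v \<le> l\<close> l(3) by (auto simp: Rl_def R0_def le_less)
    qed
    ultimately have "card (L - Lh) \<le> card (Rl - R0)"
      by (rule card_inj_on_le) (use fin in \<open>simp add: Rl_def\<close>)
    moreover have "L \<inter> Lh = Lh" by (auto simp: Lh_def)
    then have "card L = card Lh + card (L - Lh)"
      using card_Int_Diff[OF fin(1), of Lh] by simp
    moreover have "R0 \<subseteq> Rl" using l by (auto simp: R0_def Rl_def)
    then have "Rl \<inter> R0 = R0" by blast
    then have "card Rl = card R0 + card (Rl - R0)"
      using card_Int_Diff[of Rl R0] fin(2) by (simp add: Rl_def)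
    moreover have "card (Lh \<union> Rl) = card Lh + card Rl"
      using fin by (intro card_Un_disjoint) (auto simp: Lh_def Rl_def)
    ultimately show "card (L \<union> R0) \<le> card (Lh \<union> Rl)" using cardX by simp
  qed
  ultimately show "\<exists>J. bip_indep A L R J \<and> card J = card (L \<union> {v\<in>R. pr v = 0})"
    by (auto simp: R0_def)
qed

section \<open>Extending split partitions\<close>

text \<open>Two split partitions of a graph differ by exchanging at most one vertex on either side.\<close>

lemma split_on_extend:
  assumes kk: "split_on A t kk" "\<And>y. kk y \<Longrightarrow> y < t" and Q: "split_on A (Suc t) Q" and "t < n"
  obtains a b c where "a \<le> n" "b \<le> n" "c \<le> n"
    "split_on A (Suc t) (\<lambda>y. (kk y \<or> y = b \<or> y = c) \<and> y \<noteq> a)"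
    "\<And>y. (kk y \<or> y = b \<or> y = c) \<and> y \<noteq> a \<Longrightarrow> y \<le> t"
proof -
  \<comment> \<open>Two such vertices would be adjacent as members of \<open>kk\<close> and
    nonadjacent as vertices outside \<open>Q\<close>.\<close>
  have uniq1: "y = z" if "y < t" "z < t" "kk y" "kk z" "\<not> Q y" "\<not> Q z" for y z
    using kk(1) Q that unfolding split_on_def by (metis less_SucI)
  have uniq2: "y = z" if "y < t" "z < t" "\<not> kk y" "\<not> kk z" "Q y" "Q z" for y z
    using kk(1) Q that unfolding split_on_def by (metis less_SucI)
  \<comment> \<open>\<open>n\<close> is the dummy for having nothing to remove; it exceeds
    \<open>t\<close>, so the last condition is then vacuous.\<close>
  obtain a where a: "a \<le> n" "\<And>y. y < t \<Longrightarrow> kk y \<Longrightarrow> \<not> Q y \<Longrightarrow> y = a" "a \<le> t \<Longrightarrow> \<not> Q a"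
  proof (cases "\<exists>y<t. kk y \<and> \<not> Q y")
    case True
    then obtain y where "y < t" "kk y" "\<not> Q y" by blast
    show thesis
    proof (rule that[of y])
      show "y \<le> n" using \<open>y < t\<close> \<open>t < n\<close> by simp
      show "z = y" if "z < t" "kk z" "\<not> Q z" for z
        using uniq1[of z y] that \<open>y < t\<close> \<open>kk y\<close> \<open>\<not> Q y\<close> by blast
    qed (simp add: \<open>\<not> Q y\<close>)
  next
    case False
    show thesis
      by (rule that[of n]) (use False \<open>t < n\<close> in auto)
  qed
  \<comment> \<open>\<open>a\<close> itself is the dummy for having nothing to add, because the
    exchange excludes \<open>a\<close> in the end.\<close>
  obtain b where b: "b \<le> n" "\<And>y. y < t \<Longrightarrow> \<not> kk y \<Longrightarrow> Q y \<Longrightarrow> y = b" "b = a \<or> (b \<le> t \<and> Q b)"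
  proof (cases "\<exists>y<t. \<not> kk y \<and> Q y")
    case True
    then obtain y where "y < t" "\<not> kk y" "Q y" by blast
    show thesis
    proof (rule that[of y])
      show "y \<le> n" using \<open>y < t\<close> \<open>t < n\<close> by simp
      show "z = y" if "z < t" "\<not> kk z" "Q z" for z
        using uniq2[of z y] that \<open>y < t\<close> \<open>\<not> kk y\<close> \<open>Q y\<close> by blast
      show "y = a \<or> (y \<le> t \<and> Q y)"
        using \<open>y < t\<close> \<open>Q y\<close> by simp
    qed
  next
    case False
    show thesis
      by (rule that[of a]) (use False a(1) in auto)
  qed
  obtain c where c: "c \<le> n" "Q t \<Longrightarrow> c = t" "c = a \<or> (c \<le> t \<and> Q c)"
  proof (cases "Q t")
    case True
    show thesis
      by (rule that[of t]) (use True \<open>t < n\<close> in auto)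
  next
    case False
    show thesis
      by (rule that[of a]) (use False a(1) in auto)
  qed
  have eq: "(kk y \<or> y = b \<or> y = c) \<and> y \<noteq> a \<longleftrightarrow> Q y" if "y < Suc t" for y
  proof (cases "y = t")
    case True
    then show ?thesis using a b c kk(2)[of t] by auto
  next
    case False
    then have "y < t" using that by simp
    then show ?thesis using a b c by (metis less_imp_le)
  qed
  have le: "(kk y \<or> y = b \<or> y = c) \<and> y \<noteq> a \<Longrightarrow> y \<le> t" for y
    using b c kk(2) by (metis less_imp_le)
  have "split_on A (Suc t) (\<lambda>y. (kk y \<or> y = b \<or> y = c) \<and> y \<noteq> a)"
    unfolding split_on_def
  proof (intro allI impI)
    fix y z
    assume yz: "y < Suc t" "z < Suc t" "y \<noteq> z"
    show "(((kk y \<or> y = b \<or> y = c) \<and> y \<noteq> a) \<and> ((kk z \<or> z = b \<or> z = c) \<and> z \<noteq> a) \<longrightarrow> A y z) \<and>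
      (\<not> ((kk y \<or> y = b \<or> y = c) \<and> y \<noteq> a) \<and> \<not> ((kk z \<or> z = b \<or> z = c) \<and> z \<noteq> a) \<longrightarrow> \<not> A y z)"
      unfolding eq[OF yz(1)] eq[OF yz(2)] using Q yz unfolding split_on_def by blast
  qed
  then show thesis using that[OF a(1) b(1) c(1)] le by blast
qed

section \<open>Derived formulas and rules for relational programs\<close>

definition Disj :: "('r, 'v) fm \<Rightarrow> ('r, 'v) fm \<Rightarrow> ('r, 'v) fm" where
  "Disj \<phi> \<psi> = Neg (Conj (Neg \<phi>) (Neg \<psi>))"

definition Imp :: "('r, 'v) fm \<Rightarrow> ('r, 'v) fm \<Rightarrow> ('r, 'v) fm" where
  "Imp \<phi> \<psi> = Neg (Conj \<phi> (Neg \<psi>))"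

definition Forall :: "'v \<Rightarrow> ('r, 'v) fm \<Rightarrow> ('r, 'v) fm" where
  "Forall x \<phi> = Neg (Ex x (Neg \<phi>))"

definition Eq :: "'v \<Rightarrow> 'v \<Rightarrow> ('r, 'v) fm" where
  "Eq x y = Conj (Neg (Less x y)) (Neg (Less y x))"

text \<open>The first argument is a spare variable for the inner quantifier, supplied by the caller
  because binders must be fresh. The same convention holds for \<open>Last\<close> and
  \<open>Succ\<close>.\<close>

definition Zero :: "'v \<Rightarrow> 'v \<Rightarrow> ('r, 'v) fm" where
  "Zero z x = Neg (Ex z (Less z x))"

definition Last :: "'v \<Rightarrow> 'v \<Rightarrow> ('r, 'v) fm" where
  "Last z x = Neg (Ex z (Less x z))"

definition Succ :: "'v \<Rightarrow> 'v \<Rightarrow> 'v \<Rightarrow> ('r, 'v) fm" where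
  "Succ z x y = Conj (Less x y) (Neg (Ex z (Conj (Less x z) (Less z y))))"

lemma holds_derived [simp]:
  "holds N m env (Disj \<phi> \<psi>) \<longleftrightarrow> holds N m env \<phi> \<or> holds N m env \<psi>"
  "holds N m env (Imp \<phi> \<psi>) \<longleftrightarrow> (holds N m env \<phi> \<longrightarrow> holds N m env \<psi>)"
  "holds N m env (Forall x \<phi>) \<longleftrightarrow> (\<forall>i<N. holds N m (env(x := i)) \<phi>)"
  "holds N m env (Eq x y) \<longleftrightarrow> env x = env y"
  by (auto simp: Disj_def Imp_def Forall_def Eq_def)

lemma holds_Zero [simp]: "z \<noteq> x \<Longrightarrow> env x < N \<Longrightarrow> holds N m env (Zero z x) \<longleftrightarrow> env x = 0"
  by (auto simp: Zero_def)

lemma holds_Last [simp]: "z \<noteq> x \<Longrightarrow> env x < N \<Longrightarrow> holds N m env (Last z x) \<longleftrightarrow> Suc (env x) = N"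
  by (auto simp: Last_def) (meson Suc_lessI lessI)

lemma holds_Succ [simp]:
  "z \<noteq> x \<Longrightarrow> z \<noteq> y \<Longrightarrow> env y < N \<Longrightarrow> holds N m env (Succ z x y) \<longleftrightarrow> env y = Suc (env x)"
  by (auto simp: Succ_def intro!: Suc_lessI dest: Suc_lessI)

lemma wf_derived [simp]:
  "wf_fm ar V (Disj \<phi> \<psi>) \<longleftrightarrow> wf_fm ar V \<phi> \<and> wf_fm ar V \<psi>"
  "wf_fm ar V (Imp \<phi> \<psi>) \<longleftrightarrow> wf_fm ar V \<phi> \<and> wf_fm ar V \<psi>"
  "wf_fm ar V (Forall x \<phi>) \<longleftrightarrow> x \<notin> V \<and> wf_fm ar (insert x V) \<phi>"
  "wf_fm ar V (Eq x y) \<longleftrightarrow> x \<in> V \<and> y \<in> V \<and> x \<noteq> y"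
  "wf_fm ar V (Zero z x) \<longleftrightarrow> z \<notin> V \<and> x \<in> V"
  "wf_fm ar V (Last z x) \<longleftrightarrow> z \<notin> V \<and> x \<in> V"
  "wf_fm ar V (Succ z x y) \<longleftrightarrow> z \<notin> V \<and> x \<in> V \<and> y \<in> V \<and> x \<noteq> y"
  by (auto simp: Disj_def Imp_def Forall_def Eq_def Zero_def Last_def Succ_def)

primrec modified :: "('r, 'v) cmd \<Rightarrow> 'r set" where
  "modified (Upd r xs \<phi>) = {r}"
| "modified (c then\<^sub>c c') = modified c \<union> modified c'"
| "modified (For x c) = modified c"

lemma sem_frame: "r \<notin> modified c \<Longrightarrow> sem N c env m r = m r"
proof (induction c arbitrary: env m)
  case (For x c)
  have "fold (\<lambda>i. sem N c (env(x := i))) is m r = m r" for "is"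
    using For by (induction "is" arbitrary: m) auto
  then show ?case by simp
qed auto

lemma sem_For_induct:
  assumes "P 0 m" "\<And>i m. i < N \<Longrightarrow> P i m \<Longrightarrow> P (Suc i) (sem N c (env(x := i)) m)"
  shows "P N (sem N (For x c) env m)"
proof -
  have "P k (fold (\<lambda>i. sem N c (env(x := i))) [0..<k] m)" if "k \<le> N" for k
    using that by (induction k) (use assms in auto)
  then show ?thesis by simp
qed

lemma tuples_simps [simp]:
  "[a] \<in> tuples N (Suc 0) \<longleftrightarrow> a < N"
  "[a, b] \<in> tuples N (Suc (Suc 0)) \<longleftrightarrow> a < N \<and> b < N"
  "[a, b, c] \<in> tuples N (Suc (Suc (Suc 0))) \<longleftrightarrow> a < N \<and> b < N \<and> c < N"
  by (auto simp: tuples_def)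

section \<open>The program\<close>

text \<open>
  \<open>W\<close> is the input, \<open>NN\<close> the singleton of the number of vertices, \<open>KK\<close> the clique of the split
  partition and \<open>K2\<close> its next approximation.  For the current index, \<open>LS\<close> and \<open>RS\<close> are the sides of
  the bipartite graph, \<open>OW\<close>, \<open>PR\<close> and \<open>BID\<close> hold the owners, the prices and the current bid of the
  auction, \<open>XS\<close> is a set of the size sought and \<open>CNT\<close> counts its initial segments.
\<close>

datatype rel = W | NN | PLUS | ROW | ADJ | VAL | KK | K2 | LS | RS | PR | OW | BID | XS | CNT | RES

datatype var = V0 | V1 | V2 | V3 | V4 | V5 | V6 | V7 | V8 | V9

instance rel :: finite
proof
  have "x \<in> {W, NN, PLUS, ROW, ADJ, VAL, KK, K2, LS, RS, PR, OW, BID, XS, CNT, RES}" for x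
    by (cases x) simp_all
  then have "(UNIV :: rel set) \<subseteq> {W, NN, PLUS, ROW, ADJ, VAL, KK, K2, LS, RS, PR, OW, BID, XS, CNT, RES}"
    by blast
  then show "finite (UNIV :: rel set)"
    by (rule finite_subset) simp
qed

instance var :: finite
proof
  have "x \<in> {V0, V1, V2, V3, V4, V5, V6, V7, V8, V9}" for x
    by (cases x) simp_all
  then have "(UNIV :: var set) \<subseteq> {V0, V1, V2, V3, V4, V5, V6, V7, V8, V9}"
    by blast
  then show "finite (UNIV :: var set)"
    by (rule finite_subset) simp
qed

primrec arity :: "rel \<Rightarrow> nat" where
  "arity W = 1" | "arity NN = 1" | "arity PLUS = 3" | "arity ROW = 2" | "arity ADJ = 2"
| "arity VAL = 2" | "arity KK = 1" | "arity K2 = 1" | "arity LS = 1" | "arity RS = 1"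
| "arity PR = 2" | "arity OW = 2" | "arity BID = 2" | "arity XS = 1" | "arity CNT = 2" | "arity RES = 1"

type_synonym program = "(rel, var) cmd"
type_synonym formula = "(rel, var) fm"

section \<open>Parsing the input word\<close>

definition find_size :: program where
  "find_size = Upd NN [V0] (Conj (Neg (Rel W [V0])) (Forall V1 (Imp (Less V1 V0) (Rel W [V1]))))"

text \<open>Recursion on the first summand, with one update of the whole relation per round of the
  loop: the round with index \<open>t\<close> settles the first summands up to \<open>t\<close>.
  Sums outside the universe have no entry.\<close>

definition compute_plus :: program where
  "compute_plus = For V9 (Upd PLUS [V0, V1, V2]
     (Disj (Conj (Zero V3 V0) (Eq V1 V2))
       (Ex V3 (Ex V4 (Conj (Succ V5 V3 V0) (Conj (Succ V5 V4 V2) (Rel PLUS [V3, V1, V4])))))))"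

text \<open>\<open>ROW i p\<close> says that row \<open>i\<close> of the adjacency matrix starts at position \<open>p\<close> of the input.\<close>

definition find_rows :: program where
  "find_rows = For V9 (Upd ROW [V0, V1]
     (Disj (Conj (Zero V3 V0) (Ex V3 (Conj (Rel NN [V3]) (Succ V5 V3 V1))))
       (Ex V2 (Ex V3 (Ex V4 (Conj (Succ V5 V2 V0) (Conj (Rel NN [V4])
         (Conj (Rel PLUS [V3, V4, V1]) (Rel ROW [V2, V3])))))))))"

definition read_matrix :: program where
  "read_matrix = Upd ADJ [V0, V1] (Ex V2 (Ex V3 (Ex V4 (Conj (Rel NN [V2])
     (Conj (Less V0 V2) (Conj (Less V1 V2) (Conj (Rel ROW [V0, V3])
     (Conj (Rel PLUS [V3, V1, V4]) (Rel W [V4])))))))))"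

text \<open>\<open>VAL p v\<close> says that the input from position \<open>p\<close> on is a binary representation of \<open>v\<close>.\<close>

definition read_values :: program where
  "read_values = For V9 (Upd VAL [V0, V1] (Ex V3 (Ex V4
     (Conj (Disj (Conj (Last V5 V0) (Zero V5 V3)) (Ex V2 (Conj (Succ V5 V0 V2) (Rel VAL [V2, V3]))))
     (Conj (Rel PLUS [V3, V3, V4])
       (Disj (Conj (Rel W [V0]) (Succ V5 V4 V1)) (Conj (Neg (Rel W [V0])) (Eq V4 V1))))))))"

lemma size_correct:
  assumes "x < N"
  shows "sem N find_size env m NN [x] \<longleftrightarrow> \<not> m W [x] \<and> (\<forall>y<x. m W [y])"
  using assms by (auto simp: find_size_def)

lemma plus_correct:
  assumes "a < N" "b < N" "c < N"
  shows "sem N compute_plus env m PLUS [a, b, c] \<longleftrightarrow> a + b = c"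
proof -
  have "\<forall>a<N. \<forall>b<N. \<forall>c<N. a < N \<longrightarrow> (sem N compute_plus env m PLUS [a, b, c] \<longleftrightarrow> a + b = c)"
    unfolding compute_plus_def
  proof (rule sem_For_induct[where P = "\<lambda>t m. \<forall>a<N. \<forall>b<N. \<forall>c<N. a < t \<longrightarrow> (m PLUS [a, b, c] \<longleftrightarrow> a + b = c)"],
      goal_cases)
    case (2 t m)
    show ?case
    proof (intro allI impI)
      fix a b c assume "a < N" "b < N" "c < N" "a < Suc t"
      with 2 show "sem N (Upd PLUS [V0, V1, V2]
         (Disj (Conj (Zero V3 V0) (Eq V1 V2))
         (Ex V3 (Ex V4 (Conj (Succ V5 V3 V0) (Conj (Succ V5 V4 V2) (Rel PLUS [V3, V1, V4])))))))
         (env(V9 := t)) m PLUS [a, b, c] \<longleftrightarrow> a + b = c"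
        by (cases a; cases c) (auto cong: conj_cong)
    qed
  qed simp
  then show ?thesis using assms by blast
qed

lemma rows_correct:
  assumes n: "n < N" "\<And>x. x < N \<Longrightarrow> m NN [x] \<longleftrightarrow> x = n"
    and plus: "\<And>a b c. a < N \<Longrightarrow> b < N \<Longrightarrow> c < N \<Longrightarrow> m PLUS [a, b, c] \<longleftrightarrow> a + b = c"
    and ip: "i < N" "p < N"
  shows "sem N find_rows env m ROW [i, p] \<longleftrightarrow> p = Suc n + i * n"
proof -
  let ?I = "\<lambda>t m'. (\<forall>r. r \<noteq> ROW \<longrightarrow> m' r = m r) \<and>
    (\<forall>i<N. \<forall>p<N. i < t \<longrightarrow> (m' ROW [i, p] \<longleftrightarrow> p = Suc n + i * n))"
  have "?I N (sem N find_rows env m)"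
    unfolding find_rows_def
  proof (rule sem_For_induct[where P = ?I], goal_cases)
    case (2 t m')
    show ?case
    proof (intro conjI allI impI, goal_cases)
      case (2 i p)
      with \<open>?I t m'\<close> n plus show ?case
        by (cases i) (auto cong: conj_cong)
    qed (use 2 in simp)
  qed simp
  then show ?thesis using ip by blast
qed

lemma matrix_correct:
  assumes n: "n < N" "\<And>x. x < N \<Longrightarrow> m NN [x] \<longleftrightarrow> x = n"
    and plus: "\<And>a b c. a < N \<Longrightarrow> b < N \<Longrightarrow> c < N \<Longrightarrow> m PLUS [a, b, c] \<longleftrightarrow> a + b = c"
    and rows: "\<And>i p. i < N \<Longrightarrow> p < N \<Longrightarrow> m ROW [i, p] \<longleftrightarrow> p = Suc n + i * n"
    and ij: "i < N" "j < N"
  shows "sem N read_matrix env m ADJ [i, j] \<longleftrightarrow>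
    i < n \<and> j < n \<and> Suc n + i * n + j < N \<and> m W [Suc n + i * n + j]"
proof -
  have "sem N read_matrix env m ADJ [i, j] \<longleftrightarrow>
      (\<exists>p<N. \<exists>q<N. i < n \<and> j < n \<and> p = Suc n + i * n \<and> p + j = q \<and> m W [q])"
    using assms by (auto simp: read_matrix_def cong: conj_cong)
  then show ?thesis by auto
qed

primrec bits_value :: "bool list \<Rightarrow> nat" where
  "bits_value [] = 0"
| "bits_value (b # bs) = of_bool b + 2 * bits_value bs"

text \<open>The recursion runs backwards from the end of the word: after \<open>t\<close> rounds the
  last \<open>t\<close> positions are correct. Since \<open>v < N\<close>, the smaller values on
  which \<open>v\<close> depends lie in the universe as well.\<close>

lemma values_correct:
  assumes N: "N = length w" and W: "\<And>p. p < N \<Longrightarrow> m W [p] \<longleftrightarrow> w ! p"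
    and plus: "\<And>a b c. a < N \<Longrightarrow> b < N \<Longrightarrow> c < N \<Longrightarrow> m PLUS [a, b, c] \<longleftrightarrow> a + b = c"
    and pv: "p < N" "v < N"
  shows "sem N read_values env m VAL [p, v] \<longleftrightarrow> v = bits_value (drop p w)"
proof -
  let ?I = "\<lambda>t m'. (\<forall>r. r \<noteq> VAL \<longrightarrow> m' r = m r) \<and>
    (\<forall>p<N. \<forall>v<N. N \<le> p + t \<longrightarrow> (m' VAL [p, v] \<longleftrightarrow> v = bits_value (drop p w)))"
  have "?I N (sem N read_values env m)"
    unfolding read_values_def
  proof (rule sem_For_induct[where P = ?I], goal_cases)
    case (2 t m')
    show ?case
    proof (intro conjI allI impI, goal_cases)
      case (2 p v)
      let ?U = "bits_value (drop (Suc p) w)"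
      have p: "bits_value (drop p w) = of_bool (w ! p) + 2 * ?U"
        using 2 N by (simp add: Cons_nth_drop_Suc[symmetric])
      have U: "(Suc p = N \<and> u = 0) \<or> (\<exists>p'<N. p' = Suc p \<and> m' VAL [p', u]) \<longleftrightarrow> u = ?U" if "u < N" for u
      proof (cases "Suc p = N")
        case True
        then show ?thesis using N by auto
      next
        case False
        then have "Suc p < N" using 2 by simp
        then show ?thesis using \<open>?I t m'\<close> that 2 by auto
      qed
      have "(\<exists>u<N. \<exists>d<N. ((Suc p = N \<and> u = 0) \<or> (\<exists>p'<N. p' = Suc p \<and> m' VAL [p', u])) \<and>
          u + u = d \<and> (w ! p \<and> v = Suc d \<or> \<not> w ! p \<and> d = v)) \<longleftrightarrow> v = bits_value (drop p w)"
        (is "?L \<longleftrightarrow> _")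
      proof -
        have "?L \<longleftrightarrow> (\<exists>u<N. u = ?U \<and> u + u < N \<and> (w ! p \<and> v = Suc (u + u) \<or> \<not> w ! p \<and> u + u = v))"
          using U by blast
        also have "\<dots> \<longleftrightarrow> v = bits_value (drop p w)"
          unfolding p using \<open>v < N\<close> by (cases "w ! p") auto
        finally show ?thesis .
      qed
      then show ?case
        using 2 \<open>?I t m'\<close> plus W by (simp cong: conj_cong)
    qed (use 2 in simp)
  qed simp
  then show ?thesis using pv by simp
qed

section \<open>Search for a split partition\<close>

definition candidate :: "var \<Rightarrow> formula" where
  "candidate x = Conj (Disj (Rel KK [x]) (Disj (Eq x V7) (Eq x V8))) (Neg (Eq x V6))"

definition candidate_good :: formula where
  "candidate_good = Forall V1 (Forall V2 (Conj (Imp (candidate V1) (Neg (Less V9 V1)))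
     (Imp (Conj (Neg (Less V9 V1)) (Conj (Neg (Less V9 V2)) (Neg (Eq V1 V2))))
       (Conj (Imp (Conj (candidate V1) (candidate V2)) (Rel ADJ [V1, V2]))
         (Imp (Conj (Neg (candidate V1)) (Neg (candidate V2))) (Neg (Rel ADJ [V1, V2])))))))"

text \<open>A good candidate replaces \<open>K2\<close>, a bad one leaves it alone. Candidates are
  formed from \<open>KK\<close>, which stays fixed during the search, so later attempts cannot spoil
  a find.\<close>

definition try_candidate :: program where
  "try_candidate = Upd K2 [V0]
     (Disj (Conj candidate_good (candidate V0)) (Conj (Neg candidate_good) (Rel K2 [V0])))"

definition is_vertex :: "var \<Rightarrow> var \<Rightarrow> formula" where
  "is_vertex y x = Ex y (Conj (Rel NN [y]) (Less x y))"

text \<open>The index \<open>V9\<close> runs over the whole universe; beyond the last vertex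
  \<open>KK\<close> is kept.\<close>

definition extend_partition :: program where
  "extend_partition = (For V6 (For V7 (For V8 try_candidate)) then\<^sub>c
     Upd KK [V0] (Disj (Conj (is_vertex V1 V9) (Rel K2 [V0])) (Conj (Neg (is_vertex V1 V9)) (Rel KK [V0]))))"

definition find_partition :: program where
  "find_partition = For V9 extend_partition"

text \<open>The second condition keeps later vertices out of \<open>kk\<close>, so that the next
  vertex enters only by an explicit exchange.\<close>

definition split_upto :: "nat \<Rightarrow> (nat \<Rightarrow> nat \<Rightarrow> bool) \<Rightarrow> nat \<Rightarrow> (nat \<Rightarrow> bool) \<Rightarrow> bool" where
  "split_upto N A t kk \<longleftrightarrow> split_on A t kk \<and> (\<forall>y<N. kk y \<longrightarrow> y < t)"

lemma split_upto_cong: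
  assumes "t \<le> N" "\<And>y. y < N \<Longrightarrow> kk y \<longleftrightarrow> kk' y"
  shows "split_upto N A t kk \<longleftrightarrow> split_upto N A t kk'"
proof -
  have eq: "kk y \<longleftrightarrow> kk' y" if "y < t" for y
    using assms that by simp
  have "split_on A t kk \<longleftrightarrow> split_on A t kk'"
    unfolding split_on_def by (simp add: eq)
  then show ?thesis
    using assms(2) by (auto simp: split_upto_def)
qed

definition exchange :: "(nat \<Rightarrow> bool) \<Rightarrow> nat \<Rightarrow> nat \<Rightarrow> nat \<Rightarrow> nat \<Rightarrow> bool" where
  "exchange kk a b c y \<longleftrightarrow> (kk y \<or> y = b \<or> y = c) \<and> y \<noteq> a"

lemma holds_candidate_good:
  assumes "env V9 < N"
  shows "holds N m env candidate_good \<longleftrightarrow> split_upto N (\<lambda>u v. m ADJ [u, v]) (Suc (env V9))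
    (exchange (\<lambda>y. m KK [y]) (env V6) (env V7) (env V8))"
proof -
  define e where "e = exchange (\<lambda>y. m KK [y]) (env V6) (env V7) (env V8)"
  have "holds N m env candidate_good \<longleftrightarrow> (\<forall>y<N. \<forall>z<N. (e y \<longrightarrow> \<not> env V9 < y) \<and>
      (\<not> env V9 < y \<and> \<not> env V9 < z \<and> y \<noteq> z \<longrightarrow> (e y \<and> e z \<longrightarrow> m ADJ [y, z]) \<and>
        (\<not> e y \<and> \<not> e z \<longrightarrow> \<not> m ADJ [y, z])))"
    by (simp add: candidate_good_def candidate_def e_def exchange_def)
  also have "\<dots> \<longleftrightarrow> split_upto N (\<lambda>u v. m ADJ [u, v]) (Suc (env V9)) e"
    unfolding split_upto_def split_on_def using assms
    by (meson less_Suc_eq_le not_less order_le_less_trans)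
  finally show ?thesis by (simp add: e_def)
qed

abbreviation edge :: "rel memory \<Rightarrow> nat \<Rightarrow> nat \<Rightarrow> bool" where
  "edge m u v \<equiv> m ADJ [u, v]"

lemma holds_candidate: "x \<notin> {V6, V7, V8} \<Longrightarrow>
    holds N m env (candidate x) \<longleftrightarrow> exchange (\<lambda>y. m KK [y]) (env V6) (env V7) (env V8) (env x)"
  by (auto simp: candidate_def exchange_def)

lemma holds_is_vertex:
  assumes "y \<noteq> x" "n < N" "\<And>x. x < N \<Longrightarrow> m NN [x] \<longleftrightarrow> x = n"
  shows "holds N m env (is_vertex y x) \<longleftrightarrow> env x < n"
  using assms by (auto simp: is_vertex_def)

text \<open>The program never sees \<open>Q\<close>: \<open>split_on_extend\<close> turns its
  existence into a single exchange, and the search runs through all exchanges.\<close>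

lemma extend_partition_correct:
  assumes n: "n < N" "\<And>x. x < N \<Longrightarrow> m NN [x] \<longleftrightarrow> x = n" and t: "t < n" "env V9 = t"
    and kk: "split_upto N (edge m) t (\<lambda>y. m KK [y])" and Q: "split_on (edge m) (Suc t) Q"
  shows "split_upto N (edge m) (Suc t) (\<lambda>y. sem N extend_partition env m KK [y])"
proof -
  \<comment> \<open>Nothing is known about \<open>KK\<close> outside the universe, so that part is
    cut off before \<open>split_on_extend\<close> is applied.\<close>
  let ?kk = "\<lambda>y. y < N \<and> m KK [y]"
  let ?G = "\<lambda>a b c. split_upto N (edge m) (Suc t) (exchange (\<lambda>y. m KK [y]) a b c)"
  \<comment> \<open>\<open>E\<close> records whether a good candidate has been tried; only then is
    \<open>K2\<close> claimed to be correct.\<close>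
  define J where "J E m' \<longleftrightarrow> (\<forall>r. r \<noteq> K2 \<longrightarrow> m' r = m r) \<and>
    (E \<longrightarrow> split_upto N (edge m) (Suc t) (\<lambda>y. m' K2 [y]))" for E and m' :: "rel memory"
  have J_mono: "J E m' \<Longrightarrow> (E' \<Longrightarrow> E) \<Longrightarrow> J E' m'" for E E' m'
    by (auto simp: J_def)
  have attempt: "J (E \<or> ?G (e V6) (e V7) (e V8)) (sem N try_candidate e m')"
    if "J E m'" "e V9 = t" for E e m'
  proof -
    have m': "m' KK = m KK" "m' ADJ = m ADJ" using that(1) by (auto simp: J_def)
    have K2: "sem N try_candidate e m' K2 [y] \<longleftrightarrow>
        (if ?G (e V6) (e V7) (e V8) then exchange (\<lambda>y. m KK [y]) (e V6) (e V7) (e V8) y else m' K2 [y])"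
      if "y < N" for y
      using that n(1) t(1) \<open>e V9 = t\<close> m'
      by (simp add: try_candidate_def holds_candidate_good holds_candidate)
    have "split_upto N (edge m) (Suc t) (\<lambda>y. sem N try_candidate e m' K2 [y])"
      if "E \<or> ?G (e V6) (e V7) (e V8)"
    proof -
      have "split_upto N (edge m) (Suc t) (\<lambda>y. if ?G (e V6) (e V7) (e V8)
          then exchange (\<lambda>y. m KK [y]) (e V6) (e V7) (e V8) y else m' K2 [y])"
        using that \<open>J E m'\<close> by (cases "?G (e V6) (e V7) (e V8)") (simp_all add: J_def)
      then show ?thesis
        using K2 n(1) t(1) by (subst split_upto_cong) auto
    qed
    moreover have "sem N try_candidate e m' r = m r" if "r \<noteq> K2" for r
      using that \<open>J E m'\<close> by (simp add: try_candidate_def J_def)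
    ultimately show ?thesis by (auto simp: J_def)
  qed
  have loop1: "J (E \<or> (\<exists>c<N. ?G (e V6) (e V7) c)) (sem N (For V8 try_candidate) e m')"
    if "J E m'" "e V9 = t" for E e m'
  proof (rule sem_For_induct[where P = "\<lambda>i m'. J (E \<or> (\<exists>c<i. ?G (e V6) (e V7) c)) m'"])
    fix i m'
    assume "J (E \<or> (\<exists>c<i. ?G (e V6) (e V7) c)) m'"
    then show "J (E \<or> (\<exists>c<Suc i. ?G (e V6) (e V7) c)) (sem N try_candidate (e(V8 := i)) m')"
      using that(2) by (elim J_mono[OF attempt]) (auto simp: less_Suc_eq)
  qed (use that in simp)
  have loop2: "J (E \<or> (\<exists>b<N. \<exists>c<N. ?G (e V6) b c)) (sem N (For V7 (For V8 try_candidate)) e m')"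
    if "J E m'" "e V9 = t" for E e m'
  proof (rule sem_For_induct[where P = "\<lambda>i m'. J (E \<or> (\<exists>b<i. \<exists>c<N. ?G (e V6) b c)) m'"])
    fix i m'
    assume "J (E \<or> (\<exists>b<i. \<exists>c<N. ?G (e V6) b c)) m'"
    then show "J (E \<or> (\<exists>b<Suc i. \<exists>c<N. ?G (e V6) b c)) (sem N (For V8 try_candidate) (e(V7 := i)) m')"
      using that(2) by (elim J_mono[OF loop1]) (auto simp: less_Suc_eq)
  qed (use that in simp)
  have loop3: "J (\<exists>a<N. \<exists>b<N. \<exists>c<N. ?G a b c) (sem N (For V6 (For V7 (For V8 try_candidate))) env m)"
  proof (rule sem_For_induct[where P = "\<lambda>i m'. J (\<exists>a<i. \<exists>b<N. \<exists>c<N. ?G a b c) m'"])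
    fix i m'
    assume "J (\<exists>a<i. \<exists>b<N. \<exists>c<N. ?G a b c) m'"
    then show "J (\<exists>a<Suc i. \<exists>b<N. \<exists>c<N. ?G a b c) (sem N (For V7 (For V8 try_candidate)) (env(V6 := i)) m')"
      using t(2) by (elim J_mono[OF loop2]) (auto simp: less_Suc_eq)
  qed (simp add: J_def)
  have "split_upto N (edge m) t ?kk"
    using kk by (subst split_upto_cong[where kk' = "\<lambda>y. m KK [y]"]) (use n t in auto)
  then have kk': "split_on (edge m) t ?kk" "\<And>y. ?kk y \<Longrightarrow> y < t"
    by (auto simp: split_upto_def)
  obtain a b c where abc: "a \<le> n" "b \<le> n" "c \<le> n"
    "split_on (edge m) (Suc t) (\<lambda>y. (?kk y \<or> y = b \<or> y = c) \<and> y \<noteq> a)"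
    "\<And>y. (?kk y \<or> y = b \<or> y = c) \<and> y \<noteq> a \<Longrightarrow> y \<le> t"
    by (rule split_on_extend[of "edge m" t ?kk Q n, OF kk' Q t(1)]) blast+
  then have "split_upto N (edge m) (Suc t) (\<lambda>y. (?kk y \<or> y = b \<or> y = c) \<and> y \<noteq> a)"
    unfolding split_upto_def by (intro conjI allI impI le_imp_less_Suc abc(4)) (rule abc(5))
  then have "?G a b c"
    by (subst split_upto_cong[where kk' = "\<lambda>y. (?kk y \<or> y = b \<or> y = c) \<and> y \<noteq> a"])
      (use n t in \<open>auto simp: exchange_def\<close>)
  \<comment> \<open>The dummy value \<open>n\<close> is itself below \<open>N\<close>, so the loops
    over the universe reach it.\<close>
  then have ex: "\<exists>a<N. \<exists>b<N. \<exists>c<N. ?G a b c"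
    using abc(1-3) n(1) by (meson order_le_less_trans)
  let ?m = "sem N (For V6 (For V7 (For V8 try_candidate))) env m"
  have m: "?m NN = m NN" "split_upto N (edge m) (Suc t) (\<lambda>y. ?m K2 [y])"
    using loop3 ex by (auto simp: J_def)
  have "sem N extend_partition env m KK [y] = ?m K2 [y]" if "y < N" for y
    unfolding extend_partition_def
    using that n t m(1) by (simp add: holds_is_vertex[of _ _ n] del: sem.simps(3))
  then show ?thesis
    using m(2) by (subst split_upto_cong[where kk' = "\<lambda>y. ?m K2 [y]"]) (use n t in auto)
qed

lemma extend_partition_skip:
  assumes n: "n < N" "\<And>x. x < N \<Longrightarrow> m NN [x] \<longleftrightarrow> x = n" and t: "n \<le> env V9" and y: "y < N"
  shows "sem N extend_partition env m KK [y] = m KK [y]"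
proof -
  let ?c = "For V6 (For V7 (For V8 try_candidate))"
  have "sem N ?c env m NN = m NN" "sem N ?c env m KK = m KK"
    by (intro sem_frame; simp add: try_candidate_def)+
  then show ?thesis
    using assms by (simp add: extend_partition_def holds_is_vertex[of _ _ n] del: sem.simps(3))
qed

text \<open>A partition of the whole graph restricts to every initial segment, which makes each
  extension succeed. On a graph that is not split nothing is claimed about \<open>KK\<close>, and
  \<open>validate\<close> will reject.\<close>

lemma partition_correct:
  assumes n: "n < N" "\<And>x. x < N \<Longrightarrow> m NN [x] \<longleftrightarrow> x = n" and kk: "\<And>y. y < N \<Longrightarrow> \<not> m KK [y]"
    and Q: "split_on (edge m) n Q"
  shows "split_on (edge m) n (\<lambda>y. sem N find_partition env m KK [y])"
proof -
  let ?I = "\<lambda>t m'. (\<forall>r. r \<notin> {K2, KK} \<longrightarrow> m' r = m r) \<and>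
    split_upto N (edge m) (min t n) (\<lambda>y. m' KK [y])"
  have "?I N (sem N find_partition env m)"
    unfolding find_partition_def
  proof (rule sem_For_induct[where P = ?I])
    show "?I 0 m" using kk by (auto simp: split_upto_def split_on_def)
    fix t m'
    assume t: "t < N" and I: "?I t m'"
    have m': "m' NN = m NN" "edge m' = edge m" using I by auto
    have NN: "m' NN [x] \<longleftrightarrow> x = n" if "x < N" for x using n(2)[OF that] m' by simp
    have "sem N extend_partition (env(V9 := t)) m' r = m r" if "r \<notin> {K2, KK}" for r
      using that I by (subst sem_frame) (auto simp: extend_partition_def try_candidate_def)
    moreover have "split_upto N (edge m) (min (Suc t) n) (\<lambda>y. sem N extend_partition (env(V9 := t)) m' KK [y])"
    proof (cases "t < n")
      case True
      have "split_on (edge m) (Suc t) Q"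
        using Q True unfolding split_on_def by (meson Suc_leI order_less_le_trans)
      then show ?thesis
        using extend_partition_correct[where n = n and N = N and m = m' and t = t and env = "env(V9 := t)" and Q = Q, OF n(1) NN True] I True m' by (simp add: min_def)
    next
      case False
      then have "min t n = n" by simp
      then have "split_upto N (edge m) n (\<lambda>y. m' KK [y])" using I by simp
      moreover have "sem N extend_partition (env(V9 := t)) m' KK [y] = m' KK [y]" if "y < N" for y
        using extend_partition_skip[where n = n and N = N and m = m' and y = y and env = "env(V9 := t)", OF n(1) NN _ that] False by simp
      ultimately have "split_upto N (edge m) n (\<lambda>y. sem N extend_partition (env(V9 := t)) m' KK [y])"
        using n(1) by (subst split_upto_cong[where kk' = "\<lambda>y. m' KK [y]"]) auto
      then show ?thesis using False by (simp add: min_def)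
    qed
    ultimately show "?I (Suc t) (sem N extend_partition (env(V9 := t)) m')" by blast
  qed
  then show ?thesis using n(1) by (simp add: split_upto_def min_def)
qed

section \<open>The auction as a relational program\<close>

definition in_indep :: "var \<Rightarrow> var \<Rightarrow> formula" where
  "in_indep y x = Conj (is_vertex y x) (Neg (Rel KK [x]))"

definition falsum :: "var \<Rightarrow> formula" where
  "falsum x = Conj (Rel NN [x]) (Neg (Rel NN [x]))"

definition init_auction :: program where
  "init_auction = (
     Upd LS [V0] (Conj (in_indep V1 V0) (Imp (in_indep V1 V9) (Conj (Neg (Eq V0 V9))
       (Forall V2 (Imp (Rel ADJ [V0, V2]) (Rel ADJ [V9, V2])))))) then\<^sub>c
     Upd RS [V0] (Conj (is_vertex V1 V0) (Disj (Conj (in_indep V1 V9) (Rel ADJ [V9, V0]))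
       (Conj (Neg (in_indep V1 V9)) (Rel KK [V0])))) then\<^sub>c
     Upd OW [V0, V1] (falsum V0) then\<^sub>c
     Upd PR [V0, V1] (falsum V0))"

text \<open>\<open>PR v p\<close> says that the price of \<open>v\<close> exceeds \<open>p\<close>; so prices are capped at the size of the universe.\<close>

definition bid_possible :: formula where
  "bid_possible = Conj (Rel LS [V6]) (Conj (Rel RS [V5]) (Conj (Rel ADJ [V6, V5])
     (Conj (Neg (Ex V2 (Rel OW [V6, V2])))
     (Conj (Forall V2 (Imp (Conj (Rel RS [V2]) (Rel ADJ [V6, V2]))
        (Forall V3 (Imp (Rel PR [V5, V3]) (Rel PR [V2, V3])))))
     (Ex V2 (Neg (Rel PR [V5, V2])))))))"

text \<open>\<open>bid_possible\<close> reads owners and prices, both of which change, so its truth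
  value is frozen in \<open>BID\<close> before the updates. In threshold form, raising a price by
  one adds 0 and the successors of the present thresholds.\<close>

definition bid_step :: program where
  "bid_step = (
     Upd BID [V0, V1] (Conj (Eq V0 V6) (Conj (Eq V1 V5) bid_possible)) then\<^sub>c
     Upd OW [V0, V1] (Disj (Conj (Rel OW [V0, V1]) (Neg (Conj (Eq V1 V5) (Rel BID [V6, V5])))) (Rel BID [V0, V1])) then\<^sub>c
     Upd PR [V0, V1] (Disj (Rel PR [V0, V1]) (Conj (Conj (Eq V0 V5) (Rel BID [V6, V5]))
       (Disj (Zero V2 V1) (Ex V2 (Conj (Succ V3 V2 V1) (Rel PR [V0, V2])))))))"

text \<open>The two inner loops sweep over all pairs; the two outer ones repeat the sweep.\<close>

definition run_auction :: program where
  "run_auction = For V8 (For V7 (For V6 (For V5 bid_step)))"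

definition members :: "nat \<Rightarrow> rel memory \<Rightarrow> rel \<Rightarrow> nat set" where
  "members N m r = {x. x < N \<and> m r [x]}"

text \<open>\<open>m\<close> is the memory at the start of the auction, from which the fixed
  relations are taken; \<open>pr\<close> and \<open>ow\<close> are the abstract counterparts of
  \<open>PR\<close> and \<open>OW\<close>.\<close>

definition auction_state ::
  "nat \<Rightarrow> rel memory \<Rightarrow> (nat \<Rightarrow> nat) \<Rightarrow> (nat \<Rightarrow> nat \<Rightarrow> bool) \<Rightarrow> rel memory \<Rightarrow> bool" where
  "auction_state N m pr ow m' \<longleftrightarrow> (\<forall>r. r \<notin> {OW, PR, BID} \<longrightarrow> m' r = m r) \<and>
     auction_inv (edge m) (members N m LS) (members N m RS) N pr ow \<and>
     (\<forall>v<N. \<forall>p<N. m' PR [v, p] \<longleftrightarrow> p < pr v) \<and> (\<forall>u<N. \<forall>v<N. m' OW [u, v] \<longleftrightarrow> ow u v)"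

abbreviation bids :: "nat \<Rightarrow> rel memory \<Rightarrow> (nat \<Rightarrow> nat) \<Rightarrow> (nat \<Rightarrow> nat \<Rightarrow> bool) \<Rightarrow> nat \<Rightarrow> nat \<Rightarrow> bool" where
  "bids N m pr ow u v \<equiv> can_bid (edge m) (members N m LS) (members N m RS) N pr ow u v"

lemma holds_bid_possible:
  assumes st: "auction_state N m pr ow m'" and uv: "env V6 = u" "env V5 = v" "u < N" "v < N"
  shows "holds N m' env bid_possible \<longleftrightarrow> bids N m pr ow u v"
proof -
  note s = st[unfolded auction_state_def]
  have inv: "auction_inv (edge m) (members N m LS) (members N m RS) N pr ow" using s by blast
  have rel: "m' LS = m LS" "m' RS = m RS" "m' ADJ = m ADJ" using s by auto
  have PR: "m' PR [v, p] \<longleftrightarrow> p < pr v" if "v < N" "p < N" for v p using s that by blast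
  have OW: "m' OW [u, v] \<longleftrightarrow> ow u v" if "u < N" "v < N" for u v using s that by blast
  have prN: "pr v \<le> N" for v using inv by (simp add: auction_inv_def)
  have owN: "ow u z \<Longrightarrow> z < N" for u z using inv by (auto simp: auction_inv_def members_def)
  \<comment> \<open>Prices do not exceed \<open>N\<close>, so comparing thresholds below
    \<open>N\<close> compares the prices themselves.\<close>
  have le: "(\<forall>p<N. p < pr v \<longrightarrow> p < pr z) \<longleftrightarrow> pr v \<le> pr z" for z
    using prN[of v] by (metis less_le_trans not_le order_less_irrefl)
  have lt: "(\<exists>p<N. \<not> p < pr v) \<longleftrightarrow> pr v < N"
    by (meson le_less_trans not_le order_refl)
  have "holds N m' env bid_possible \<longleftrightarrow> m LS [u] \<and> m RS [v] \<and> edge m u v \<and> \<not> (\<exists>z<N. ow u z) \<and>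
      (\<forall>z<N. m RS [z] \<and> edge m u z \<longrightarrow> (\<forall>p<N. p < pr v \<longrightarrow> p < pr z)) \<and> (\<exists>p<N. \<not> p < pr v)"
    using uv by (simp add: bid_possible_def rel PR OW cong: conj_cong)
  also have "\<dots> \<longleftrightarrow> bids N m pr ow u v"
    unfolding le lt can_bid_def using uv(3,4) owN by (auto simp: members_def)
  finally show ?thesis .
qed

lemma bid_step_correct:
  assumes st: "auction_state N m pr ow m'" and uv: "env V6 = u" "env V5 = v" "u < N" "v < N"
  shows "if bids N m pr ow u v
    then auction_state N m (pr(v := pr v + 1)) (\<lambda>a b. (ow a b \<and> b \<noteq> v) \<or> (a = u \<and> b = v)) (sem N bid_step env m')
    else auction_state N m pr ow (sem N bid_step env m')"
proof -
  note s = st[unfolded auction_state_def]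
  have PR: "m' PR [v, p] \<longleftrightarrow> p < pr v" if "v < N" "p < N" for v p using s that by blast
  have OW: "m' OW [u, v] \<longleftrightarrow> ow u v" if "u < N" "v < N" for u v using s that by blast
  let ?c1 = "Upd BID [V0, V1] (Conj (Eq V0 V6) (Conj (Eq V1 V5) bid_possible)) :: program"
  let ?B = "bids N m pr ow u v"
  define m1 where "m1 = sem N ?c1 env m'"
  have m1: "m1 BID [a, b] \<longleftrightarrow> a = u \<and> b = v \<and> ?B" if "a < N" "b < N" for a b
    using that uv holds_bid_possible[OF st, of "env(V0 := a, V1 := b)" u v] by (auto simp: m1_def)
  have m1': "m1 r = m' r" if "r \<noteq> BID" for r
    using that by (simp add: m1_def)
  define m2 where "m2 = sem N (Upd OW [V0, V1] (Disj (Conj (Rel OW [V0, V1])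
     (Neg (Conj (Eq V1 V5) (Rel BID [V6, V5])))) (Rel BID [V0, V1]))) env m1"
  have m2: "m2 OW [a, b] \<longleftrightarrow> (ow a b \<and> \<not> (b = v \<and> ?B)) \<or> (a = u \<and> b = v \<and> ?B)" if "a < N" "b < N" for a b
    using that uv m1 m1' OW by (auto simp: m2_def)
  have m2': "m2 r = m1 r" if "r \<noteq> OW" for r
    using that by (simp add: m2_def)
  define m3 where "m3 = sem N (Upd PR [V0, V1] (Disj (Rel PR [V0, V1])
      (Conj (Conj (Eq V0 V5) (Rel BID [V6, V5]))
       (Disj (Zero V2 V1) (Ex V2 (Conj (Succ V3 V2 V1) (Rel PR [V0, V2]))))))) env m2"
  have "m3 PR [a, p] \<longleftrightarrow> p < pr a \<or> (a = v \<and> ?B \<and> (p = 0 \<or> (\<exists>q<N. p = Suc q \<and> q < pr a)))" if "a < N" "p < N" for a p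
    using that uv m1 m1' m2' PR by (auto simp: m3_def cong: conj_cong)
  then have m3: "m3 PR [a, p] \<longleftrightarrow> p < (if a = v \<and> ?B then pr a + 1 else pr a)" if "a < N" "p < N" for a p
    using that by (cases p) auto
  have m3': "m3 r = m2 r" if "r \<noteq> PR" for r
    using that by (simp add: m3_def)
  have "sem N bid_step env m' = m3"
    by (simp add: bid_step_def m1_def m2_def m3_def)
  moreover have "\<forall>r. r \<notin> {OW, PR, BID} \<longrightarrow> m3 r = m r"
    using s m1' m2' m3' by simp
  moreover have "m3 OW = m2 OW" using m3' by simp
  ultimately show ?thesis
    using s m2 m3 auction_inv_bid[of "edge m" "members N m LS" "members N m RS" N pr ow u v]
    unfolding auction_state_def by auto
qed

text \<open>Until the first successful bid the auction is in its initial state, so the failed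
  attempts all refer to \<open>pr0\<close> and \<open>ow0\<close>. A sweep thus either raises the
  sum of prices or shows that no pair could bid at its start.\<close>

lemma sweep_correct:
  assumes st: "auction_state N m pr0 ow0 m'"
  defines "stop \<equiv> \<lambda>pr ow. \<forall>u<N. \<forall>v<N. \<not> bids N m pr ow u v"
  shows "\<exists>pr ow. auction_state N m pr ow (sem N (For V6 (For V5 bid_step)) env m') \<and>
    (sum pr0 (members N m RS) < sum pr (members N m RS) \<and> \<not> stop pr0 ow0 \<or> pr = pr0 \<and> ow = ow0 \<and> stop pr0 ow0)"
proof -
  let ?S = "\<lambda>pr. sum pr (members N m RS)"
  have fin: "finite (members N m RS)" by (simp add: members_def)
  define J where "J D m' \<longleftrightarrow> (\<exists>pr ow. auction_state N m pr ow m' \<and> (?S pr0 < ?S pr \<and> \<not> stop pr0 ow0 \<or>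
    pr = pr0 \<and> ow = ow0 \<and> (\<forall>(u, v)\<in>D. \<not> bids N m pr0 ow0 u v)))" for D and m' :: "rel memory"
  have step: "J (insert (u, v) D) (sem N bid_step e m'')"
    if J: "J D m''" and uv: "e V6 = u" "e V5 = v" "u < N" "v < N" for D m'' e u v
  proof -
    obtain pr ow where p: "auction_state N m pr ow m''" "?S pr0 < ?S pr \<and> \<not> stop pr0 ow0 \<or>
      pr = pr0 \<and> ow = ow0 \<and> (\<forall>(u, v)\<in>D. \<not> bids N m pr0 ow0 u v)"
      using J unfolding J_def by blast
    note b = bid_step_correct[OF p(1) uv]
    show ?thesis
    proof (cases "bids N m pr ow u v")
      case True
      then have "v \<in> members N m RS" by (simp add: can_bid_def)
      then have "?S (pr(v := pr v + 1)) = Suc (?S pr)"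
        using fin by (simp add: sum.remove[of _ v])
      moreover have "?S pr0 \<le> ?S pr" "\<not> stop pr0 ow0"
        using p(2) True uv by (auto simp: stop_def)
      ultimately show ?thesis
        using b True unfolding J_def
        by (intro exI[of _ "pr(v := pr v + 1)"] exI[of _ "\<lambda>a b. (ow a b \<and> b \<noteq> v) \<or> (a = u \<and> b = v)"]) simp
    next
      case False
      then show ?thesis
        using b p(2) unfolding J_def by (intro exI[of _ pr] exI[of _ ow]) auto
    qed
  qed
  have loop1: "J (D \<union> {u} \<times> {..<N}) (sem N (For V5 bid_step) e m'')"
    if J: "J D m''" and u: "e V6 = u" "u < N" for D m'' e u
  proof (rule sem_For_induct[where P = "\<lambda>i m'. J (D \<union> {u} \<times> {..<i}) m'"])
    fix i m'
    assume "i < N" "J (D \<union> {u} \<times> {..<i}) m'"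
    then have "J (insert (u, i) (D \<union> {u} \<times> {..<i})) (sem N bid_step (e(V5 := i)) m')"
      using u by (intro step) auto
    moreover have "insert (u, i) (D \<union> {u} \<times> {..<i}) = D \<union> {u} \<times> {..<Suc i}"
      by (auto simp: less_Suc_eq)
    ultimately show "J (D \<union> {u} \<times> {..<Suc i}) (sem N bid_step (e(V5 := i)) m')" by simp
  qed (use J in simp)
  have "J ({..<N} \<times> {..<N}) (sem N (For V6 (For V5 bid_step)) env m')"
  proof (rule sem_For_induct[where P = "\<lambda>i m'. J ({..<i} \<times> {..<N}) m'"])
    show "J ({..<0} \<times> {..<N}) m'" using st by (auto simp: J_def)
    fix i m'
    assume "i < N" "J ({..<i} \<times> {..<N}) m'"
    then have "J ({..<i} \<times> {..<N} \<union> {i} \<times> {..<N}) (sem N (For V5 bid_step) (env(V6 := i)) m')"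
      by (intro loop1) auto
    moreover have "{..<i} \<times> {..<N} \<union> {i} \<times> {..<N} = {..<Suc i} \<times> {..<N}"
      by (auto simp: less_Suc_eq)
    ultimately show "J ({..<Suc i} \<times> {..<N}) (sem N (For V5 bid_step) (env(V6 := i)) m')" by simp
  qed
  then show ?thesis
    unfolding J_def stop_def by (auto simp: Ball_def)
qed

text \<open>Every sweep that is not idle raises the sum of the prices, which stays below \<open>N * N\<close>.\<close>

lemma run_auction_correct:
  assumes st: "auction_state N m pr0 ow0 m'" and card: "card (members N m RS) < N"
  shows "\<exists>pr ow. auction_state N m pr ow (sem N run_auction env m') \<and> (\<forall>u v. \<not> bids N m pr ow u v)"
proof -
  let ?S = "\<lambda>pr. sum pr (members N m RS)" and ?c = "For V6 (For V5 bid_step)"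
  \<comment> \<open>Rest persists because an idle sweep changes nothing, so \<open>k\<close> sweeps
    give either rest or a sum of at least \<open>k\<close>.\<close>
  define J where "J k m' \<longleftrightarrow> (\<exists>pr ow. auction_state N m pr ow m' \<and>
    (k \<le> ?S pr \<or> (\<forall>u<N. \<forall>v<N. \<not> bids N m pr ow u v)))" for k and m' :: "rel memory"
  have step: "J (Suc k) (sem N ?c e m'')" if J: "J k m''" for k e m''
  proof -
    obtain pr ow where p: "auction_state N m pr ow m''"
      "k \<le> ?S pr \<or> (\<forall>u<N. \<forall>v<N. \<not> bids N m pr ow u v)"
      using J unfolding J_def by blast
    obtain pr' ow' where p': "auction_state N m pr' ow' (sem N ?c e m'')"
      "?S pr < ?S pr' \<and> \<not> (\<forall>u<N. \<forall>v<N. \<not> bids N m pr ow u v) \<or>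
        pr' = pr \<and> ow' = ow \<and> (\<forall>u<N. \<forall>v<N. \<not> bids N m pr ow u v)"
      using sweep_correct[OF p(1), of e] by blast
    then have "Suc k \<le> ?S pr' \<or> (\<forall>u<N. \<forall>v<N. \<not> bids N m pr' ow' u v)"
      using p(2) by auto
    then show ?thesis
      using p'(1) unfolding J_def by blast
  qed
  have "J (N * N) (sem N run_auction env m')"
    unfolding run_auction_def
  proof (rule sem_For_induct[where P = "\<lambda>i m'. J (i * N) m'"])
    show "J (0 * N) m'" using st by (auto simp: J_def)
    fix i m'
    assume J: "J (i * N) m'"
    have "J (i * N + N) (sem N (For V7 ?c) (env(V8 := i)) m')"
      by (rule sem_For_induct[where P = "\<lambda>j m'. J (i * N + j) m'"]) (use J step in simp_all)
    then show "J (Suc i * N) (sem N (For V7 ?c) (env(V8 := i)) m')"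
      by (simp add: add.commute)
  qed
  then obtain pr ow where p: "auction_state N m pr ow (sem N run_auction env m')"
    "N * N \<le> ?S pr \<or> (\<forall>u<N. \<forall>v<N. \<not> bids N m pr ow u v)"
    unfolding J_def by blast
  have "pr v \<le> N" for v
    using p(1) by (simp add: auction_state_def auction_inv_def)
  \<comment> \<open>A sum of \<open>N * N\<close> is out of reach, which leaves only rest.\<close>
  then have "?S pr \<le> card (members N m RS) * N"
    using sum_bounded_above[of "members N m RS" pr N] by simp
  also have "\<dots> < N * N" using card by simp
  finally have "\<forall>u<N. \<forall>v<N. \<not> bids N m pr ow u v" using p(2) by simp
  then have "\<not> bids N m pr ow u v" for u v
    by (auto simp: can_bid_def members_def)
  then show ?thesis using p(1) by blast
qed

lemma init_auction_correct:
  assumes n: "n < N" "\<And>x. x < N \<Longrightarrow> m NN [x] \<longleftrightarrow> x = n" and i: "env V9 = i" "i < N"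
    and adj: "\<And>u v. u < N \<Longrightarrow> v < N \<Longrightarrow> edge m u v \<Longrightarrow> u < n \<and> v < n"
  defines "m' \<equiv> sem N init_auction env m"
  shows "members N m' LS = left_part (edge m) n (\<lambda>y. m KK [y]) i"
    and "members N m' RS = right_part (edge m) n (\<lambda>y. m KK [y]) i"
    and "auction_state N m' (\<lambda>_. 0) (\<lambda>_ _. False) m'"
    and "r \<notin> {LS, RS, OW, PR} \<Longrightarrow> m' r = m r"
proof -
  have indep: "holds N m1 e (in_indep V1 x) \<longleftrightarrow> e x < n \<and> \<not> m KK [e x]"
    if "m1 NN = m NN" "m1 KK = m KK" "x \<noteq> V1" for m1 e x
    using that n by (simp add: in_indep_def holds_is_vertex[of _ _ n])
  show "members N m' LS = left_part (edge m) n (\<lambda>y. m KK [y]) i"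
    using n(1) i adj unfolding m'_def init_auction_def members_def left_part_def
    by (auto simp: indep)
  show "members N m' RS = right_part (edge m) n (\<lambda>y. m KK [y]) i"
    using n i adj unfolding m'_def init_auction_def members_def right_part_def
    by (auto simp: indep holds_is_vertex[of _ _ n])
  show "auction_state N m' (\<lambda>_. 0) (\<lambda>_ _. False) m'"
    by (auto simp: auction_state_def auction_inv_def m'_def init_auction_def falsum_def)
  show "r \<notin> {LS, RS, OW, PR} \<Longrightarrow> m' r = m r"
    by (simp add: m'_def init_auction_def)
qed

section \<open>Comparing the optimum with the threshold\<close>

definition collect :: program where
  "collect = Upd XS [V0] (Disj (Rel LS [V0])
     (Disj (Conj (Rel RS [V0]) (Neg (Ex V1 (Rel PR [V0, V1])))) (Conj (Eq V0 V9) (in_indep V1 V9))))"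

definition count :: program where
  "count = For V8 (Upd CNT [V0, V1] (Disj (Conj (Zero V2 V0) (Zero V2 V1))
     (Ex V2 (Ex V3 (Conj (Succ V4 V2 V0) (Conj (Rel CNT [V2, V3])
       (Disj (Conj (Rel XS [V2]) (Succ V4 V3 V1)) (Conj (Neg (Rel XS [V2])) (Eq V3 V1)))))))))"

text \<open>Row \<open>n\<close>, one past the last, would start directly behind the matrix, so
  \<open>ROW\<close> also locates the binary number. If its value lies outside the universe, no
  \<open>V3\<close> is found, and rejecting is right because counts stay below \<open>N\<close>.
  Successes of earlier indices are kept in \<open>RES\<close>.\<close>

definition accept_large :: program where
  "accept_large = Upd RES [V0] (Disj (Rel RES [V0]) (Ex V1 (Ex V2 (Ex V3 (Ex V4 (Conj (Rel NN [V1])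
     (Conj (Rel ROW [V1, V2]) (Conj (Rel VAL [V2, V3]) (Conj (Rel CNT [V1, V4]) (Neg (Less V4 V3)))))))))))"

definition solve_index :: program where
  "solve_index = (init_auction then\<^sub>c run_auction then\<^sub>c collect then\<^sub>c count then\<^sub>c accept_large)"

text \<open>The entry of \<open>ROW\<close> exists only if the word reaches beyond the matrix, and a
  last bit 1 then rules out leading zeros and \<open>k = 0\<close>. Checking the partition makes a
  wrong earlier answer harmless on graphs that are not split.\<close>

definition validate :: program where
  "validate = Upd RES [V0] (Conj (Rel RES [V0]) (Conj
     (Ex V1 (Ex V2 (Ex V3 (Conj (Rel NN [V1]) (Conj (Rel ROW [V1, V2]) (Conj (Last V4 V3) (Rel W [V3])))))))
     (Forall V1 (Forall V2 (Conj (Imp (Rel ADJ [V1, V2]) (Conj (Rel ADJ [V2, V1]) (Neg (Eq V1 V2))))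
       (Imp (Conj (is_vertex V3 V1) (Conj (is_vertex V3 V2) (Neg (Eq V1 V2))))
         (Conj (Imp (Conj (Rel KK [V1]) (Rel KK [V2])) (Rel ADJ [V1, V2]))
           (Imp (Conj (Neg (Rel KK [V1])) (Neg (Rel KK [V2]))) (Neg (Rel ADJ [V1, V2]))))))))))"

definition decide :: program where
  "decide = (find_size then\<^sub>c compute_plus then\<^sub>c find_rows then\<^sub>c read_matrix then\<^sub>c read_values then\<^sub>c
     find_partition then\<^sub>c For V9 solve_index then\<^sub>c validate)"

lemma wf_decide: "wf_cmd arity {} decide"
  by (simp add: decide_def find_size_def compute_plus_def find_rows_def read_matrix_def read_values_def
      find_partition_def extend_partition_def try_candidate_def candidate_good_def candidate_def
      is_vertex_def solve_index_def init_auction_def in_indep_def falsum_def run_auction_def bid_step_def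
      bid_possible_def collect_def count_def accept_large_def validate_def)

lemma count_correct:
  assumes "a < N" "c < N"
  shows "sem N count env m CNT [a, c] \<longleftrightarrow> c = card {y. y < a \<and> m XS [y]}"
proof -
  let ?I = "\<lambda>t m'. (\<forall>r. r \<noteq> CNT \<longrightarrow> m' r = m r) \<and>
    (\<forall>a<N. \<forall>c<N. a < t \<longrightarrow> (m' CNT [a, c] \<longleftrightarrow> c = card {y. y < a \<and> m XS [y]}))"
  have card_Suc: "card {y. y < Suc b \<and> m XS [y]} = card {y. y < b \<and> m XS [y]} + (if m XS [b] then 1 else 0)" for b
  proof -
    have "{y. y < Suc b \<and> m XS [y]} = (if m XS [b] then insert b {y. y < b \<and> m XS [y]} else {y. y < b \<and> m XS [y]})"
      by (auto simp: less_Suc_eq)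
    then show ?thesis by simp
  qed
  have "?I N (sem N count env m)"
    unfolding count_def
  proof (rule sem_For_induct[where P = ?I], goal_cases)
    case (2 t m')
    show ?case
    proof (intro conjI allI impI, goal_cases)
      case (2 a c)
      show ?case
      proof (cases a)
        case 0
        then show ?thesis using 2 by (simp cong: conj_cong)
      next
        case (Suc b)
        have "card {y. y < b \<and> m XS [y]} \<le> card {..<b}" by (intro card_mono) auto
        then have "card {y. y < b \<and> m XS [y]} < N" using 2 Suc by simp
        then show ?thesis
          using \<open>?I t m'\<close> 2 Suc card_Suc[of b] by (auto cong: conj_cong)
      qed
    qed (use 2 in simp)
  qed simp
  then show ?thesis using assms by blast
qed

lemma solve_index_correct:
  assumes n: "n < N" "\<And>x. x < N \<Longrightarrow> m NN [x] \<longleftrightarrow> x = n" and i: "env V9 = i" "i < N"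
    and adj: "\<And>u v. u < N \<Longrightarrow> v < N \<Longrightarrow> edge m u v \<Longrightarrow> u < n \<and> v < n \<and> u \<noteq> v"
    and split: "split_on (edge m) n (\<lambda>y. m KK [y])"
    and row: "s < N" "\<And>p. p < N \<Longrightarrow> m ROW [n, p] \<longleftrightarrow> p = s"
    and val: "\<And>v. v < N \<Longrightarrow> m VAL [s, v] \<longleftrightarrow> v = k"
  shows "sem N solve_index env m RES [0] \<longleftrightarrow> m RES [0] \<or>
    (\<exists>J. bip_indep (edge m) (left_part (edge m) n (\<lambda>y. m KK [y]) i) (right_part (edge m) n (\<lambda>y. m KK [y]) i) J \<and>
      k \<le> card J + (if i < n \<and> \<not> m KK [i] then 1 else 0))"
proof -
  let ?L = "left_part (edge m) n (\<lambda>y. m KK [y]) i" and ?R = "right_part (edge m) n (\<lambda>y. m KK [y]) i"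
  let ?b = "i < n \<and> \<not> m KK [i]"
  define m1 where "m1 = sem N init_auction env m"
  have adj': "u < n \<and> v < n" if "u < N" "v < N" "edge m u v" for u v using adj that by blast
  note init = init_auction_correct[where m = m and env = env and i = i, OF n i adj', folded m1_def]
  have LR: "?L \<subseteq> {..<n}" "?R \<subseteq> {..<n}" by (auto simp: left_part_def right_part_def)
  have m1: "edge m1 = edge m" using init(4)[of ADJ] by simp
  have "card ?R \<le> card {..<n}" using LR by (intro card_mono) auto
  then have R: "card ?R < N" using n(1) by simp
  obtain pr ow where auc: "auction_state N m1 pr ow (sem N run_auction env m1)" "\<And>u v. \<not> bids N m1 pr ow u v"
    using run_auction_correct[OF init(3)] R init(2) by metis
  define m2 where "m2 = sem N run_auction env m1"
  have m2: "m2 r = m1 r" if "r \<notin> {OW, PR, BID}" for r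
    using auc(1) that by (simp add: auction_state_def m2_def)
  have PR: "m2 PR [v, p] \<longleftrightarrow> p < pr v" if "v < N" "p < N" for v p
    using auc(1) that by (simp add: auction_state_def m2_def)
  have m2m: "m2 r = m r" if "r \<notin> {OW, PR, BID, LS, RS}" for r
    using m2 init(4) that by simp
  define m3 where "m3 = sem N collect env m2"
  \<comment> \<open>This set has the size of an optimal choice but need not be independent; by
    \<open>auction_optimal\<close> its cardinality is all that matters.\<close>
  define X where "X = (?L \<union> {v\<in>?R. pr v = 0}) \<union> (if ?b then {i} else {})"
  have m3: "m3 r = m2 r" if "r \<noteq> XS" for r
    using that by (simp add: m3_def collect_def)
  have LS: "m1 LS [x] \<longleftrightarrow> x \<in> ?L" "m1 RS [x] \<longleftrightarrow> x \<in> ?R" if "x < N" for x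
    using init(1,2) that by (auto simp: members_def)
  have "(\<forall>p<N. \<not> p < pr x) \<longleftrightarrow> pr x = 0" for x
    using n(1) by auto
  then have XS: "m3 XS [x] \<longleftrightarrow> x \<in> X" if "x < N" for x
    using that i n m2 m2m LS
    by (auto simp: m3_def collect_def X_def PR in_indep_def holds_is_vertex[of _ _ n] cong: conj_cong)
  have Xn: "X \<subseteq> {..<n}" using LR by (auto simp: X_def)
  have "{y. y < n \<and> m3 XS [y]} = X" using Xn XS n(1) by auto
  then have CNT: "sem N count env m3 CNT [n, c] \<longleftrightarrow> c = card X" if "c < N" for c
    using count_correct[OF n(1) that] by simp
  define m4 where "m4 = sem N count env m3"
  have m4: "m4 r = m r" if "r \<notin> {OW, PR, BID, LS, RS, XS, CNT}" for r
    using that m3 m2m by (simp add: m4_def sem_frame count_def del: sem.simps(3))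
  have cX: "card X < N"
    using card_mono[OF _ Xn] n(1) by simp
  have "sem N solve_index env m = sem N accept_large env m4"
    by (simp add: solve_index_def m1_def m2_def m3_def m4_def)
  moreover have "sem N accept_large env m4 RES [0] \<longleftrightarrow> m RES [0] \<or> k \<le> card X"
  proof -
    have "sem N accept_large env m4 RES [0] \<longleftrightarrow> m RES [0] \<or>
        (\<exists>n'<N. \<exists>p<N. \<exists>v<N. \<exists>c<N. n' = n \<and> m ROW [n', p] \<and> m VAL [p, v] \<and> m4 CNT [n', c] \<and> \<not> c < v)"
      using n by (simp add: accept_large_def m4 cong: conj_cong)
    also have "(\<exists>n'<N. \<exists>p<N. \<exists>v<N. \<exists>c<N. n' = n \<and> m ROW [n', p] \<and> m VAL [p, v] \<and> m4 CNT [n', c] \<and> \<not> c < v) \<longleftrightarrow>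
        k \<le> card X" (is "?E \<longleftrightarrow> _")
    proof
      assume ?E
      then obtain p v c where pvc: "p < N" "v < N" "c < N" "m ROW [n, p]" "m VAL [p, v]" "m4 CNT [n, c]" "\<not> c < v"
        by blast
      then have "p = s" using row(2) by simp
      then have "v = k" using val pvc by simp
      moreover have "c = card X" using CNT pvc by (simp add: m4_def)
      ultimately show "k \<le> card X" using pvc by simp
    next
      \<comment> \<open>Since \<open>card X < N\<close>, the threshold \<open>k\<close> lies in the
        universe and has an entry in \<open>VAL\<close>.\<close>
      assume k: "k \<le> card X"
      then have "m VAL [s, k]" using val cX by simp
      moreover have "m ROW [n, s]" using row by simp
      moreover have "m4 CNT [n, card X]" using CNT cX by (simp add: m4_def)
      moreover have "k < N" "\<not> card X < k" using k cX by simp_all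
      ultimately show ?E using n(1) row(1) cX by blast
    qed
    finally show ?thesis .
  qed
  moreover have cardX: "card X = card (?L \<union> {v\<in>?R. pr v = 0}) + (if ?b then 1 else 0)"
  proof -
    \<comment> \<open>\<open>i\<close> is excluded from its own left part, and it is not in the
      right part because there are no loops.\<close>
    have "i \<notin> ?L \<union> {v\<in>?R. pr v = 0}" if ?b
      using that adj[OF i(2) i(2)] by (auto simp: left_part_def right_part_def)
    moreover have "finite (?L \<union> {v\<in>?R. pr v = 0})"
      using LR finite_subset by fastforce
    ultimately show ?thesis by (simp add: X_def)
  qed
  have opt: "\<exists>J. bip_indep (edge m) ?L ?R J \<and> card J = card (?L \<union> {v\<in>?R. pr v = 0})"
    "\<And>J. bip_indep (edge m) ?L ?R J \<Longrightarrow> card J \<le> card (?L \<union> {v\<in>?R. pr v = 0})"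
  proof -
    have inv: "auction_inv (edge m) ?L ?R N pr ow"
      using auc(1) init(1,2) m1 by (simp add: auction_state_def)
    have stop: "\<not> can_bid (edge m) ?L ?R N pr ow u v" for u v
      using auc(2) init(1,2) m1 by simp
    have fin: "finite ?L" "finite ?R" using LR finite_subset by blast+
    have "?L \<inter> ?R = {}"
      using split by (auto simp: left_part_def right_part_def split_on_def split: if_splits)
    note opt = auction_optimal[OF inv stop fin this R]
    show "\<exists>J. bip_indep (edge m) ?L ?R J \<and> card J = card (?L \<union> {v\<in>?R. pr v = 0})"
      "\<And>J. bip_indep (edge m) ?L ?R J \<Longrightarrow> card J \<le> card (?L \<union> {v\<in>?R. pr v = 0})"
      using opt by blast+
  qed
  moreover have "k \<le> card X \<longleftrightarrow> (\<exists>J. bip_indep (edge m) ?L ?R J \<and> k \<le> card J + (if ?b then 1 else 0))"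
  proof
    assume "k \<le> card X"
    then show "\<exists>J. bip_indep (edge m) ?L ?R J \<and> k \<le> card J + (if ?b then 1 else 0)"
      using opt(1) unfolding cardX by auto
  next
    assume "\<exists>J. bip_indep (edge m) ?L ?R J \<and> k \<le> card J + (if ?b then 1 else 0)"
    then obtain J where J: "bip_indep (edge m) ?L ?R J" "k \<le> card J + (if ?b then 1 else 0)"
      by blast
    show "k \<le> card X"
      unfolding cardX using J(2) add_right_mono[OF opt(2)[OF J(1)]] by (rule order.trans)
  qed
  ultimately show ?thesis by simp
qed

lemma solve_correct:
  assumes n: "n < N" "\<And>x. x < N \<Longrightarrow> m NN [x] \<longleftrightarrow> x = n"
    and adj: "\<And>u v. u < N \<Longrightarrow> v < N \<Longrightarrow> edge m u v \<Longrightarrow> u < n \<and> v < n \<and> u \<noteq> v"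
    and split: "split_on (edge m) n (\<lambda>y. m KK [y])"
    and row: "s < N" "\<And>p. p < N \<Longrightarrow> m ROW [n, p] \<longleftrightarrow> p = s"
    and val: "\<And>v. v < N \<Longrightarrow> m VAL [s, v] \<longleftrightarrow> v = k"
    and res: "\<not> m RES [0]"
  shows "sem N (For V9 solve_index) env m RES [0] \<longleftrightarrow>
    (\<exists>i<N. \<exists>J. bip_indep (edge m) (left_part (edge m) n (\<lambda>y. m KK [y]) i) (right_part (edge m) n (\<lambda>y. m KK [y]) i) J \<and>
      k \<le> card J + (if i < n \<and> \<not> m KK [i] then 1 else 0))" (is "_ \<longleftrightarrow> (\<exists>i<N. ?P i)")
proof -
  let ?I = "\<lambda>t m'. (\<forall>r. r \<in> {NN, ADJ, KK, ROW, VAL} \<longrightarrow> m' r = m r) \<and> (m' RES [0] \<longleftrightarrow> (\<exists>i<t. ?P i))"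
  have "?I N (sem N (For V9 solve_index) env m)"
  proof (rule sem_For_induct[where P = ?I])
    show "?I 0 m" using res by simp
    fix t m'
    assume t: "t < N" and I: "?I t m'"
    have m': "m' NN = m NN" "m' ADJ = m ADJ" "m' KK = m KK" "m' ROW = m ROW" "m' VAL = m VAL"
      using I by auto
    have "sem N solve_index (env(V9 := t)) m' RES [0] \<longleftrightarrow> m' RES [0] \<or> ?P t"
      using solve_index_correct[where m = m' and n = n and N = N and env = "env(V9 := t)" and i = t and s = s and k = k]
        n adj split row val t m' by simp
    then have res': "sem N solve_index (env(V9 := t)) m' RES [0] \<longleftrightarrow> (\<exists>i<t. ?P i) \<or> ?P t"
      using I by blast
    have "sem N solve_index (env(V9 := t)) m' r = m' r" if "r \<in> {NN, ADJ, KK, ROW, VAL}" for r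
      using that by (intro sem_frame) (auto simp: solve_index_def init_auction_def run_auction_def bid_step_def
        collect_def count_def accept_large_def)
    then have frame: "\<forall>r. r \<in> {NN, ADJ, KK, ROW, VAL} \<longrightarrow> sem N solve_index (env(V9 := t)) m' r = m r"
      using I by metis
    have ex_Suc: "(\<exists>i<Suc t. Q i) \<longleftrightarrow> (\<exists>i<t. Q i) \<or> Q t" for Q
      by (auto simp: less_Suc_eq)
    show "?I (Suc t) (sem N solve_index (env(V9 := t)) m')"
      by (rule conjI[OF frame]) (unfold res', rule ex_Suc[of ?P, symmetric])
  qed
  then show ?thesis by (rule conjunct2)
qed

section \<open>Encodings of instances\<close>

lemma bits_value_pos: "bs \<noteq> [] \<Longrightarrow> last bs \<Longrightarrow> 0 < bits_value bs"
  by (induction bs) (auto split: if_splits)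

text \<open>A last bit 1 is the absence of leading zeros, the condition under which decoding can be
  undone.\<close>

lemma binary_bits_value: "bs = [] \<or> last bs \<Longrightarrow> binary (bits_value bs) = bs"
proof (induction bs)
  case Nil
  then show ?case by (simp add: binary.simps)
next
  case (Cons b bs)
  have "bits_value (b # bs) \<noteq> 0"
    using bits_value_pos[of "b # bs"] Cons.prems by simp
  moreover have "bits_value (b # bs) div 2 = bits_value bs" "odd (bits_value (b # bs)) \<longleftrightarrow> b"
    by simp_all
  moreover have "binary (bits_value bs) = bs"
    using Cons by (cases "bs = []") simp_all
  ultimately show ?case
    using binary.simps[of "bits_value (b # bs)"] by (simp del: bits_value.simps)
qed

lemma bits_value_binary: "bits_value (binary k) = k"
proof (induction k rule: less_induct)
  case (less k)
  show ?case
  proof (cases "k = 0")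
    case False
    then have "bits_value (binary (k div 2)) = k div 2" using less by simp
    then show ?thesis
      using False binary.simps[of k] by (simp add: mod_2_eq_odd[symmetric])
  qed (simp add: binary.simps)
qed

lemma last_binary: "0 < k \<Longrightarrow> binary k \<noteq> [] \<and> last (binary k)"
proof (induction k rule: less_induct)
  case (less k)
  show ?case
  proof (cases "k div 2 = 0")
    case True
    then have "k = 1" using less.prems by linarith
    then show ?thesis by (simp add: binary.simps)
  next
    case False
    then show ?thesis
      using less.IH[of "k div 2"] less.prems binary.simps[of k] by simp
  qed
qed

lemma nth_concat_rows:
  assumes "i < m" "j < n"
  shows "concat (map (\<lambda>i. map (f i) [0..<n]) [0..<m]) ! (i * n + j) = f i j"
  using assms(1)
proof (induction m)
  case (Suc m)
  let ?c = "concat (map (\<lambda>i. map (f i) [0..<n]) [0..<m])"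
  have len: "length ?c = m * n"
    by (simp add: length_concat o_def sum_list_triv)
  show ?case
  proof (cases "i < m")
    case True
    then have "i * n + j < m * n"
      using assms(2) by (metis add.commute less_le_trans mult_Suc mult_le_mono1 nat_add_left_cancel_less Suc_leI)
    then show ?thesis using Suc.IH True len by (simp add: nth_append)
  next
    case False
    then have "i = m" using Suc.prems by simp
    then show ?thesis using len assms(2) by (simp add: nth_append)
  qed
qed simp

section \<open>Instances read back from words\<close>

definition matrix_entry :: "bool list \<Rightarrow> nat \<Rightarrow> nat \<Rightarrow> nat \<Rightarrow> bool" where
  "matrix_entry w n i j \<longleftrightarrow> i < n \<and> j < n \<and> w ! (Suc n + i * n + j)"

definition matrix_graph :: "bool list \<Rightarrow> nat \<Rightarrow> nat pair_pre_digraph" where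
  "matrix_graph w n = \<lparr>pverts = {0..<n}, parcs = {(i, j). matrix_entry w n i j}\<rparr>"

text \<open>\<open>n\<close> is the position of the terminator. The word must continue past the
  matrix and end in 1, which says that the binary number is positive and has no leading
  zeros.\<close>

definition well_formed :: "bool list \<Rightarrow> nat \<Rightarrow> bool" where
  "well_formed w n \<longleftrightarrow> n < length w \<and> \<not> w ! n \<and> (\<forall>y<n. w ! y) \<and> Suc n + n * n < length w \<and> last w"

lemma nth_encode_instance:
  fixes G :: "nat pair_pre_digraph" and k :: nat
  assumes n: "card (pverts G) = n"
  defines "w \<equiv> encode_instance G k"
  shows "length w = Suc n + n * n + length (binary k)"
    and "y < n \<Longrightarrow> w ! y" and "\<not> w ! n"
    and "i < n \<Longrightarrow> j < n \<Longrightarrow> w ! (Suc n + i * n + j) \<longleftrightarrow> (i, j) \<in> parcs G"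
    and "drop (Suc n + n * n) w = binary k"
proof -
  have w: "w = replicate n True @ False # adjacency_bits G @ binary k"
    using n by (simp add: w_def encode_instance_def)
  have len: "length (adjacency_bits G) = n * n"
    using n by (simp add: length_adjacency_bits)
  show "length w = Suc n + n * n + length (binary k)" "y < n \<Longrightarrow> w ! y" "\<not> w ! n"
    "drop (Suc n + n * n) w = binary k"
    using len by (simp_all add: w nth_append)
  assume ij: "i < n" "j < n"
  then have "i * n + j < n * n"
    by (metis add.commute less_le_trans mult_Suc mult_le_mono1 nat_add_left_cancel_less Suc_leI)
  then have "w ! (Suc n + i * n + j) = adjacency_bits G ! (i * n + j)"
    using len by (simp add: w nth_append)
  also have "\<dots> = ((i, j) \<in> parcs G)"
    using nth_concat_rows[OF ij, of "\<lambda>i j. (i, j) \<in> parcs G"] n by (simp add: adjacency_bits_def Let_def)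
  finally show "w ! (Suc n + i * n + j) \<longleftrightarrow> (i, j) \<in> parcs G" by simp
qed

lemma encode_matrix_graph:
  assumes "well_formed w n"
  shows "w = encode_instance (matrix_graph w n) (bits_value (drop (Suc n + n * n) w))"
proof -
  let ?s = "Suc n + n * n" and ?G = "matrix_graph w n"
  let ?b = "drop ?s w"
  have wf: "n < length w" "\<not> w ! n" "\<forall>y<n. w ! y" "?s < length w" "last w"
    using assms by (auto simp: well_formed_def)
  have card: "card (pverts ?G) = n" by (simp add: matrix_graph_def)
  have "last ?b" using wf by (simp add: last_drop)
  then have b: "binary (bits_value ?b) = ?b" by (intro binary_bits_value) simp
  note enc = nth_encode_instance[where k = "bits_value ?b", OF card, unfolded b]
  show ?thesis
  proof (rule nth_equalityI)
    show len: "length w = length (encode_instance ?G (bits_value ?b))"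
      using enc(1) wf(4) by simp
    fix p assume p: "p < length w"
    consider "p < n" | "p = n" | "n < p" "p < ?s" | "?s \<le> p" by linarith
    then show "w ! p = encode_instance ?G (bits_value ?b) ! p"
    proof cases
      case 1
      then show ?thesis using enc(2) wf(3) by simp
    next
      case 2
      then show ?thesis using enc(3) wf(2) by simp
    next
      case 3
      \<comment> \<open>Entry \<open>q\<close> of the matrix belongs to row \<open>q div n\<close>
        and column \<open>q mod n\<close>.\<close>
      define q where "q = p - Suc n"
      have q: "p = Suc n + q" "q < n * n" using 3 by (auto simp: q_def)
      then have "0 < n" by (cases n) auto
      have ij: "q div n < n" "q mod n < n" "q div n * n + q mod n = q"
        using q(2) \<open>0 < n\<close> by (auto simp: less_mult_imp_div_less)
      then have "p = Suc n + q div n * n + q mod n" using q(1) by simp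
      then show ?thesis
        using enc(4)[OF ij(1,2)] ij(1,2) by (simp add: matrix_graph_def matrix_entry_def)
    next
      case 4
      then have "w ! p = ?b ! (p - ?s)" using wf(4) by simp
      also have "\<dots> = drop ?s (encode_instance ?G (bits_value ?b)) ! (p - ?s)"
        using enc(5) by simp
      also have "\<dots> = encode_instance ?G (bits_value ?b) ! p"
        using 4 p len by simp
      finally show ?thesis .
    qed
  qed
qed

lemma pair_graph_matrix_graph:
  "pair_graph (matrix_graph w n) \<longleftrightarrow>
    (\<forall>i j. matrix_entry w n i j \<longrightarrow> matrix_entry w n j i \<and> i \<noteq> j)" (is "?L \<longleftrightarrow> ?R")
proof
  assume ?L
  then interpret pair_graph "matrix_graph w n" .
  show ?R
    using pair_sym_arcs pair_no_loops by (fastforce simp: matrix_graph_def symmetric_def sym_def)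
next
  assume R: ?R
  have "{(i, j). matrix_entry w n i j} \<subseteq> {0..<n} \<times> {0..<n}"
    by (auto simp: matrix_entry_def)
  then have "finite {(i, j). matrix_entry w n i j}"
    by (rule finite_subset) simp
  then show ?L
    using R by unfold_locales (auto simp: matrix_graph_def matrix_entry_def symmetric_def sym_def)
qed

lemma split_graph_matrix_graph:
  "split_graph (matrix_graph w n) \<longleftrightarrow>
    (\<forall>i j. matrix_entry w n i j \<longrightarrow> matrix_entry w n j i \<and> i \<noteq> j) \<and> (\<exists>Q. split_on (matrix_entry w n) n Q)"
  (is "_ \<longleftrightarrow> ?S \<and> ?Q")
proof -
  have "(\<exists>K I. K \<union> I = {0..<n} \<and> K \<inter> I = {} \<and>
        (\<forall>u\<in>K. \<forall>v\<in>K. u \<noteq> v \<longrightarrow> matrix_entry w n u v) \<and>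
        (\<forall>u\<in>I. \<forall>v\<in>I. \<not> matrix_entry w n u v)) \<longleftrightarrow> ?Q" (is "?P \<longleftrightarrow> _") if S: ?S
  proof
    assume ?P
    then obtain K I where KI: "K \<union> I = {0..<n}" "\<forall>u\<in>K. \<forall>v\<in>K. u \<noteq> v \<longrightarrow> matrix_entry w n u v"
      "\<forall>u\<in>I. \<forall>v\<in>I. \<not> matrix_entry w n u v" by blast
    have "y \<in> K \<or> y \<in> I" if "y < n" for y using KI(1) that by auto
    then have "split_on (matrix_entry w n) n (\<lambda>y. y \<in> K)"
      unfolding split_on_def using KI(2,3) by blast
    then show ?Q by blast
  next
    assume ?Q
    then obtain Q where Q: "split_on (matrix_entry w n) n Q" by blast
    show ?P
    proof (rule exI[of _ "{y. y < n \<and> Q y}"], rule exI[of _ "{y. y < n \<and> \<not> Q y}"], intro conjI ballI impI)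
      fix u v
      assume "u \<in> {y. y < n \<and> \<not> Q y}" "v \<in> {y. y < n \<and> \<not> Q y}"
      then show "\<not> matrix_entry w n u v"
        using Q S unfolding split_on_def by (cases "u = v") blast+
    qed (use Q in \<open>auto simp: split_on_def\<close>)
  qed
  then show ?thesis
    unfolding split_graph_def pair_graph_matrix_graph by (auto simp: matrix_graph_def)
qed

text \<open>The instance is no longer an arbitrary preimage of \<open>w\<close> but is read off the
  word; in this form the language can be compared with the program.\<close>

lemma split_monophonic_rank_iff:
  "w \<in> split_monophonic_rank \<longleftrightarrow> (\<exists>n. well_formed w n \<and> split_graph (matrix_graph w n) \<and>
    (\<exists>S. monophonic_convexly_independent (matrix_graph w n) S \<and> bits_value (drop (Suc n + n * n) w) \<le> card S))"
proof
  assume "w \<in> split_monophonic_rank"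
  then obtain G k S where G: "w = encode_instance G k" "split_graph G" "pverts G = {0..<card (pverts G)}"
    "0 < k" "monophonic_convexly_independent G S" "k \<le> card S"
    by (auto simp: split_monophonic_rank_def)
  define n where "n = card (pverts G)"
  note enc = nth_encode_instance[where k = k, OF n_def[symmetric], folded G(1)]
  have ne: "binary k \<noteq> []" "last (binary k)" using last_binary[OF G(4)] by auto
  have len: "Suc n + n * n < length w"
    using enc(1) ne(1) by simp
  then have "last w = last (drop (Suc n + n * n) w)"
    by (simp add: last_drop)
  then have "last w" using enc(5) ne(2) by simp
  then have wf: "well_formed w n"
    using enc(2,3) len by (simp add: well_formed_def)
  interpret pair_graph G using G(2) by (simp add: split_graph_def)
  have "parcs G \<subseteq> {0..<n} \<times> {0..<n}"
    using in_arcsD1 in_arcsD2 G(3) unfolding n_def by fastforce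
  then have "{(i, j). matrix_entry w n i j} = parcs G"
    using enc(4) by (auto simp: matrix_entry_def)
  then have "matrix_graph w n = G"
    using G(3) by (cases G) (simp add: matrix_graph_def n_def)
  then show "\<exists>n. well_formed w n \<and> split_graph (matrix_graph w n) \<and>
    (\<exists>S. monophonic_convexly_independent (matrix_graph w n) S \<and> bits_value (drop (Suc n + n * n) w) \<le> card S)"
    using wf G(2,5,6) enc(5) by (intro exI[of _ n]) (auto simp: bits_value_binary)
next
  assume "\<exists>n. well_formed w n \<and> split_graph (matrix_graph w n) \<and>
    (\<exists>S. monophonic_convexly_independent (matrix_graph w n) S \<and> bits_value (drop (Suc n + n * n) w) \<le> card S)"
  then obtain n S where n: "well_formed w n" "split_graph (matrix_graph w n)"
    "monophonic_convexly_independent (matrix_graph w n) S" "bits_value (drop (Suc n + n * n) w) \<le> card S"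
    by blast
  let ?b = "drop (Suc n + n * n) w"
  have "last ?b" "?b \<noteq> []"
    using n(1) by (simp_all add: well_formed_def last_drop)
  then have "binary (bits_value ?b) = ?b" "?b \<noteq> []" by (simp_all add: binary_bits_value)
  then have "0 < bits_value ?b" by (cases "bits_value ?b = 0") (auto simp: binary.simps)
  then show "w \<in> split_monophonic_rank"
    unfolding split_monophonic_rank_def using encode_matrix_graph[OF n(1)] n(2-4)
    by (intro CollectI exI[of _ "matrix_graph w n"] exI[of _ "bits_value ?b"]) (auto simp: matrix_graph_def)
qed

text \<open>The program tries every index of the universe, and all indices from \<open>n\<close> on
  describe the same case.\<close>

lemma ex_index_cong:
  assumes "n < N"
  shows "(\<exists>i<N. \<exists>J. bip_indep A (left_part A n kk i) (right_part A n kk i) J \<and>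
      k \<le> card J + (if i < n \<and> \<not> kk i then 1 else 0)) \<longleftrightarrow>
    (\<exists>i\<le>n. \<exists>J. bip_indep A (left_part A n kk i) (right_part A n kk i) J \<and>
      k \<le> card J + (if i < n \<and> \<not> kk i then 1 else 0))" (is "(\<exists>i<N. ?P i) \<longleftrightarrow> (\<exists>i\<le>n. ?P i)")
proof
  assume "\<exists>i<N. ?P i"
  then obtain i where i: "i < N" "?P i" by blast
  show "\<exists>i\<le>n. ?P i"
  proof (cases "i < n")
    case True
    then have "i \<le> n" by simp
    then show ?thesis using i(2) by blast
  next
    case False
    then have "left_part A n kk i = left_part A n kk n" "right_part A n kk i = right_part A n kk n"
      by (simp_all add: left_part_def right_part_def)
    then have "?P n" using i(2) False by simp
    then show ?thesis by blast
  qed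
next
  assume "\<exists>i\<le>n. ?P i"
  then show "\<exists>i<N. ?P i" using assms order_le_less_trans by blast
qed

section \<open>Correctness of the decision program\<close>

lemma validate_correct:
  assumes n: "n < N" "\<And>x. x < N \<Longrightarrow> m NN [x] \<longleftrightarrow> x = n"
    and row: "\<And>p. p < N \<Longrightarrow> m ROW [n, p] \<longleftrightarrow> p = s"
  shows "sem N validate env m RES [0] \<longleftrightarrow> m RES [0] \<and> s < N \<and> m W [N - 1] \<and>
    (\<forall>i<N. \<forall>j<N. edge m i j \<longrightarrow> edge m j i \<and> i \<noteq> j) \<and> split_on (edge m) n (\<lambda>y. m KK [y])"
proof -
  have v: "holds N m e (is_vertex V3 x) \<longleftrightarrow> e x < n" if "x \<noteq> V3" for e x
    using that n by (simp add: holds_is_vertex[of _ _ n])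
  have "sem N validate env m RES [0] \<longleftrightarrow> m RES [0] \<and>
      (\<exists>a<N. \<exists>p<N. \<exists>l<N. a = n \<and> m ROW [a, p] \<and> Suc l = N \<and> m W [l]) \<and>
      (\<forall>i<N. \<forall>j<N. (edge m i j \<longrightarrow> edge m j i \<and> i \<noteq> j) \<and>
        (i < n \<and> j < n \<and> i \<noteq> j \<longrightarrow> (m KK [i] \<and> m KK [j] \<longrightarrow> edge m i j) \<and>
          (\<not> m KK [i] \<and> \<not> m KK [j] \<longrightarrow> \<not> edge m i j)))"
    using n by (simp add: validate_def v cong: conj_cong)
  moreover have "(\<exists>a<N. \<exists>p<N. \<exists>l<N. a = n \<and> m ROW [a, p] \<and> Suc l = N \<and> m W [l]) \<longleftrightarrow>
      s < N \<and> m W [N - 1]"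
    using n(1) row by (cases N) (auto simp: less_Suc_eq)
  moreover have "split_on (edge m) n (\<lambda>y. m KK [y]) \<longleftrightarrow>
    (\<forall>i<N. \<forall>j<N. i < n \<and> j < n \<and> i \<noteq> j \<longrightarrow> (m KK [i] \<and> m KK [j] \<longrightarrow> edge m i j) \<and>
          (\<not> m KK [i] \<and> \<not> m KK [j] \<longrightarrow> \<not> edge m i j))"
    unfolding split_on_def using n(1) by (meson order_less_trans)
  ultimately show ?thesis by blast
qed

text \<open>Words without a terminator, words with an unacceptable length or last bit, and
  well-formed words are treated separately. On the last kind the answer of the search matters only
  for split graphs, because \<open>validate\<close> rejects the others.\<close>

lemma decide_correct:
  assumes "w \<noteq> []"
  shows "sem (length w) decide env (init_memory W w) RES [0] \<longleftrightarrow> w \<in> split_monophonic_rank"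
proof -
  define N where "N = length w"
  define m0 where "m0 = init_memory W w"
  define m1 where "m1 = sem N find_size env m0"
  define m2 where "m2 = sem N compute_plus env m1"
  define m3 where "m3 = sem N find_rows env m2"
  define m4 where "m4 = sem N read_matrix env m3"
  define m5 where "m5 = sem N read_values env m4"
  define m6 where "m6 = sem N find_partition env m5"
  define m7 where "m7 = sem N (For V9 solve_index) env m6"
  have final: "sem (length w) decide env (init_memory W w) = sem N validate env m7"
    by (simp add: decide_def m0_def m1_def m2_def m3_def m4_def m5_def m6_def m7_def N_def del: sem.simps(3))
  have f1: "m1 r = m0 r" if "r \<noteq> NN" for r
    unfolding m1_def by (rule sem_frame) (use that in \<open>simp add: find_size_def\<close>)
  have f2: "m2 r = m1 r" if "r \<noteq> PLUS" for r
    unfolding m2_def by (rule sem_frame) (use that in \<open>simp add: compute_plus_def\<close>)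
  have f3: "m3 r = m2 r" if "r \<noteq> ROW" for r
    unfolding m3_def by (rule sem_frame) (use that in \<open>simp add: find_rows_def\<close>)
  have f4: "m4 r = m3 r" if "r \<noteq> ADJ" for r
    unfolding m4_def by (rule sem_frame) (use that in \<open>simp add: read_matrix_def\<close>)
  have f5: "m5 r = m4 r" if "r \<noteq> VAL" for r
    unfolding m5_def by (rule sem_frame) (use that in \<open>simp add: read_values_def\<close>)
  have f6: "m6 r = m5 r" if "r \<notin> {KK, K2}" for r
    unfolding m6_def by (rule sem_frame)
      (use that in \<open>simp add: find_partition_def extend_partition_def try_candidate_def\<close>)
  have f7: "m7 r = m6 r" if "r \<in> {W, NN, ROW, ADJ, KK}" for r
    unfolding m7_def by (rule sem_frame)
      (use that in \<open>auto simp: solve_index_def init_auction_def run_auction_def bid_step_def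
        collect_def count_def accept_large_def\<close>)
  have W: "m0 W [p] \<longleftrightarrow> w ! p" for p by (simp add: m0_def init_memory_def)
  have m0: "\<not> m0 r ys" if "r \<noteq> W" for r ys using that by (simp add: m0_def init_memory_def)
  have W7: "m7 W [p] \<longleftrightarrow> w ! p" for p
    using W by (simp add: f1 f2 f3 f4 f5 f6 f7)
  have NN1: "m1 NN [x] \<longleftrightarrow> \<not> w ! x \<and> (\<forall>y<x. w ! y)" if "x < N" for x
    using size_correct[OF that] W by (simp add: m1_def)
  have N7: "m7 NN = m1 NN" by (simp add: f2 f3 f4 f5 f6 f7)
  show ?thesis
  proof (cases "\<exists>n<N. \<not> w ! n \<and> (\<forall>y<n. w ! y)")
    case False
    then have "\<not> m7 NN [x]" if "x < N" for x using NN1[OF that] that N7 by auto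
    moreover have "0 < N" using assms by (simp add: N_def)
    ultimately have "\<not> sem N validate env m7 RES [0]"
      by (simp add: validate_def cong: conj_cong)
    moreover have "\<not> well_formed w n" for n
      using False unfolding well_formed_def N_def by blast
    ultimately show ?thesis
      unfolding final split_monophonic_rank_iff by blast
  next
    case True
    then obtain n where n: "n < N" "\<not> w ! n" "\<forall>y<n. w ! y" by blast
    let ?s = "Suc n + n * n" and ?A = "matrix_entry w n" and ?kk = "\<lambda>y. m6 KK [y]"
    let ?k = "bits_value (drop ?s w)"
    have NN: "m1 NN [x] \<longleftrightarrow> x = n" if "x < N" for x
      using NN1[OF that] n by (metis linorder_less_linear)
    have PLUS: "m2 PLUS [a, b, c] \<longleftrightarrow> a + b = c" if "a < N" "b < N" "c < N" for a b c
      using plus_correct[OF that] by (simp add: m2_def)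
    have ROW: "m3 ROW [i, p] \<longleftrightarrow> p = Suc n + i * n" if "i < N" "p < N" for i p
      unfolding m3_def by (rule rows_correct) (use n(1) NN PLUS f2 that in simp_all)
    have ADJ: "m4 ADJ [i, j] \<longleftrightarrow> i < n \<and> j < n \<and> Suc n + i * n + j < N \<and> w ! (Suc n + i * n + j)"
      if "i < N" "j < N" for i j
    proof -
      have "m4 ADJ [i, j] \<longleftrightarrow> i < n \<and> j < n \<and> Suc n + i * n + j < N \<and> m3 W [Suc n + i * n + j]"
        unfolding m4_def by (rule matrix_correct) (use n(1) NN PLUS ROW f2 f3 that in simp_all)
      then show ?thesis using W by (simp add: f1 f2 f3)
    qed
    have VAL: "m5 VAL [p, v] \<longleftrightarrow> v = bits_value (drop p w)" if "p < N" "v < N" for p v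
      unfolding m5_def by (rule values_correct) (use N_def PLUS W f1 f2 f3 f4 that in simp_all)
    have R7: "m7 ROW [n, p] \<longleftrightarrow> p = ?s" if "p < N" for p
      using ROW[OF n(1) that] by (simp add: f4 f5 f6 f7)
    have E6: "m6 ADJ = m4 ADJ" by (simp add: f5 f6)
    have E7: "m7 ADJ = m6 ADJ" "m7 KK = m6 KK" by (simp_all add: f7)
    have dec: "sem N validate env m7 RES [0] \<longleftrightarrow> m7 RES [0] \<and> ?s < N \<and> w ! (N - 1) \<and>
        (\<forall>i<N. \<forall>j<N. edge m6 i j \<longrightarrow> edge m6 j i \<and> i \<noteq> j) \<and> split_on (edge m6) n ?kk"
      using validate_correct[where m = m7 and n = n and N = N and s = ?s and env = env] n(1) NN N7 R7 W7 E7 by simp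
    have wf: "well_formed w n \<longleftrightarrow> ?s < N \<and> w ! (N - 1)"
      using n assms by (auto simp: well_formed_def N_def last_conv_nth)
    have rank: "w \<in> split_monophonic_rank \<longleftrightarrow> well_formed w n \<and> split_graph (matrix_graph w n) \<and>
        (\<exists>S. monophonic_convexly_independent (matrix_graph w n) S \<and> ?k \<le> card S)"
    proof -
      \<comment> \<open>The terminator is the first bit \<open>False\<close>, so no other size can
        parse the same word.\<close>
      have "n' = n" if "well_formed w n'" for n'
      proof (rule ccontr)
        assume "n' \<noteq> n"
        then consider "n' < n" | "n < n'" by linarith
        then show False
          using that n unfolding well_formed_def by cases blast+
      qed
      then show ?thesis unfolding split_monophonic_rank_iff by blast
    qed
    show ?thesis
    proof (cases "?s < N \<and> w ! (N - 1)")
      case False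
      then show ?thesis unfolding final dec rank wf by blast
    next
      case True
      \<comment> \<open>In a word that reaches beyond the matrix, the range test in
        \<open>ADJ\<close> succeeds for every entry, so the computed relation is the matrix.\<close>
      have A: "edge m6 i j \<longleftrightarrow> ?A i j" if "i < N" "j < N" for i j
      proof -
        have "Suc n + i * n + j < N" if "i < n" "j < n"
        proof -
          have "i * n + n \<le> n * n" using that(1) mult_le_mono1[of "Suc i" n n] by simp
          then show ?thesis using that(2) True by linarith
        qed
        then show ?thesis using ADJ[OF that] unfolding E6 matrix_entry_def by blast
      qed
      have A_less: "?A i j \<Longrightarrow> i < n \<and> j < n" for i j by (simp add: matrix_entry_def)
      have sym: "(\<forall>i<N. \<forall>j<N. edge m6 i j \<longrightarrow> edge m6 j i \<and> i \<noteq> j) \<longleftrightarrow>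
          (\<forall>i j. ?A i j \<longrightarrow> ?A j i \<and> i \<noteq> j)"
      proof (intro iffI allI impI)
        fix i j
        assume *: "\<forall>i<N. \<forall>j<N. edge m6 i j \<longrightarrow> edge m6 j i \<and> i \<noteq> j" and ij: "?A i j"
        have "i < N" "j < N" using A_less[OF ij] n(1) by simp_all
        then show "?A j i \<and> i \<noteq> j" using * ij A by blast
      next
        fix i j
        assume "\<forall>i j. ?A i j \<longrightarrow> ?A j i \<and> i \<noteq> j" "i < N" "j < N" "edge m6 i j"
        then show "edge m6 j i \<and> i \<noteq> j" using A by blast
      qed
      have "edge m6 i j \<longleftrightarrow> ?A i j" if "i < n" "j < n" for i j
        using A that n(1) by simp
      then have split: "split_on (edge m6) n Q \<longleftrightarrow> split_on ?A n Q" for Q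
        unfolding split_on_def by simp
      \<comment> \<open>The existence of any partition makes the search succeed, so testing the
        computed one decides existence.\<close>
      have KK: "split_on (edge m6) n Q \<Longrightarrow> split_on (edge m6) n ?kk" for Q
      proof -
        assume Q: "split_on (edge m6) n Q"
        have "split_on (edge m5) n (\<lambda>y. sem N find_partition env m5 KK [y])"
          by (rule partition_correct[where n = n and N = N and Q = Q])
            (use n(1) NN m0 Q in \<open>simp_all add: f1 f2 f3 f4 f5 f6\<close>)
        then show ?thesis by (simp add: m6_def[symmetric] f6)
      qed
      have graph: "split_graph (matrix_graph w n) \<longleftrightarrow>
          (\<forall>i<N. \<forall>j<N. edge m6 i j \<longrightarrow> edge m6 j i \<and> i \<noteq> j) \<and> split_on (edge m6) n ?kk"
        unfolding split_graph_matrix_graph sym split[symmetric] using KK by blast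
      have "m7 RES [0] \<longleftrightarrow> (\<exists>S. monophonic_convexly_independent (matrix_graph w n) S \<and> ?k \<le> card S)"
        if G: "split_graph (matrix_graph w n)"
      proof -
        have "pair_graph (matrix_graph w n)" "pverts (matrix_graph w n) = {0..<n}"
          using G by (simp_all add: split_graph_def matrix_graph_def)
        moreover have "edge m6 u v \<longleftrightarrow> (u, v) \<in> parcs (matrix_graph w n)" if "u < n" "v < n" for u v
          using A[of u v] that n(1) by (simp add: matrix_graph_def)
        moreover have S: "split_on (edge m6) n ?kk" using G graph by blast
        ultimately have 1: "(\<exists>S. monophonic_convexly_independent (matrix_graph w n) S \<and> ?k \<le> card S) \<longleftrightarrow>
            (\<exists>i\<le>n. \<exists>J. bip_indep (edge m6) (left_part (edge m6) n ?kk i) (right_part (edge m6) n ?kk i) J \<and>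
              ?k \<le> card J + (if i < n \<and> \<not> ?kk i then 1 else 0))"
          by (intro independent_set_iff_bip_indep)
        have adj: "u < n \<and> v < n \<and> u \<noteq> v" if "u < N" "v < N" "edge m6 u v" for u v
          using A[OF that(1,2)] A_less that G graph by blast
        have "m7 RES [0] \<longleftrightarrow>
            (\<exists>i<N. \<exists>J. bip_indep (edge m6) (left_part (edge m6) n ?kk i) (right_part (edge m6) n ?kk i) J \<and>
              ?k \<le> card J + (if i < n \<and> \<not> ?kk i then 1 else 0))"
          unfolding m7_def
        proof (rule solve_correct[where s = ?s])
          show "n < N" "?s < N" using n(1) True by simp_all
          show "m6 NN [x] \<longleftrightarrow> x = n" if "x < N" for x
            using NN[OF that] by (simp add: f2 f3 f4 f5 f6)
          show "m6 ROW [n, p] \<longleftrightarrow> p = ?s" if "p < N" for p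
            using ROW[OF n(1) that] by (simp add: f4 f5 f6)
          show "m6 VAL [?s, v] \<longleftrightarrow> v = ?k" if "v < N" for v
            using VAL[OF _ that, of ?s] True by (simp add: f6)
          show "\<not> m6 RES [0]" using m0 by (simp add: f1 f2 f3 f4 f5 f6)
        qed (fact S adj)+
        then show ?thesis unfolding 1 ex_index_cong[OF n(1)] .
      qed
      then show ?thesis
        unfolding final dec rank wf graph[symmetric] using True graph by blast
    qed
  qed
qed

theorem theorem16:
  shows "split_monophonic_rank \<in> class_P"
proof (rule relational_program_class_P[OF wf_decide])
  show "arity W = 1" "arity RES = 1" by simp_all
  \<comment> \<open>An encoding contains at least the terminator, so rejecting the empty word agrees
    with the language.\<close>
  have "[] \<notin> split_monophonic_rank"
    by (auto simp: split_monophonic_rank_iff well_formed_def)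
  then show "w \<in> split_monophonic_rank \<longleftrightarrow>
      w \<noteq> [] \<and> sem (length w) decide (\<lambda>_. 0) (init_memory W w) RES [0]" for w
    using decide_correct[of w "\<lambda>_. 0"] by blast
qed

end
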